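(* For every integer $n\ge 2$, $\mathrm{gr}(I_n)$ is naturally isomorphic to $\mathcal{L}_1(I_n)$ as a Lie algebra; that is, there exists a Lie algebra isomorphism $\zeta:\mathrm{gr}(I_n)\to\mathcal{L}_1(I_n)$ such that $\zeta(y_{ij}I_n')=y_{ij}\,\mathrm{I}_3\mathrm{A}(F_n)$ for all $2\le i\le n$, $1\le j\le i$.
   Context: $F_n$ is the free group on $\{x_1,\ldots,x_n\}$. For $2\le m\le n$ and $1\le i\le m$ let $y_{mi}\in\mathrm{Aut}(F_n)$ be given by $y_{mi}(x_k)=x_i^{-1}x_kx_i$ for $k\le m$ and $y_{mi}(x_k)=x_k$ for $k>m$. $I_n$ is the subgroup of $\mathrm{Aut}(F_n)$ generated by all these $y_{mi}$. For a group $G$, $\gamma_c(G)$ is the $c$-th term of the lower central series, $G'=\gamma_2(G)$, and $\mathrm{gr}(G)=\bigoplus_{c\ge1}\gamma_c(G)/\gamma_{c+1}(G)$ is the associated graded Lie algebra over $\mathbb{Z}$, with bracket induced by the group commutator $[a,b]=a^{-1}b^{-1}ab$. For $c\ge2$, $\mathrm{I}_c\mathrm{A}(F_n)$ is the kernel of the natural homomorphism $\mathrm{Aut}(F_n)\to\mathrm{Aut}(F_n/\gamma_c(F_n))$, and $\mathrm{IA}(F_n)=\mathrm{I}_2\mathrm{A}(F_n)$. One has $[\mathrm{I}_t\mathrm{A}(F_n),\mathrm{I}_s\mathrm{A}(F_n)]\subseteq \mathrm{I}_{t+s-1}\mathrm{A}(F_n)$ for $t,s\ge 2$, and $\gamma_c(\mathrm{IA}(F_n))\subseteq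 \mathrm{I}_{c+1}\mathrm{A}(F_n)$. The Andreadakis–Johnson Lie algebra is $\mathcal{L}(\mathrm{IA}(F_n))=\bigoplus_{r\ge2}\mathrm{I}_r\mathrm{A}(F_n)/\mathrm{I}_{r+1}\mathrm{A}(F_n)$, graded with the $r$-th summand in degree $r-1$, with bracket $[\phi\,\mathrm{I}_{j+1}\mathrm{A}(F_n),\psi\,\mathrm{I}_{k+1}\mathrm{A}(F_n)]=(\phi^{-1}\psi^{-1}\phi\psi)\,\mathrm{I}_{j+k}\mathrm{A}(F_n)$ for $\phi\in \mathrm{I}_j\mathrm{A}(F_n)$, $\psi\in \mathrm{I}_k\mathrm{A}(F_n)$, extended linearly. For a subgroup $G\le\mathrm{IA}(F_n)$ and $q\ge1$ put $\mathcal{L}_1^q(G)=\gamma_q(G)\,\mathrm{I}_{q+2}\mathrm{A}(F_n)/\mathrm{I}_{q+2}\mathrm{A}(F_n)$ and $\mathcal{L}_1(G)=\bigoplus_{q\ge1}\mathcal{L}_1^q(G)$, a Lie subalgebra of $\mathcal{L}(\mathrm{IA}(F_n))$. *)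

theory Defs
  imports "HOL-Algebra.Algebra"
begin

section \<open>Free groups\<close>

text \<open>
  The free group on a set \<open>S\<close> is realised by reduced words. The letter \<open>(k, True)\<close> stands for
  the generator \<open>k\<close> and \<open>(k, False)\<close> for its inverse.
\<close>

definition inv_letter :: "'a \<times> bool \<Rightarrow> 'a \<times> bool" where
  "inv_letter a = (fst a, \<not> snd a)"

definition reduced :: "('a \<times> bool) list \<Rightarrow> bool" where
  "reduced w \<longleftrightarrow> successively (\<lambda>a b. b \<noteq> inv_letter a) w"

fun push :: "'a \<times> bool \<Rightarrow> ('a \<times> bool) list \<Rightarrow> ('a \<times> bool) list" where
  "push a [] = [a]"
| "push a (b # w) = (if b = inv_letter a then w else a # b # w)"

definition free_group :: "'a set \<Rightarrow> ('a \<times> bool) list monoid" where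
  "free_group S =
    \<lparr>carrier = {w. reduced w \<and> fst ` set w \<subseteq> S},
     monoid.mult = (\<lambda>u v. foldr push u v),
     one = []\<rparr>"

definition gen :: "'a \<Rightarrow> ('a \<times> bool) list" where
  "gen k = [(k, True)]"

definition free_ext :: "('b, 'c) monoid_scheme \<Rightarrow> ('a \<Rightarrow> 'b) \<Rightarrow> ('a \<times> bool) list \<Rightarrow> 'b" where
  "free_ext G f w =
     foldr (\<lambda>(k, e) g. (if e then f k else inv\<^bsub>G\<^esub> (f k)) \<otimes>\<^bsub>G\<^esub> g) w \<one>\<^bsub>G\<^esub>"

lemma inv_letter_simps [simp]:
  "inv_letter (inv_letter a) = a" "inv_letter a \<noteq> a" "fst (inv_letter a) = fst a"
  "inv_letter (k, e) = (k, \<not> e)"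
  by (auto simp: inv_letter_def prod_eq_iff)

lemma reduced_simps [simp]:
  "reduced []" "reduced [a]" "reduced (a # b # w) \<longleftrightarrow> b \<noteq> inv_letter a \<and> reduced (b # w)"
  by (auto simp: reduced_def)

lemma reduced_tl: "reduced (a # w) \<Longrightarrow> reduced w"
  by (cases w) auto

lemma reduced_push: "reduced w \<Longrightarrow> reduced (push a w)"
  by (cases w) (auto dest: reduced_tl)

lemma set_push: "set (push a w) \<subseteq> insert a (set w)"
  by (cases w) auto

lemma push_inv_letter: "reduced w \<Longrightarrow> push a (push (inv_letter a) w) = w"
  by (cases w; cases "tl w") (auto dest: reduced_tl)

lemma push_reduced: "reduced (a # w) \<Longrightarrow> push a w = a # w"
  by (cases w) auto

lemma reduced_foldr_push: "reduced v \<Longrightarrow> reduced (foldr push u v)"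
  by (induction u) (auto intro: reduced_push)

lemma set_foldr_push: "set (foldr push u v) \<subseteq> set u \<union> set v"
  by (induction u) (use set_push in fastforce)+

lemma foldr_push_push:
  assumes "reduced w"
  shows "foldr push (push a u) w = push a (foldr push u w)"
proof (cases u)
  case (Cons b u')
  then show ?thesis
    using push_inv_letter[OF reduced_foldr_push[OF assms], of a u'] by auto
qed auto

lemma foldr_push_assoc:
  "reduced w \<Longrightarrow> foldr push (foldr push u v) w = foldr push u (foldr push v w)"
  by (induction u) (auto simp: foldr_push_push)

lemma foldr_push_Nil: "reduced u \<Longrightarrow> foldr push u [] = u"
proof (induction u)
  case (Cons a u)
  then show ?case
    using reduced_tl[of a u] push_reduced[of a u] by simp
qed simp

lemma foldr_push_rev:
  "reduced w \<Longrightarrow> foldr push (map inv_letter (rev u)) (foldr push u w) = w"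
proof (induction u arbitrary: w)
  case (Cons a u)
  then show ?case
    using push_inv_letter[OF reduced_foldr_push[of w u], of "inv_letter a"] by auto
qed auto

lemma group_free_group: "group (free_group S)"
proof (rule groupI)
  fix x assume x: "x \<in> carrier (free_group S)"
  define y where "y = foldr push (map inv_letter (rev x)) []"
  have "y \<in> carrier (free_group S)"
    using x set_foldr_push[of "map inv_letter (rev x)" "[]"]
    by (fastforce simp: y_def free_group_def intro!: reduced_foldr_push)
  moreover have "y \<otimes>\<^bsub>free_group S\<^esub> x = \<one>\<^bsub>free_group S\<^esub>"
  proof -
    have x': "foldr push x [] = x" "reduced x"
      using x by (auto simp: free_group_def foldr_push_Nil)
    have "foldr push y x = foldr push (map inv_letter (rev x)) (foldr push x [])"
      using x' by (simp add: y_def foldr_push_assoc)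
    then show ?thesis
      using foldr_push_rev[of "[]" x] by (simp add: free_group_def)
  qed
  ultimately show "\<exists>y\<in>carrier (free_group S). y \<otimes>\<^bsub>free_group S\<^esub> x = \<one>\<^bsub>free_group S\<^esub>"
    by blast
next
  fix x y assume "x \<in> carrier (free_group S)" "y \<in> carrier (free_group S)"
  then show "x \<otimes>\<^bsub>free_group S\<^esub> y \<in> carrier (free_group S)"
    using set_foldr_push[of x y] by (fastforce simp: free_group_def intro!: reduced_foldr_push)
qed (auto simp: free_group_def foldr_push_assoc)

lemma gen_in_free_group: "k \<in> S \<Longrightarrow> gen k \<in> carrier (free_group S)"
  by (simp add: gen_def free_group_def)

lemma (in group) free_ext_closed:
  "f \<in> S \<rightarrow> carrier G \<Longrightarrow> fst ` set w \<subseteq> S \<Longrightarrow> free_ext G f w \<in> carrier G"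
  by (induction w) (auto simp: free_ext_def Pi_iff)

lemma (in group) free_ext_push:
  assumes f: "f \<in> S \<rightarrow> carrier G" and a: "fst a \<in> S" and w: "fst ` set w \<subseteq> S"
  shows "free_ext G f (push a w) = free_ext G f [a] \<otimes> free_ext G f w"
proof (cases w)
  case Nil
  then show ?thesis
    using f a by (cases a) (auto simp: free_ext_def Pi_iff)
next
  case (Cons b w')
  have [simp]: "f (fst a) \<in> carrier G" "free_ext G f w' \<in> carrier G" "f (fst b) \<in> carrier G"
    using assms Cons by (auto intro!: free_ext_closed[of f S])
  have [simp]:
    "free_ext G f (c # u) = (if snd c then f (fst c) else inv f (fst c)) \<otimes> free_ext G f u" for c u
    by (simp add: free_ext_def split_beta)
  have [simp]: "free_ext G f [] = \<one>"
    by (simp add: free_ext_def)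
  show ?thesis
    by (auto simp: Cons inv_letter_def m_assoc[symmetric])
qed

lemma (in group) free_ext_gen:
  "f k \<in> carrier G \<Longrightarrow> free_ext G f (gen k) = f k"
  by (simp add: free_ext_def gen_def)

lemma (in group) free_ext_hom:
  assumes f: "f \<in> S \<rightarrow> carrier G"
  shows "free_ext G f \<in> hom (free_group S) G"
proof (rule homI)
  fix u v assume u: "u \<in> carrier (free_group S)" and v: "v \<in> carrier (free_group S)"
  have "fst ` set u \<subseteq> S \<Longrightarrow> fst ` set v \<subseteq> S \<Longrightarrow>
      free_ext G f (foldr push u v) = free_ext G f u \<otimes> free_ext G f v"
  proof (induction u)
    case Nil
    then show ?case
      using free_ext_closed[OF f, of v] by (auto simp: free_ext_def)
  next
    case (Cons a u)
    have s: "fst ` set (foldr push u v) \<subseteq> S"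
      using Cons.prems set_foldr_push[of u v] by fastforce
    have *: "free_ext G f (a # u) = free_ext G f [a] \<otimes> free_ext G f u"
      using Cons.prems f free_ext_closed[OF f, of u]
      by (cases a) (auto simp: free_ext_def Pi_iff)
    show ?case
      using Cons free_ext_push[OF f _ s, of a] free_ext_closed[OF f]
      by (simp add: * m_assoc)
  qed
  then show "free_ext G f (u \<otimes>\<^bsub>free_group S\<^esub> v) = free_ext G f u \<otimes> free_ext G f v"
    using u v by (simp add: free_group_def)
qed (use free_ext_closed[OF f] in \<open>auto simp: free_group_def\<close>)

lemma (in group) free_hom_unique:
  assumes "g \<in> hom (free_group S) G" "h \<in> hom (free_group S) G"
    and eq: "\<And>k. k \<in> S \<Longrightarrow> g (gen k) = h (gen k)"
    and w: "w \<in> carrier (free_group S)"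
  shows "g w = h w"
proof -
  interpret F: group "free_group S" by (rule group_free_group)
  interpret g: group_hom "free_group S" G g
    using assms by unfold_locales auto
  interpret h: group_hom "free_group S" G h
    using assms by unfold_locales auto
  have letter: "[(k, e)] \<in> carrier (free_group S) \<and> g [(k, e)] = h [(k, e)]" if "k \<in> S" for k e
  proof (cases e)
    case False
    have c: "[(k, e)] \<in> carrier (free_group S)" for e
      using that by (simp add: free_group_def)
    have "[(k, False)] \<otimes>\<^bsub>free_group S\<^esub> gen k = \<one>\<^bsub>free_group S\<^esub>"
      by (simp add: free_group_def gen_def)
    then have "[(k, False)] = inv\<^bsub>free_group S\<^esub> gen k"
      using c gen_in_free_group[OF that] by (metis F.inv_equality)
    then show ?thesis
      using False c eq[OF that] gen_in_free_group[OF that] by simp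
  qed (use that eq[OF that] in \<open>auto simp: gen_def free_group_def\<close>)
  from w show ?thesis
  proof (induction w)
    case Nil
    then show ?case
      using g.hom_one h.hom_one by (simp add: free_group_def)
  next
    case (Cons a w)
    have w: "w \<in> carrier (free_group S)" and a: "fst a \<in> S"
      using Cons.prems by (auto simp: free_group_def dest: reduced_tl)
    have "a # w = [a] \<otimes>\<^bsub>free_group S\<^esub> w"
      using Cons.prems by (simp add: free_group_def push_reduced)
    then show ?case
      using Cons.IH[OF w] letter[OF a, of "snd a"] w by simp
  qed
qed


section \<open>Commutators and the lower central series\<close>

definition commutator :: "('a, 'b) monoid_scheme \<Rightarrow> 'a \<Rightarrow> 'a \<Rightarrow> 'a" where
  "commutator G a b = inv\<^bsub>G\<^esub> a \<otimes>\<^bsub>G\<^esub> inv\<^bsub>G\<^esub> b \<otimes>\<^bsub>G\<^esub> a \<otimes>\<^bsub>G\<^esub> b"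

definition commutator_subgroup :: "('a, 'b) monoid_scheme \<Rightarrow> 'a set \<Rightarrow> 'a set \<Rightarrow> 'a set" where
  "commutator_subgroup G H K = generate G {commutator G h k | h k. h \<in> H \<and> k \<in> K}"

text \<open>The series starts with index 1; the value at 0 is a convention and is never used.\<close>

fun lower_central :: "('a, 'b) monoid_scheme \<Rightarrow> nat \<Rightarrow> 'a set" where
  "lower_central G 0 = carrier G"
| "lower_central G (Suc 0) = carrier G"
| "lower_central G (Suc (Suc c)) = commutator_subgroup G (lower_central G (Suc c)) (carrier G)"


section \<open>Graded Lie rings of filtrations\<close>

text \<open>
  Lie algebras over the integers. The additive group is the one of the underlying \<open>monoid\<close>
  record: it is written multiplicatively, as are the library's factor groups and direct sums.
\<close>

record 'a lie_ring = "'a monoid" +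
  bracket :: "'a \<Rightarrow> 'a \<Rightarrow> 'a"

definition lie_iso :: "('a, 'c) lie_ring_scheme \<Rightarrow> ('b, 'd) lie_ring_scheme \<Rightarrow> ('a \<Rightarrow> 'b) set" where
  "lie_iso L M = {h \<in> iso L M. \<forall>x\<in>carrier L. \<forall>y\<in>carrier L.
     h (bracket L x y) = bracket M (h x) (h y)}"

text \<open>
  In what follows \<open>N 1\<close>, \<open>N 2\<close>, ... is a descending sequence of subgroups of \<open>G\<close> such that
  \<open>[N p, N q]\<close> is contained in \<open>N (p + q)\<close>.
\<close>

definition graded_piece :: "('a, 'b) monoid_scheme \<Rightarrow> (nat \<Rightarrow> 'a set) \<Rightarrow> nat \<Rightarrow> 'a set monoid" where
  "graded_piece G N q = (G\<lparr>carrier := N q\<rparr>) Mod N (Suc q)"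

text \<open>
  The class of \<open>[a, b]\<close> modulo \<open>N (p + q + 1)\<close> does not depend on the representatives \<open>a\<close>, \<open>b\<close>
  of the cosets \<open>A\<close>, \<open>B\<close>, so that the union below is a union of equal cosets.
\<close>

definition piece_bracket ::
  "('a, 'b) monoid_scheme \<Rightarrow> (nat \<Rightarrow> 'a set) \<Rightarrow> nat \<Rightarrow> nat \<Rightarrow> 'a set \<Rightarrow> 'a set \<Rightarrow> 'a set" where
  "piece_bracket G N p q A B = (\<Union>a\<in>A. \<Union>b\<in>B. N (Suc (p + q)) #>\<^bsub>G\<^esub> commutator G a b)"

definition filtration_lie ::
  "('a, 'b) monoid_scheme \<Rightarrow> (nat \<Rightarrow> 'a set) \<Rightarrow> (nat \<Rightarrow> 'a set) lie_ring" where
  "filtration_lie G N =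
    \<lparr>carrier = carrier (sum_group {1..} (graded_piece G N)),
     monoid.mult = monoid.mult (sum_group {1..} (graded_piece G N)),
     one = one (sum_group {1..} (graded_piece G N)),
     bracket = (\<lambda>f g. \<lambda>r\<in>{1..}. finprod (graded_piece G N r)
       (\<lambda>p. piece_bracket G N p (r - p) (f p) (g (r - p))) {1..<r})\<rparr>"

text \<open>The element of the direct sum whose degree \<open>d\<close> component is the coset \<open>A\<close> and whose other
  components are trivial.\<close>

definition homogeneous :: "(nat \<Rightarrow> 'a set) \<Rightarrow> nat \<Rightarrow> 'a set \<Rightarrow> nat \<Rightarrow> 'a set" where
  "homogeneous N d A = (\<lambda>q\<in>{1..}. if q = d then A else N (Suc q))"

definition gr :: "('a, 'b) monoid_scheme \<Rightarrow> (nat \<Rightarrow> 'a set) lie_ring" where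
  "gr G = filtration_lie G (lower_central G)"


section \<open>Automorphisms of free groups\<close>

type_synonym word = "(nat \<times> bool) list"

abbreviation Fn :: "nat \<Rightarrow> word monoid" where
  "Fn n \<equiv> free_group {1..n}"

abbreviation Aut :: "nat \<Rightarrow> (word \<Rightarrow> word) monoid" where
  "Aut n \<equiv> AutoGroup (Fn n)"

definition y_aut :: "nat \<Rightarrow> nat \<Rightarrow> nat \<Rightarrow> word \<Rightarrow> word" where
  "y_aut n m i = (\<lambda>w\<in>carrier (Fn n). free_ext (Fn n)
     (\<lambda>k. if k \<le> m then inv\<^bsub>Fn n\<^esub> gen i \<otimes>\<^bsub>Fn n\<^esub> gen k \<otimes>\<^bsub>Fn n\<^esub> gen i else gen k) w)"

definition I_sub :: "nat \<Rightarrow> (word \<Rightarrow> word) set" where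
  "I_sub n = generate (Aut n) {y_aut n m i | m i. 2 \<le> m \<and> m \<le> n \<and> 1 \<le> i \<and> i \<le> m}"

text \<open>For a normal subgroup \<open>N\<close> invariant under all automorphisms, the image of a coset of \<open>N\<close>
  under an automorphism is again a coset of \<open>N\<close>.\<close>

definition induced_auto :: "('a, 'b) monoid_scheme \<Rightarrow> 'a set \<Rightarrow> ('a \<Rightarrow> 'a) \<Rightarrow> 'a set \<Rightarrow> 'a set" where
  "induced_auto G N \<phi> = (\<lambda>A\<in>carrier (G Mod N). \<phi> ` A)"

definition IA :: "nat \<Rightarrow> nat \<Rightarrow> (word \<Rightarrow> word) set" where
  "IA n c = kernel (Aut n) (AutoGroup (Fn n Mod lower_central (Fn n) c))
     (induced_auto (Fn n) (lower_central (Fn n) c))"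

definition Johnson_filtration :: "nat \<Rightarrow> nat \<Rightarrow> (word \<Rightarrow> word) set" where
  "Johnson_filtration n q = IA n (Suc q)"

definition Johnson_lie :: "nat \<Rightarrow> (nat \<Rightarrow> (word \<Rightarrow> word) set) lie_ring" where
  "Johnson_lie n = filtration_lie (Aut n) (Johnson_filtration n)"

definition L1_piece :: "nat \<Rightarrow> (word \<Rightarrow> word) set \<Rightarrow> nat \<Rightarrow> (word \<Rightarrow> word) set set" where
  "L1_piece n H q = carrier
     ((Aut n)\<lparr>carrier := lower_central ((Aut n)\<lparr>carrier := H\<rparr>) q <#>\<^bsub>Aut n\<^esub> IA n (q + 2)\<rparr>
        Mod IA n (q + 2))"

definition L1 :: "nat \<Rightarrow> (word \<Rightarrow> word) set \<Rightarrow> (nat \<Rightarrow> (word \<Rightarrow> word) set) lie_ring" where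
  "L1 n H = (Johnson_lie n)
     \<lparr>carrier := {f \<in> carrier (Johnson_lie n). \<forall>q\<ge>1. f q \<in> L1_piece n H q}\<rparr>"

lemma y_aut_gen:
  assumes "i \<in> {1..n}" "k \<in> {1..n}"
  shows "y_aut n m i (gen k) =
    (if k \<le> m then inv\<^bsub>Fn n\<^esub> gen i \<otimes>\<^bsub>Fn n\<^esub> gen k \<otimes>\<^bsub>Fn n\<^esub> gen i else gen k)"
proof -
  interpret F: group "Fn n" by (rule group_free_group)
  show ?thesis
    using assms gen_in_free_group[of _ "{1..n}"]
    by (simp add: y_aut_def F.free_ext_gen del: One_nat_def atLeastAtMost_iff)
qed

lemma y_aut_in_Aut:
  assumes i: "1 \<le> i" "i \<le> m" and m: "m \<le> n"
  shows "y_aut n m i \<in> carrier (Aut n)"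
proof -
  note One_nat_def [simp del]
  interpret F: group "Fn n" by (rule group_free_group)
  have g [simp]: "gen k \<in> carrier (Fn n)" if "1 \<le> k" "k \<le> n" for k
    using that by (auto intro: gen_in_free_group)
  have i' [simp]: "gen i \<in> carrier (Fn n)" "i \<le> n" using i m by auto
  define f where "f = (\<lambda>k. if k \<le> m then inv\<^bsub>Fn n\<^esub> gen i \<otimes>\<^bsub>Fn n\<^esub> gen k \<otimes>\<^bsub>Fn n\<^esub> gen i else gen k)"
  define f' where "f' = (\<lambda>k. if k \<le> m then gen i \<otimes>\<^bsub>Fn n\<^esub> gen k \<otimes>\<^bsub>Fn n\<^esub> inv\<^bsub>Fn n\<^esub> gen i else gen k)"
  define h where "h = free_ext (Fn n) f"
  define h' where "h' = free_ext (Fn n) f'"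
  have fc: "f \<in> {1..n} \<rightarrow> carrier (Fn n)" and f'c: "f' \<in> {1..n} \<rightarrow> carrier (Fn n)"
    by (auto simp: f_def f'_def)
  have hh: "h \<in> hom (Fn n) (Fn n)" "h' \<in> hom (Fn n) (Fn n)"
    unfolding h_def h'_def using F.free_ext_hom[OF fc] F.free_ext_hom[OF f'c] by auto
  interpret h: group_hom "Fn n" "Fn n" h using hh by unfold_locales auto
  interpret h': group_hom "Fn n" "Fn n" h' using hh by unfold_locales auto
  have hg: "h (gen k) = f k" "h' (gen k) = f' k" if "1 \<le> k" "k \<le> n" for k
    using fc f'c that by (auto simp: h_def h'_def Pi_iff F.free_ext_gen)
  have fi: "f i = gen i" "f' i = gen i"
    using i by (simp_all add: f_def f'_def F.m_assoc)
  have cancel: "a \<otimes>\<^bsub>Fn n\<^esub> (inv\<^bsub>Fn n\<^esub> a \<otimes>\<^bsub>Fn n\<^esub> b) = b" "inv\<^bsub>Fn n\<^esub> a \<otimes>\<^bsub>Fn n\<^esub> (a \<otimes>\<^bsub>Fn n\<^esub> b) = b"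
    if "a \<in> carrier (Fn n)" "b \<in> carrier (Fn n)" for a b
    using that by (simp_all flip: F.m_assoc)
  have gens: "h' (h (gen k)) = gen k" "h (h' (gen k)) = gen k" if "1 \<le> k" "k \<le> n" for k
    using that i by (simp_all add: hg f_def f'_def F.m_assoc cancel fi[unfolded f_def f'_def])
  have idh: "(\<lambda>w. w) \<in> hom (Fn n) (Fn n)" by (auto simp: hom_def)
  have inverse: "h' (h w) = w" "h (h' w) = w" if "w \<in> carrier (Fn n)" for w
    using F.free_hom_unique[OF hom_compose[OF hh] idh, of w] gens
      F.free_hom_unique[OF hom_compose[OF hh(2) hh(1)] idh, of w] that by auto
  have bij: "bij_betw h (carrier (Fn n)) (carrier (Fn n))"
    by (rule bij_betw_byWitness[where f' = h']) (auto simp: inverse)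
  have "y_aut n m i = restrict h (carrier (Fn n))"
    by (simp add: y_aut_def h_def f_def)
  moreover have "restrict h (carrier (Fn n)) \<in> hom (Fn n) (Fn n)"
    by (auto intro!: homI)
  ultimately show ?thesis
    using bij by (simp add: AutoGroup_def auto_def Bij_def bij_betw_restrict_eq)
qed

end

(*
  I_n is an iterated semidirect product: writing J_m for the subgroup generated by the y_{ki} with
  k <= m, one has J_m = Inn(F_m) x| J_{m-1}, and J_{m-1} acts trivially on the abelianisation of
  F_m, so that gamma_q(J_m) = gamma_q(F_m) x| gamma_q(J_{m-1}). The graded map
  gr(I_n) -> L(IA(F_n)) is surjective onto L_1(I_n) by construction, and it is injective if
  gamma_q(I_n) meets I_{q+2}A(F_n) only in gamma_{q+1}(I_n). If conj(g) psi lies in I_{q+2}A(F_n)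
  with g in gamma_q(F_m) and psi in gamma_q(J_{m-1}), then, since psi fixes x_m, the class of g in
  degree q commutes with x_m. By the Magnus expansion it is a multiple of x_m, hence 0 for q >= 2;
  for q = 1 the multiple is 0 by looking at x_1. Induction on m finishes the proof.

  What is needed about free groups is the theorem of Magnus and Witt: an element of gamma_q whose
  Magnus expansion has no terms of degree q lies in gamma_{q+1}. It is proved by Lazard elimination
  in gr(F): a family of elements of gr(F) whose Magnus expansions have as lexicographically least
  terms the words of a prefix code generates a Lie ring Z x + L', where x has the least word and L'
  is generated by the ad(x)^k y for the other members y, whose least words x^k y form a prefix code
  again.
*)

theory Submission
  imports Defs "HOL-Library.List_Lexorder" "HOL-Library.Multiset" "HOL-Library.Sublist"
begin

section \<open>Commutator calculus\<close>

text \<open>The obstacle is to recognise terms of the lower central series from coefficients: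
  membership forces coefficients to vanish, but the converse has to produce membership by group
  operations. Elimination does so without a basis of the free Lie ring. If g = x^e h with h in L',
  the coefficient of g at the least word x is e, because nothing in L' shows this word and leading
  coefficients are 1. So vanishing coefficients give e = 0, and g lies in L'. In the free Lie ring
  this would never stop. Only degree q matters, so every family is cut off at words of length q. One
  round trades a word for finitely many longer ones, so the multiset of the numbers q + 1 - length
  decreases until the family is empty; then g is trivial in degree q. No quotient ring is formed on
  the way: \<open>lie\<close> speaks of group elements up to the next term of the filtration, and
  the Jacobi identity becomes a membership statement derived from the Hall-Witt identity.\<close>

context group
begin

lemma l_cancel_inv [simp]:
  "a \<in> carrier G \<Longrightarrow> b \<in> carrier G \<Longrightarrow> inv a \<otimes> (a \<otimes> b) = b"
  "a \<in> carrier G \<Longrightarrow> b \<in> carrier G \<Longrightarrow> a \<otimes> (inv a \<otimes> b) = b"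
  by (simp_all flip: m_assoc)

lemma commutator_closed [simp]:
  "a \<in> carrier G \<Longrightarrow> b \<in> carrier G \<Longrightarrow> commutator G a b \<in> carrier G"
  by (simp add: commutator_def)

lemmas word_simps = commutator_def m_assoc inv_mult_group

lemma inv_commutator:
  "a \<in> carrier G \<Longrightarrow> b \<in> carrier G \<Longrightarrow> inv commutator G a b = commutator G b a"
  by (simp add: word_simps)

lemma conj_eq_mult_commutator:
  "x \<in> carrier G \<Longrightarrow> b \<in> carrier G \<Longrightarrow> inv b \<otimes> x \<otimes> b = x \<otimes> commutator G x b"
  by (simp add: word_simps)

lemma mult_commutator:
  "a \<in> carrier G \<Longrightarrow> b \<in> carrier G \<Longrightarrow> b \<otimes> a \<otimes> commutator G a b = a \<otimes> b"
  by (simp add: word_simps)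

lemma commutator_mult_left:
  "a \<in> carrier G \<Longrightarrow> b \<in> carrier G \<Longrightarrow> c \<in> carrier G \<Longrightarrow>
    commutator G (a \<otimes> b) c =
      commutator G a c \<otimes> commutator G (commutator G a c) b \<otimes> commutator G b c"
  by (simp add: word_simps)

lemma commutator_mult_right:
  "a \<in> carrier G \<Longrightarrow> b \<in> carrier G \<Longrightarrow> c \<in> carrier G \<Longrightarrow>
    commutator G a (b \<otimes> c) =
      commutator G a c \<otimes> commutator G a b \<otimes> commutator G (commutator G a b) c"
  by (simp add: word_simps)

lemma commutator_inv_left:
  "a \<in> carrier G \<Longrightarrow> c \<in> carrier G \<Longrightarrow>
    commutator G (inv a) c = inv commutator G a c \<otimes> commutator G (inv commutator G a c) (inv a)"
  by (simp add: word_simps)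

lemma commutator_inv_right:
  "a \<in> carrier G \<Longrightarrow> b \<in> carrier G \<Longrightarrow>
    commutator G a (inv b) = inv commutator G a b \<otimes> commutator G (inv commutator G a b) (inv b)"
  by (simp add: word_simps)

text \<open>Pure cancellation once the commutators are expanded. In a graded Lie ring it becomes the
  Jacobi identity: the inner inverses turn into signs and the outer conjugations disappear.\<close>

lemma hall_witt:
  assumes "a \<in> carrier G" "b \<in> carrier G" "c \<in> carrier G"
  shows "(inv b \<otimes> commutator G (commutator G a (inv b)) c \<otimes> b) \<otimes>
    (inv c \<otimes> commutator G (commutator G b (inv c)) a \<otimes> c) \<otimes>
    (inv a \<otimes> commutator G (commutator G c (inv a)) b \<otimes> a) = \<one>"
  using assms by (simp add: word_simps)

lemma conj_commutator:
  assumes "a \<in> carrier G" "b \<in> carrier G" "g \<in> carrier G"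
  shows "g \<otimes> commutator G a b \<otimes> inv g =
    commutator G (g \<otimes> a \<otimes> inv g) (g \<otimes> b \<otimes> inv g)"
  using assms by (simp add: word_simps)

end

lemma hom_commutator:
  assumes "group G" "group H" "h \<in> hom G H" "a \<in> carrier G" "b \<in> carrier G"
  shows "h (commutator G a b) = commutator H (h a) (h b)"
proof -
  interpret group_hom G H h
    using assms by (simp add: group_hom_def group_hom_axioms_def)
  show ?thesis
    using assms by (simp add: commutator_def)
qed


section \<open>Strongly central filtrations\<close>

text \<open>\<open>N 1\<close> may be a proper subgroup: the Johnson filtration lives in the group
  \<open>Aut n\<close>, but its first term is only IA. Degrees start at 1.\<close>

locale filtration = group +
  fixes N :: "nat \<Rightarrow> 'a set"
  assumes normal: "1 \<le> q \<Longrightarrow> N q \<lhd> G"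
    and Suc_subset: "1 \<le> q \<Longrightarrow> N (Suc q) \<subseteq> N q"
    and commutator_mem:
      "1 \<le> p \<Longrightarrow> 1 \<le> q \<Longrightarrow> a \<in> N p \<Longrightarrow> b \<in> N q \<Longrightarrow> commutator G a b \<in> N (p + q)"
begin

lemma sub: "1 \<le> q \<Longrightarrow> subgroup (N q) G"
  by (rule normal_imp_subgroup[OF normal])

lemma mem_carrier: "1 \<le> q \<Longrightarrow> a \<in> N q \<Longrightarrow> a \<in> carrier G"
  by (rule subgroup.mem_carrier[OF sub])

lemma antimono: "1 \<le> p \<Longrightarrow> p \<le> q \<Longrightarrow> N q \<subseteq> N p"
proof (induction q)
  case (Suc q)
  then show ?case
    using Suc_subset[of q] by (cases "p = Suc q") auto
qed auto

lemma inv_mem: "1 \<le> q \<Longrightarrow> a \<in> N q \<Longrightarrow> inv a \<in> N q"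
  by (rule subgroup.m_inv_closed[OF sub])

lemma mult_mem: "1 \<le> q \<Longrightarrow> a \<in> N q \<Longrightarrow> b \<in> N q \<Longrightarrow> a \<otimes> b \<in> N q"
  by (rule subgroup.m_closed[OF sub])

lemma one_mem: "1 \<le> q \<Longrightarrow> \<one> \<in> N q"
  by (rule subgroup.one_closed[OF sub])

lemma pow_mem: "1 \<le> q \<Longrightarrow> a \<in> N q \<Longrightarrow> a [^] (e::int) \<in> N q"
  by (rule subgroup_int_pow_closed[OF sub])

lemma commutator_mem': "1 \<le> p \<Longrightarrow> 1 \<le> q \<Longrightarrow> a \<in> N p \<Longrightarrow> b \<in> N q \<Longrightarrow> 1 \<le> r \<Longrightarrow> r \<le> p + q \<Longrightarrow>
    commutator G a b \<in> N r"
  using commutator_mem antimono by blast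

section \<open>Biadditivity of the commutator modulo higher terms\<close>

context
  fixes p q V
  assumes p: "1 \<le> p" and q: "1 \<le> q" and V: "subgroup V G" "N (Suc (p + q)) \<subseteq> V"
begin

interpretation V: subgroup V G by (rule V)

text \<open>The correction term [[a,c],b] has degree 2p + q, hence at least p + q + 1. Working with
  a subgroup V above \<open>N (Suc (p + q))\<close> amounts to arguing in the quotient without
  forming it.\<close>

lemma commutator_mult_left_mem:
  assumes "a \<in> N p" "b \<in> N p" "c \<in> N q" "commutator G a c \<in> V" "commutator G b c \<in> V"
  shows "commutator G (a \<otimes> b) c \<in> V"
proof -
  have "commutator G (commutator G a c) b \<in> N (Suc (p + q))"
    using assms p q by (intro commutator_mem'[of "p + q" p] commutator_mem[of p q]) auto
  then show ?thesis
    using assms V p q by (subst commutator_mult_left) (auto intro: mem_carrier)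
qed

lemma commutator_mult_right_mem:
  assumes "a \<in> N p" "b \<in> N q" "c \<in> N q" "commutator G a b \<in> V" "commutator G a c \<in> V"
  shows "commutator G a (b \<otimes> c) \<in> V"
proof -
  have "commutator G (commutator G a b) c \<in> N (Suc (p + q))"
    using assms p q by (intro commutator_mem'[of "p + q" q] commutator_mem[of p q]) auto
  then show ?thesis
    using assms V p q by (subst commutator_mult_right) (auto intro: mem_carrier)
qed

lemma commutator_inv_left_mem:
  assumes "a \<in> N p" "c \<in> N q" "commutator G a c \<in> V"
  shows "commutator G (inv a) c \<in> V"
proof -
  have "commutator G (inv commutator G a c) (inv a) \<in> N (Suc (p + q))"
    using assms p q
    by (intro commutator_mem'[of "p + q" p] inv_mem commutator_mem[of p q]) auto
  then show ?thesis
    using assms V p q by (subst commutator_inv_left) (auto intro: mem_carrier)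
qed

lemma commutator_inv_right_mem:
  assumes "a \<in> N p" "b \<in> N q" "commutator G a b \<in> V"
  shows "commutator G a (inv b) \<in> V"
proof -
  have "commutator G (inv commutator G a b) (inv b) \<in> N (Suc (p + q))"
    using assms p q
    by (intro commutator_mem'[of "p + q" q] inv_mem commutator_mem[of p q]) auto
  then show ?thesis
    using assms V p q by (subst commutator_inv_right) (auto intro: mem_carrier)
qed

lemma commutator_pow_left_mem:
  assumes "a \<in> N p" "c \<in> N q" "commutator G a c \<in> V"
  shows "commutator G (a [^] (e::int)) c \<in> V"
proof -
  \<comment> \<open>For fixed c the elements with commutator in V form a subgroup, which therefore
    contains all powers of a.\<close>
  have H: "subgroup {b \<in> N p. commutator G b c \<in> V} G"
    using assms p q sub[of p, THEN subgroup.m_closed] sub[of p, THEN subgroup.m_inv_closed]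
      sub[of p, THEN subgroup.one_closed]
    by (intro subgroupI)
      (auto intro: commutator_mult_left_mem commutator_inv_left_mem mem_carrier
        simp: commutator_def[of _ "\<one>"] mem_carrier)
  show ?thesis
    using subgroup_int_pow_closed[OF H, of a e] assms by auto
qed

end

text \<open>The Jacobi identity in the form needed for elimination: of the three cyclic double
  commutators, two in V force the third into V. It is the Hall-Witt identity with inverses and
  conjugations removed, which only costs terms of degree above p + q + r.\<close>

lemma jacobi_mem:
  assumes pos: "1 \<le> p" "1 \<le> q" "1 \<le> r" and V: "subgroup V G" "N (Suc (p + q + r)) \<subseteq> V"
    and abc: "a \<in> N p" "b \<in> N q" "c \<in> N r"
    and V1: "commutator G (commutator G a b) c \<in> V"
    and V2: "commutator G (commutator G c a) b \<in> V"
  shows "commutator G (commutator G b c) a \<in> V"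
proof -
  interpret V: subgroup V G by (rule V)
  note [simp] = V.mem_carrier
  have [simp]: "a \<in> carrier G" "b \<in> carrier G" "c \<in> carrier G"
    using pos abc by (auto intro: mem_carrier)
  \<comment> \<open>Inverting y changes the sign of the class of [[x,y],z] in its degree, and V is
    closed under inverses. One implication for all y' suffices, applied to y and to its
    inverse.\<close>
  have flip: "commutator G (commutator G x (inv y)) z \<in> V \<longleftrightarrow>
      commutator G (commutator G x y) z \<in> V"
    if "x \<in> N i" "y \<in> N j" "z \<in> N k" "1 \<le> i" "1 \<le> j" "1 \<le> k" "i + j + k = p + q + r" for x y z i j k
  proof -
    have c: "x \<in> carrier G" "y \<in> carrier G" "z \<in> carrier G"
      using that by (auto intro: mem_carrier)
    have *: "commutator G (commutator G x (inv y')) z \<in> V"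
      if y': "y' \<in> N j" "commutator G (commutator G x y') z \<in> V" for y'
    proof -
      let ?u = "inv commutator G x y'" and ?v = "commutator G (inv commutator G x y') (inv y')"
      have c': "y' \<in> carrier G"
        using y' \<open>1 \<le> j\<close> mem_carrier by blast
      have u: "?u \<in> N (i + j)"
        using that y' \<open>x \<in> N i\<close> \<open>1 \<le> i\<close> \<open>1 \<le> j\<close> by (intro inv_mem commutator_mem) auto
      have v: "?v \<in> N (Suc (i + j))"
        using commutator_mem'[of "i + j" j ?u "inv y'" "Suc (i + j)"] inv_mem[of j y']
          u y' \<open>1 \<le> j\<close> \<open>1 \<le> i\<close> by auto
      have V': "N (Suc (i + j + k)) \<subseteq> V"
        using V \<open>i + j + k = p + q + r\<close> by simp
      have "commutator G ?u z \<in> V"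
        using y' \<open>x \<in> N i\<close> \<open>1 \<le> i\<close> \<open>1 \<le> j\<close> \<open>1 \<le> k\<close> \<open>z \<in> N k\<close> V'
        by (intro commutator_inv_left_mem[OF _ _ V(1) V'] commutator_mem) auto
      moreover have "commutator G ?v z \<in> V"
        using commutator_mem[of "Suc (i + j)" k ?v z] v \<open>z \<in> N k\<close> \<open>1 \<le> k\<close> V' by auto
      moreover have "?v \<in> N (i + j)"
        using v Suc_subset[of "i + j"] \<open>1 \<le> i\<close> by auto
      ultimately have "commutator G (?u \<otimes> ?v) z \<in> V"
        using u \<open>z \<in> N k\<close> \<open>1 \<le> i\<close> \<open>1 \<le> k\<close>
        by (intro commutator_mult_left_mem[OF _ _ V(1) V']) auto
      then show ?thesis
        by (subst commutator_inv_right[OF c(1) c'])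
    qed
    show ?thesis
      using *[of y] *[of "inv y"] that c inv_mem[of j y] by auto
  qed
  \<comment> \<open>Conjugation multiplies x by [x,y], which has degree above p + q + r and so lies
    in V.\<close>
  have conj: "inv y \<otimes> x \<otimes> y \<in> V \<longleftrightarrow> x \<in> V" if "x \<in> N (p + q + r)" "y \<in> N j" "1 \<le> j" for x y j
  proof -
    have c: "x \<in> carrier G" "y \<in> carrier G"
      using that pos mem_carrier[of "p + q + r" x] mem_carrier[of j y] by auto
    have cV: "commutator G x y \<in> V"
      using V(2) commutator_mem'[of "p + q + r" j x y "Suc (p + q + r)"] that pos by auto
    have eq: "x \<otimes> commutator G x y \<otimes> inv commutator G x y = x"
      using c by (simp add: m_assoc)
    show ?thesis
      unfolding conj_eq_mult_commutator[OF c]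
    proof
      assume "x \<otimes> commutator G x y \<in> V"
      from V.m_closed[OF this V.m_inv_closed[OF cV]] show "x \<in> V"
        unfolding eq .
    qed (rule V.m_closed[OF _ cV])
  qed
  let ?A = "inv b \<otimes> commutator G (commutator G a (inv b)) c \<otimes> b"
  let ?B = "inv c \<otimes> commutator G (commutator G b (inv c)) a \<otimes> c"
  let ?C = "inv a \<otimes> commutator G (commutator G c (inv a)) b \<otimes> a"
  have m: "commutator G (commutator G a (inv b)) c \<in> N (p + q + r)"
      "commutator G (commutator G b (inv c)) a \<in> N (p + q + r)"
      "commutator G (commutator G c (inv a)) b \<in> N (p + q + r)"
    using pos abc inv_mem[of p a] inv_mem[of q b] inv_mem[of r c] commutator_mem'[of "p + q" r "commutator G a (inv b)" c "p + q + r"]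
      commutator_mem'[of "q + r" p "commutator G b (inv c)" a "p + q + r"]
      commutator_mem'[of "r + p" q "commutator G c (inv a)" b "p + q + r"]
      commutator_mem[of p q a "inv b"] commutator_mem[of q r b "inv c"] commutator_mem[of r p c "inv a"]
    by (auto simp: ac_simps)
  have A: "?A \<in> V"
    using conj[OF m(1) abc(2)] flip[of a p b q c r] V1 abc pos by auto
  have C: "?C \<in> V"
    using conj[OF m(3) abc(1)] flip[of c r a p b q] V2 abc pos by auto
  have "?B = inv ?A \<otimes> inv ?C"
  proof -
    have "?A \<otimes> ?B \<otimes> ?C = \<one>"
      by (rule hall_witt) auto
    then have "?A \<otimes> ?B = inv ?C"
      by (intro inv_equality[symmetric]) (auto simp del: inv_mult_group)
    then show ?thesis
      by (subst inv_solve_left) auto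
  qed
  then have "?B \<in> V"
    using A C by auto
  then show ?thesis
    using conj[OF m(2) abc(3)] flip[of b q c r a p] abc pos by auto
qed

end


section \<open>The lower central series\<close>

context group
begin

lemma lower_central_normal: "lower_central G q \<lhd> G"
proof (induction q rule: induct_nat_012)
  case (ge2 q)
  let ?S = "{commutator G h k |h k. h \<in> lower_central G (Suc q) \<and> k \<in> carrier G}"
  have S: "lower_central G (Suc q) \<subseteq> carrier G"
    using ge2 normal_imp_subgroup subgroup.subset by blast
  have "generate G ?S \<lhd> G"
  proof (rule normal_generateI)
    show "?S \<subseteq> carrier G"
      using S by auto
    fix x g assume "x \<in> ?S" and g: "g \<in> carrier G"
    then obtain h k where x: "x = commutator G h k" "h \<in> lower_central G (Suc q)" "k \<in> carrier G"
      by auto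
    have "g \<otimes> h \<otimes> inv g \<in> lower_central G (Suc q)"
      using ge2 g x(2) normal.inv_op_closed2 by metis
    then show "g \<otimes> x \<otimes> inv g \<in> ?S"
      using x g conj_commutator[of h k g] subsetD[OF S, of h]
      by (intro CollectI exI[of _ "g \<otimes> h \<otimes> inv g"] exI[of _ "g \<otimes> k \<otimes> inv g"]) auto
  qed
  then show ?case
    by (simp add: commutator_subgroup_def)
qed (auto simp: normal_inv_iff subgroup_self)

lemma lower_central_subgroup: "subgroup (lower_central G q) G"
  by (rule normal_imp_subgroup[OF lower_central_normal])

lemma lower_central_carrier: "a \<in> lower_central G q \<Longrightarrow> a \<in> carrier G"
  by (rule subgroup.mem_carrier[OF lower_central_subgroup])

lemma commutator_lower_central_Suc:
  assumes "a \<in> lower_central G q" "b \<in> carrier G" "1 \<le> q"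
  shows "commutator G a b \<in> lower_central G (Suc q)"
  using assms by (cases q) (auto simp: commutator_subgroup_def intro!: generate.incl)

text \<open>The induction principle behind all upper bounds on the lower central series below: only
  the generating commutators have to be tested against a subgroup.\<close>

lemma lower_central_Suc_le:
  assumes "1 \<le> q" "subgroup H G"
    "\<And>a b. a \<in> lower_central G q \<Longrightarrow> b \<in> carrier G \<Longrightarrow> commutator G a b \<in> H"
  shows "lower_central G (Suc q) \<subseteq> H"
proof -
  obtain c where q: "q = Suc c"
    using assms(1) by (cases q) auto
  show ?thesis
    unfolding q lower_central.simps commutator_subgroup_def
    by (rule generate_subgroup_incl[OF _ assms(2)]) (use assms(3) q in auto)
qed

lemma lower_central_Suc_subset: "lower_central G (Suc q) \<subseteq> lower_central G q"
proof (cases "q = 0")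
  case False
  note sg = lower_central_subgroup[of q]
  have "commutator G a b \<in> lower_central G q" if a: "a \<in> lower_central G q" and b: "b \<in> carrier G" for a b
  proof -
    have "inv b \<otimes> a \<otimes> b \<in> lower_central G q"
      using that by (intro normal.inv_op_closed1[OF lower_central_normal])
    moreover have "commutator G a b = inv a \<otimes> (inv b \<otimes> a \<otimes> b)"
      using lower_central_carrier[OF a] b by (simp add: word_simps)
    ultimately show ?thesis
      using subgroup.m_closed[OF sg] subgroup.m_inv_closed[OF sg a] by simp
  qed
  then show ?thesis
    using False by (intro lower_central_Suc_le sg) auto
qed auto

text \<open>The three subgroups argument on elements. By Hall-Witt, [[u,v],a] is controlled by
  [[a,u],v] and [[v,a],u] up to inverses; the latter uses the induction hypothesis with p + 1 in
  place of p, hence the generalisation over p.\<close>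

lemma lower_central_commutator:
  "1 \<le> p \<Longrightarrow> 1 \<le> q \<Longrightarrow> a \<in> lower_central G p \<Longrightarrow> b \<in> lower_central G q \<Longrightarrow>
    commutator G a b \<in> lower_central G (p + q)"
proof (induction q arbitrary: p a b)
  case (Suc q)
  show ?case
  proof (cases "q = 0")
    case True
    then show ?thesis
      using Suc.prems commutator_lower_central_Suc[of a p b] lower_central_carrier by auto
  next
    case False
    then have q: "1 \<le> q" by simp
    let ?M = "lower_central G (p + Suc q)"
    note M = subgroup.m_closed[OF lower_central_subgroup] subgroup.m_inv_closed[OF lower_central_subgroup]
      subgroup.one_closed[OF lower_central_subgroup]
      and conj = normal.inv_op_closed1[OF lower_central_normal]
        normal.inv_op_closed2[OF lower_central_normal]
      and [simp] = lower_central_carrier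
    have a: "a \<in> carrier G"
      using Suc.prems by auto
    let ?H = "{y \<in> lower_central G (Suc q). commutator G y a \<in> ?M}"
    have "subgroup ?H G"
    proof (rule subgroupI)
      show "?H \<noteq> {}"
        using M(3) a by (auto simp: commutator_def intro!: exI[of _ \<one>])
      show "inv y \<in> ?H" if y: "y \<in> ?H" for y
      proof -
        have c: "y \<in> carrier G"
          using y by auto
        have "commutator G (inv y) a = y \<otimes> inv commutator G y a \<otimes> inv y"
          using c a by (simp add: word_simps)
        then show ?thesis
          using y c by (auto intro!: M conj)
      qed
      show "y \<otimes> z \<in> ?H" if yz: "y \<in> ?H" "z \<in> ?H" for y z
      proof -
        have c: "y \<in> carrier G" "z \<in> carrier G"
          using yz by auto
        have "commutator G (y \<otimes> z) a = (inv z \<otimes> commutator G y a \<otimes> z) \<otimes> commutator G z a"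
          using c a by (simp add: word_simps)
        then show ?thesis
          using yz c by (auto intro!: M conj)
      qed
    qed auto
    moreover have "commutator G u v \<in> ?H" if u: "u \<in> lower_central G q" and v: "v \<in> carrier G" for u v
    proof -
      have uc: "u \<in> carrier G"
        using u by auto
      \<comment> \<open>With this choice the middle Hall-Witt factor is a conjugate of [[u,v],a]
        itself.\<close>
      define c where "c = inv v"
      have c: "c \<in> carrier G" "inv c = v"
        using v by (simp_all add: c_def)
      let ?A = "inv u \<otimes> commutator G (commutator G a (inv u)) c \<otimes> u"
      let ?B = "inv c \<otimes> commutator G (commutator G u (inv c)) a \<otimes> c"
      let ?C = "inv a \<otimes> commutator G (commutator G c (inv a)) u \<otimes> a"
      have "commutator G a (inv u) \<in> lower_central G (p + q)"
        using Suc.IH[of p a "inv u"] Suc.prems u q M(2) by auto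
      then have A: "?A \<in> ?M"
        using commutator_lower_central_Suc[of _ "p + q" c] Suc.prems(1) c uc conj(1) by auto
      have "commutator G c (inv a) = inv commutator G (inv a) c"
        using c a by (simp add: inv_commutator)
      then have "commutator G c (inv a) \<in> lower_central G (Suc p)"
        using commutator_lower_central_Suc[of "inv a" p c] Suc.prems c M(2) by auto
      then have "commutator G (commutator G c (inv a)) u \<in> lower_central G (Suc p + q)"
        using Suc.IH[of "Suc p"] u q by auto
      then have C: "?C \<in> ?M"
        using conj(1) a by auto
      have "?A \<otimes> ?B \<otimes> ?C = \<one>"
        using a uc c by (intro hall_witt) auto
      then have "?A \<otimes> ?B = inv ?C"
        using a uc c by (intro inv_equality[symmetric]) auto
      then have "?B = inv ?A \<otimes> inv ?C"
        using a uc c by (subst inv_solve_left[symmetric]) auto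
      then have "?B \<in> ?M"
        using A C M by metis
      then have "c \<otimes> ?B \<otimes> inv c \<in> ?M"
        using c(1) by (rule conj(2)[rotated])
      moreover have "c \<otimes> ?B \<otimes> inv c = commutator G (commutator G u v) a"
        unfolding c(2) using c uc v a by (simp add: m_assoc c_def)
      ultimately show ?thesis
        using u v q commutator_lower_central_Suc by auto
    qed
    ultimately have "lower_central G (Suc q) \<subseteq> ?H"
      by (intro lower_central_Suc_le[OF q])
    then have "commutator G b a \<in> ?M"
      using Suc.prems by auto
    then show ?thesis
      using M(2)[of "commutator G b a"] Suc.prems a by (simp add: inv_commutator)
  qed
qed simp

lemma lower_central_filtration: "filtration G (lower_central G)"
  by (intro filtration.intro filtration_axioms.intro group_axioms lower_central_normal
      lower_central_Suc_subset lower_central_commutator)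

end

lemma lower_central_hom:
  assumes "group G" "group H" "h \<in> hom G H" "a \<in> lower_central G q"
  shows "h a \<in> lower_central H q"
  using assms(4)
proof (induction q arbitrary: a rule: induct_nat_012)
  case (ge2 q)
  interpret G: group G by fact
  interpret H: group H by fact
  interpret h: group_hom G H h
    using assms by (simp add: group_hom_def group_hom_axioms_def)
  note sg = H.lower_central_subgroup[of "Suc (Suc q)"]
  let ?K = "{a \<in> carrier G. h a \<in> lower_central H (Suc (Suc q))}"
  have "lower_central G (Suc (Suc q)) \<subseteq> ?K"
  proof (rule G.lower_central_Suc_le)
    show "subgroup ?K G"
      using subgroup.m_closed[OF sg] subgroup.m_inv_closed[OF sg] subgroup.one_closed[OF sg]
      by (intro G.subgroupI) (auto simp del: lower_central.simps intro!: exI[of _ "\<one>\<^bsub>G\<^esub>"])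
  next
    fix a b assume ab: "a \<in> lower_central G (Suc q)" "b \<in> carrier G"
    then have "a \<in> carrier G"
      by (auto dest: G.lower_central_carrier)
    then show "commutator G a b \<in> ?K"
      using ab ge2.IH(2)[of a] H.commutator_lower_central_Suc[of "h a" "Suc q" "h b"]
        hom_commutator[OF assms(1-3), of a b] by auto
  qed auto
  then show ?case
    using ge2.prems by blast
qed (use assms(3) in \<open>auto simp: hom_def Pi_iff\<close>)

interpretation F: group "free_group S" for S
  by (rule group_free_group)

lemma free_group_generated:
  assumes K: "subgroup K (free_group S)" and gen: "\<And>k. k \<in> S \<Longrightarrow> gen k \<in> K"
  shows "w \<in> carrier (free_group S) \<Longrightarrow> w \<in> K"
proof (induction w)
  case Nil
  then show ?case
    using subgroup.one_closed[OF K] by (simp add: free_group_def)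
next
  case (Cons a w)
  have w: "w \<in> carrier (free_group S)" and a: "fst a \<in> S"
    using Cons.prems by (auto simp: free_group_def dest: reduced_tl)
  have "[(fst a, False)] = inv\<^bsub>free_group S\<^esub> gen (fst a)"
  proof (rule F.inv_equality[symmetric])
    show "[(fst a, False)] \<otimes>\<^bsub>free_group S\<^esub> gen (fst a) = \<one>\<^bsub>free_group S\<^esub>"
      by (simp add: free_group_def gen_def)
  qed (use a gen_in_free_group[OF a] in \<open>auto simp: free_group_def\<close>)
  then have "[(fst a, e)] \<in> K" for e
    using gen[OF a] subgroup.m_inv_closed[OF K gen[OF a]] by (cases e) (simp_all add: gen_def)
  from this[of "snd a"] have "[a] \<in> K"
    by simp
  moreover have "a # w = [a] \<otimes>\<^bsub>free_group S\<^esub> w"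
    using Cons.prems by (simp add: free_group_def push_reduced)
  ultimately show ?case
    using subgroup.m_closed[OF K] Cons.IH[OF w] by simp
qed


section \<open>The Magnus expansion\<close>

text \<open>Noncommutative formal power series with integer coefficients, as coefficient functions on
  monomials.\<close>

typedef 'a ncps = "UNIV :: ('a list \<Rightarrow> int) set"
  morphisms coeff Series ..

lemma coeff_Series [simp]: "coeff (Series f) = f"
  by (rule Series_inverse) simp

lemma ncps_eqI: "(\<And>u. coeff f u = coeff g u) \<Longrightarrow> f = g"
  by (metis coeff_inject ext)

text \<open>The sum over all splittings of the word into a left factor for f and a right factor for
  g. Recursion moves the first letter into f, so that no sum over positions has to be
  handled.\<close>

fun conv :: "('a list \<Rightarrow> int) \<Rightarrow> ('a list \<Rightarrow> int) \<Rightarrow> 'a list \<Rightarrow> int" where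
  "conv f g [] = f [] * g []"
| "conv f g (a # u) = f [] * g (a # u) + conv (\<lambda>v. f (a # v)) g u"

lemma conv_add_left: "conv (\<lambda>u. f u + g u) h u = conv f h u + conv g h u"
  by (induction u arbitrary: f g) (auto simp: algebra_simps)

lemma conv_add_right: "conv h (\<lambda>u. f u + g u) u = conv h f u + conv h g u"
  by (induction u arbitrary: h) (auto simp: algebra_simps)

lemma conv_scale_left: "conv (\<lambda>u. c * f u) g u = c * conv f g u"
  by (induction u arbitrary: f) (auto simp: algebra_simps)

lemma conv_zero_left [simp]: "conv (\<lambda>u. 0) g u = 0"
  by (induction u) auto

lemma conv_one_left: "conv (\<lambda>u. if u = [] then 1 else 0) g u = g u"
  by (cases u) auto

lemma conv_one_right: "conv f (\<lambda>u. if u = [] then 1 else 0) u = f u"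
  by (induction u arbitrary: f) auto

lemma conv_assoc: "conv (conv f g) h u = conv f (conv g h) u"
proof (induction u arbitrary: f)
  case (Cons a u)
  have "(\<lambda>v. conv f g (a # v)) = (\<lambda>v. f [] * g (a # v) + conv (\<lambda>w. f (a # w)) g v)"
    by simp
  then have "conv (conv f g) h (a # u) = f [] * g [] * h (a # u) +
      (f [] * conv (\<lambda>v. g (a # v)) h u + conv (conv (\<lambda>w. f (a # w)) g) h u)"
    by (simp add: conv_add_left conv_scale_left)
  then show ?case
    by (simp add: Cons.IH algebra_simps)
qed simp

instantiation ncps :: (type) ring_1
begin

definition "0 = Series (\<lambda>u. 0)"
definition "1 = Series (\<lambda>u. if u = [] then 1 else 0)"
definition "f + g = Series (\<lambda>u. coeff f u + coeff g u)"
definition "f - g = Series (\<lambda>u. coeff f u - coeff g u)"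
definition "- f = Series (\<lambda>u. - coeff f u)"
definition "f * g = Series (conv (coeff f) (coeff g))"

instance
proof
  fix f g h :: "'a ncps"
  show "f * g * h = f * (g * h)"
    by (rule ncps_eqI) (simp add: times_ncps_def conv_assoc)
  show "(f + g) * h = f * h + g * h" "f * (g + h) = f * g + f * h"
    by (rule ncps_eqI, simp add: times_ncps_def plus_ncps_def conv_add_left conv_add_right)+
  show "1 * f = f" "f * 1 = f"
    by (rule ncps_eqI, simp add: times_ncps_def one_ncps_def conv_one_left conv_one_right)+
  show "(0::'a ncps) \<noteq> 1"
    by (auto dest!: arg_cong[where f = "\<lambda>f. coeff f []"] simp: zero_ncps_def one_ncps_def)
qed (rule ncps_eqI,
    simp add: plus_ncps_def minus_ncps_def uminus_ncps_def zero_ncps_def)+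

end

lemma coeff_simps [simp]:
  "coeff 0 u = 0" "coeff 1 u = (if u = [] then 1 else 0)"
  "coeff (f + g) u = coeff f u + coeff g u" "coeff (f - g) u = coeff f u - coeff g u"
  "coeff (- f) u = - coeff f u"
  by (simp_all add: zero_ncps_def one_ncps_def plus_ncps_def minus_ncps_def uminus_ncps_def)

section \<open>Orders of series and coefficients in lowest degree\<close>

definition deg_ge :: "nat \<Rightarrow> 'a ncps \<Rightarrow> bool" where
  "deg_ge d f \<longleftrightarrow> (\<forall>u. length u < d \<longrightarrow> coeff f u = 0)"

text \<open>A splitting of a word of length at most a + b can contribute only if its left part has
  length at least a and its right part at least b; this leaves one splitting in length a + b and
  none below.\<close>

lemma conv_deg:
  assumes "\<And>v. length v < a \<Longrightarrow> f v = 0" "\<And>v. length v < b \<Longrightarrow> g v = 0" "length u \<le> a + b"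
  shows "conv f g u = (if length u = a + b then f (take a u) * g (drop a u) else 0)"
  using assms
proof (induction u arbitrary: f a)
  case Nil
  then show ?case
    by (cases "a = 0"; cases "b = 0") auto
next
  case (Cons c u)
  show ?case
  proof (cases a)
    case 0
    have "conv (\<lambda>v. f (c # v)) g u = 0"
      using Cons.IH[of 0 "\<lambda>v. f (c # v)"] Cons.prems 0 by auto
    then show ?thesis
      using Cons.prems 0 by auto
  next
    case (Suc a')
    have "conv (\<lambda>v. f (c # v)) g u = (if length u = a' + b then f (c # take a' u) * g (drop a' u) else 0)"
      using Cons.prems Suc by (intro Cons.IH) auto
    then show ?thesis
      using Cons.prems(1)[of "[]"] Suc by auto
  qed
qed

lemma deg_ge_mult: "deg_ge a f \<Longrightarrow> deg_ge b g \<Longrightarrow> deg_ge (a + b) (f * g)"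
  by (auto simp: deg_ge_def times_ncps_def conv_deg[of a _ b])

lemma coeff_mult:
  "deg_ge a f \<Longrightarrow> deg_ge b g \<Longrightarrow> length u = a + b \<Longrightarrow>
    coeff (f * g) u = coeff f (take a u) * coeff g (drop a u)"
  by (auto simp: deg_ge_def times_ncps_def conv_deg[of a _ b])

lemma deg_ge_0 [simp]: "deg_ge 0 f"
  by (simp add: deg_ge_def)

lemma deg_ge_mult_left: "deg_ge b g \<Longrightarrow> deg_ge b (f * g)"
  using deg_ge_mult[of 0 f b g] by simp

lemma deg_ge_mult_right: "deg_ge a f \<Longrightarrow> deg_ge a (f * g)"
  using deg_ge_mult[of a f 0 g] by simp

lemma deg_ge_simps [intro]:
  "deg_ge d 0" "deg_ge d f \<Longrightarrow> deg_ge d g \<Longrightarrow> deg_ge d (f + g)"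
  "deg_ge d f \<Longrightarrow> deg_ge d g \<Longrightarrow> deg_ge d (f - g)" "deg_ge d f \<Longrightarrow> deg_ge d (- f)"
  by (auto simp: deg_ge_def)

definition Var :: "'a \<Rightarrow> 'a ncps" where
  "Var k = Series (\<lambda>u. if u = [k] then 1 else 0)"

lemma coeff_Var [simp]: "coeff (Var k) u = (if u = [k] then 1 else 0)"
  by (simp add: Var_def)

abbreviation ncps_units :: "'a ncps monoid" where
  "ncps_units \<equiv> units_of \<lparr>carrier = UNIV, monoid.mult = (*), one = 1\<rparr>"

lemma group_ncps_units: "group (ncps_units :: 'a ncps monoid)"
proof -
  interpret monoid "\<lparr>carrier = UNIV :: 'a ncps set, monoid.mult = (*), one = 1\<rparr>"
    by unfold_locales (auto simp: mult.assoc)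
  show ?thesis by (rule units_group)
qed

lemma carrier_ncps_units: "f \<in> carrier ncps_units \<longleftrightarrow> (\<exists>g. g * f = 1 \<and> f * g = 1)"
  by (simp add: units_of_def Units_def)

lemma ncps_units_simps [simp]:
  "monoid.mult ncps_units f g = f * g" "one ncps_units = 1"
  by (simp_all add: units_of_def)

definition letter_series :: "'a \<Rightarrow> 'a ncps" where
  "letter_series k = 1 + Var k"

lemma conv_Var_left: "conv (coeff (Var k)) g u = (case u of [] \<Rightarrow> 0 | a # v \<Rightarrow> if a = k then g v else 0)"
proof (cases u)
  case (Cons a v)
  have "conv (\<lambda>v. coeff (Var k) (a # v)) g v = (if a = k then g v else 0)"
    using conv_one_left[of g v] by auto
  then show ?thesis
    by (simp add: Cons)
qed simp

lemma coeff_Var_mult: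
  "coeff (Var k * g) u = (case u of [] \<Rightarrow> 0 | a # v \<Rightarrow> if a = k then coeff g v else 0)"
  by (simp add: times_ncps_def conv_Var_left)

lemma coeff_mult_Var:
  "coeff (g * Var k) u = (if u \<noteq> [] \<and> last u = k then coeff g (butlast u) else 0)"
proof -
  have "conv f (coeff (Var k)) u = (if u \<noteq> [] \<and> last u = k then f (butlast u) else 0)" for f
  proof (induction u arbitrary: f)
    case (Cons a u)
    then show ?case
      by (cases u) auto
  qed auto
  then show ?thesis
    by (simp add: times_ncps_def)
qed

lemma letter_series_unit: "letter_series k \<in> carrier ncps_units"
proof -
  \<comment> \<open>The geometric series 1 - x + x^2 - ... in the single variable x of index
    k.\<close>
  define g where "g = Series (\<lambda>u. if set u \<subseteq> {k} then (-1) ^ length u else 0)"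
  have "letter_series k * g = 1"
    by (rule ncps_eqI)
      (auto simp: letter_series_def distrib_right coeff_Var_mult g_def split: list.splits)
  moreover have "g * letter_series k = 1"
  proof (rule ncps_eqI)
    fix u :: "'a list"
    show "coeff (g * letter_series k) u = coeff 1 u"
    proof (cases u rule: rev_cases)
      case (snoc v a)
      then show ?thesis
        by (auto simp: letter_series_def distrib_left coeff_mult_Var g_def)
    qed (auto simp: letter_series_def distrib_left coeff_mult_Var g_def)
  qed
  ultimately show ?thesis
    by (auto simp: carrier_ncps_units)
qed

text \<open>Words are evaluated letter by letter, without reference to a set of generators. The same
  function is the Magnus homomorphism of every \<open>Fn m\<close>, so coefficients may be compared
  between \<open>Fn m\<close> and \<open>Fn n\<close>.\<close>

definition magnus :: "('a \<times> bool) list \<Rightarrow> 'a ncps" where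
  "magnus = free_ext ncps_units letter_series"

lemma magnus_hom: "magnus \<in> hom (free_group S) ncps_units"
  unfolding magnus_def
  by (rule group.free_ext_hom[OF group_ncps_units]) (use letter_series_unit in auto)

interpretation magnus: group_hom "free_group S" ncps_units magnus for S
  by (simp add: group_hom_def group_hom_axioms_def group_free_group group_ncps_units magnus_hom)

lemma magnus_gen: "magnus (gen k) = 1 + Var k"
  using group.free_ext_gen[OF group_ncps_units, of letter_series k, OF letter_series_unit]
  by (simp add: magnus_def letter_series_def)

lemma magnus_mult:
  "a \<in> carrier (free_group S) \<Longrightarrow> b \<in> carrier (free_group S) \<Longrightarrow>
    magnus (a \<otimes>\<^bsub>free_group S\<^esub> b) = magnus a * magnus b"
  using magnus.hom_mult by simp

lemma magnus_one [simp]: "magnus \<one>\<^bsub>free_group S\<^esub> = 1"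
  using magnus.hom_one[of S] by simp

lemma magnus_inv:
  assumes "a \<in> carrier (free_group S)"
  shows "magnus (inv\<^bsub>free_group S\<^esub> a) * magnus a = 1" "magnus a * magnus (inv\<^bsub>free_group S\<^esub> a) = 1"
  using assms F.inv_closed[OF assms]
  by (metis magnus_mult magnus_one F.l_inv F.r_inv)+

lemma coeff_Nil_mult: "coeff (f * g) [] = coeff f [] * coeff g []"
  by (simp add: times_ncps_def)

lemma coeff_magnus_Nil: "coeff (magnus w) [] = 1"
proof (induction w)
  case (Cons a w)
  let ?l = "letter_series (fst a)"
  have l: "coeff ?l [] = 1"
    by (simp add: letter_series_def)
  have "inv\<^bsub>ncps_units\<^esub> ?l \<otimes>\<^bsub>ncps_units\<^esub> ?l = \<one>\<^bsub>ncps_units\<^esub>"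
    by (rule group.l_inv[OF group_ncps_units letter_series_unit])
  then have "coeff (inv\<^bsub>ncps_units\<^esub> ?l * ?l) [] = 1"
    by simp
  then have "coeff (inv\<^bsub>ncps_units\<^esub> ?l) [] = 1"
    by (simp add: coeff_Nil_mult l)
  then show ?case
    using Cons l by (cases a) (auto simp: magnus_def free_ext_def coeff_Nil_mult)
qed (simp add: magnus_def free_ext_def)

lemma deg_ge_magnus: "deg_ge 1 (magnus w - 1)"
  using coeff_magnus_Nil[of w] by (auto simp: deg_ge_def)

text \<open>[a,b] - 1 equals the inverse of ba times ab - ba, and ab - ba does not change when 1 is
  subtracted from both factors.\<close>

lemma magnus_commutator:
  assumes "a \<in> carrier (free_group S)" "b \<in> carrier (free_group S)"
  shows "magnus (commutator (free_group S) a b) - 1 =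
    magnus (inv\<^bsub>free_group S\<^esub> (b \<otimes>\<^bsub>free_group S\<^esub> a)) *
      ((magnus a - 1) * (magnus b - 1) - (magnus b - 1) * (magnus a - 1))"
proof -
  have "magnus (commutator (free_group S) a b) =
      magnus (inv\<^bsub>free_group S\<^esub> (b \<otimes>\<^bsub>free_group S\<^esub> a) \<otimes>\<^bsub>free_group S\<^esub> (a \<otimes>\<^bsub>free_group S\<^esub> b))"
    using assms by (simp add: F.word_simps)
  also have "\<dots> = magnus (inv\<^bsub>free_group S\<^esub> (b \<otimes>\<^bsub>free_group S\<^esub> a)) * (magnus a * magnus b)"
    using assms by (simp add: magnus_mult del: magnus.hom_mult magnus.hom_inv)
  finally have *: "magnus (commutator (free_group S) a b) =
      magnus (inv\<^bsub>free_group S\<^esub> (b \<otimes>\<^bsub>free_group S\<^esub> a)) * (magnus a * magnus b)" .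
  have "magnus (inv\<^bsub>free_group S\<^esub> (b \<otimes>\<^bsub>free_group S\<^esub> a)) * (magnus b * magnus a) = 1"
    using assms magnus_inv(1)[of "b \<otimes>\<^bsub>free_group S\<^esub> a" S] by (simp add: magnus_mult del: magnus.hom_mult magnus.hom_inv)
  then show ?thesis
    unfolding * by (simp add: algebra_simps)
qed

lemma magnus_commutator_deg:
  assumes "a \<in> carrier (free_group S)" "b \<in> carrier (free_group S)"
    and "deg_ge p (magnus a - 1)" "deg_ge q (magnus b - 1)"
  shows "deg_ge (p + q) (magnus (commutator (free_group S) a b) - 1)"
  unfolding magnus_commutator[OF assms(1,2)]
  using deg_ge_mult[OF assms(3,4)] deg_ge_mult[OF assms(4,3)]
  by (auto intro!: deg_ge_mult_left simp: add.commute)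

lemma coeff_magnus_commutator:
  assumes "a \<in> carrier (free_group S)" "b \<in> carrier (free_group S)"
    and a: "deg_ge p (magnus a - 1)" "1 \<le> p" and b: "deg_ge q (magnus b - 1)" "1 \<le> q"
    and u: "length u = p + q"
  shows "coeff (magnus (commutator (free_group S) a b)) u =
    coeff (magnus a) (take p u) * coeff (magnus b) (drop p u) -
    coeff (magnus b) (take q u) * coeff (magnus a) (drop q u)"
proof -
  let ?f = "magnus a - 1" and ?g = "magnus b - 1"
    and ?w = "magnus (inv\<^bsub>free_group S\<^esub> (b \<otimes>\<^bsub>free_group S\<^esub> a))"
  have ne: "u \<noteq> []" "take p u \<noteq> []" "drop p u \<noteq> []" "take q u \<noteq> []" "drop q u \<noteq> []"
    using u a(2) b(2) by auto
  have "deg_ge (p + q) (?f * ?g - ?g * ?f)"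
    using deg_ge_mult[OF a(1) b(1)] deg_ge_mult[OF b(1) a(1)] by (auto simp: add.commute)
  \<comment> \<open>The unit in front has constant term 1, so replacing it by 1 does not affect
    degree p + q: what remains is the Lie bracket of the lowest parts.\<close>
  then have "deg_ge (1 + (p + q)) ((?w - 1) * (?f * ?g - ?g * ?f))"
    by (rule deg_ge_mult[OF deg_ge_magnus])
  then have "coeff ((?w - 1) * (?f * ?g - ?g * ?f)) u = 0"
    using u by (auto simp: deg_ge_def)
  then have "coeff (?w * (?f * ?g - ?g * ?f)) u = coeff (?f * ?g) u - coeff (?g * ?f) u"
    by (simp only: left_diff_distrib coeff_simps) simp
  then have "coeff (magnus (commutator (free_group S) a b) - 1) u = coeff (?f * ?g) u - coeff (?g * ?f) u"
    by (simp only: magnus_commutator[OF assms(1,2)])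
  then show ?thesis
    using ne u coeff_mult[OF a(1) b(1), of u] coeff_mult[OF b(1) a(1), of u] by simp
qed

lemma magnus_mult_deg:
  assumes "a \<in> carrier (free_group S)" "b \<in> carrier (free_group S)"
    "deg_ge q (magnus a - 1)" "deg_ge q (magnus b - 1)"
  shows "deg_ge q (magnus (a \<otimes>\<^bsub>free_group S\<^esub> b) - 1)"
proof -
  have eq: "magnus (a \<otimes>\<^bsub>free_group S\<^esub> b) - 1 = (magnus a - 1) * magnus b + (magnus b - 1)"
    using assms(1,2) by (simp only: magnus_mult) (simp add: algebra_simps)
  show ?thesis
    unfolding eq using assms by (intro deg_ge_simps(2) deg_ge_mult_right)
qed

lemma magnus_inv_deg:
  assumes "a \<in> carrier (free_group S)" "deg_ge q (magnus a - 1)"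
  shows "deg_ge q (magnus (inv\<^bsub>free_group S\<^esub> a) - 1)"
proof -
  have "magnus (inv\<^bsub>free_group S\<^esub> a) - 1 = - (magnus (inv\<^bsub>free_group S\<^esub> a) * (magnus a - 1))"
    using magnus_inv(1)[OF assms(1)] by (simp only: right_diff_distrib) simp
  then show ?thesis
    using assms by (auto intro: deg_ge_mult_left)
qed

text \<open>The cross term of (a - 1) and (b - 1) has order at least 2q, so in degree q products
  become sums.\<close>

lemma coeff_magnus_mult:
  assumes "a \<in> carrier (free_group S)" "b \<in> carrier (free_group S)"
    "deg_ge q (magnus a - 1)" "deg_ge q (magnus b - 1)" "length u = q" "1 \<le> q"
  shows "coeff (magnus (a \<otimes>\<^bsub>free_group S\<^esub> b)) u = coeff (magnus a) u + coeff (magnus b) u"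
proof -
  have eq: "magnus (a \<otimes>\<^bsub>free_group S\<^esub> b) = magnus a + magnus b - 1 + (magnus a - 1) * (magnus b - 1)"
    using assms(1,2) by (simp only: magnus_mult) (simp add: algebra_simps)
  have "coeff ((magnus a - 1) * (magnus b - 1)) u = 0"
    using deg_ge_mult[OF assms(3,4)] assms(5,6) by (auto simp: deg_ge_def)
  moreover have "u \<noteq> []"
    using assms(5,6) by auto
  ultimately show ?thesis
    unfolding eq by simp
qed

lemma coeff_magnus_inv:
  assumes "a \<in> carrier (free_group S)" "deg_ge q (magnus a - 1)" "length u = q" "1 \<le> q"
  shows "coeff (magnus (inv\<^bsub>free_group S\<^esub> a)) u = - coeff (magnus a) u"
proof -
  have "u \<noteq> []"
    using assms(3,4) by auto
  moreover have "coeff (magnus (inv\<^bsub>free_group S\<^esub> a \<otimes>\<^bsub>free_group S\<^esub> a)) u =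
      coeff (magnus (inv\<^bsub>free_group S\<^esub> a)) u + coeff (magnus a) u"
    using assms by (intro coeff_magnus_mult magnus_inv_deg) (auto simp del: magnus.hom_inv)
  ultimately show ?thesis
    using assms(1) by (simp del: magnus.hom_inv magnus.hom_mult)
qed

lemma coeff_magnus_pow:
  assumes "a \<in> carrier (free_group S)" "deg_ge q (magnus a - 1)" "length u = q" "1 \<le> q"
  shows "deg_ge q (magnus (a [^]\<^bsub>free_group S\<^esub> (e::int)) - 1) \<and>
    coeff (magnus (a [^]\<^bsub>free_group S\<^esub> e)) u = e * coeff (magnus a) u"
proof (induction e rule: int_induct[where k = 0])
  case base
  have "u \<noteq> []"
    using assms(3,4) by auto
  then show ?case
    by (auto simp del: magnus.hom_int_pow)
next
  case (step1 e)
  then show ?case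
    using assms by (simp add: F.int_pow_mult magnus_mult_deg coeff_magnus_mult[where q = q]
      distrib_right del: magnus.hom_int_pow magnus.hom_mult)
next
  case (step2 e)
  have "a [^]\<^bsub>free_group S\<^esub> (e - 1) = a [^]\<^bsub>free_group S\<^esub> e \<otimes>\<^bsub>free_group S\<^esub> inv\<^bsub>free_group S\<^esub> a"
    using assms(1) F.int_pow_mult[of a S e "-1"] by (simp add: F.int_pow_neg)
  then show ?case
    using assms step2 by (simp add: magnus_mult_deg magnus_inv_deg coeff_magnus_inv[where q = q]
      coeff_magnus_mult[where q = q] left_diff_distrib
      del: magnus.hom_int_pow magnus.hom_mult magnus.hom_inv)
qed

text \<open>The easy half of Magnus's theorem: orders add up under commutators, and every group
  element has order at least 1.\<close>

lemma magnus_lower_central: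
  "w \<in> lower_central (free_group S) q \<Longrightarrow> deg_ge q (magnus w - 1)"
proof (induction q arbitrary: w rule: induct_nat_012)
  case (ge2 q)
  let ?H = "{w \<in> carrier (free_group S). deg_ge (Suc (Suc q)) (magnus w - 1)}"
  have "lower_central (free_group S) (Suc (Suc q)) \<subseteq> ?H"
  proof (rule F.lower_central_Suc_le)
    show "subgroup ?H (free_group S)"
      by (intro F.subgroupI)
        (auto simp del: magnus.hom_inv magnus.hom_mult
          intro!: magnus_mult_deg magnus_inv_deg exI[of _ "\<one>\<^bsub>free_group S\<^esub>"])
    fix a b assume ab: "a \<in> lower_central (free_group S) (Suc q)" "b \<in> carrier (free_group S)"
    then show "commutator (free_group S) a b \<in> ?H"
      using ge2.IH(2)[of a] magnus_commutator_deg[of a S b "Suc q" 1] deg_ge_magnus[of b]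
        F.lower_central_carrier[of a S "Suc q"]
      by auto
  qed simp
  then show ?case
    using ge2.prems by blast
qed (use deg_ge_magnus in auto)

section \<open>Lazard elimination\<close>

context filtration
begin

text \<open>\<open>lie B d a\<close> states that the class of \<open>a\<close> in degree \<open>d\<close> belongs to the graded Lie subring
  generated by the classes of the elements of \<open>B\<close>, given together with their degrees.\<close>

inductive lie :: "(nat \<times> 'a) set \<Rightarrow> nat \<Rightarrow> 'a \<Rightarrow> bool" for B where
  gen: "(d, c) \<in> B \<Longrightarrow> 1 \<le> d \<Longrightarrow> c \<in> N d \<Longrightarrow> lie B d c"
| high: "1 \<le> d \<Longrightarrow> c \<in> N (Suc d) \<Longrightarrow> lie B d c"
| mult: "lie B d a \<Longrightarrow> lie B d b \<Longrightarrow> lie B d (a \<otimes> b)"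
| inverse: "lie B d a \<Longrightarrow> lie B d (inv a)"
| bracket: "lie B p a \<Longrightarrow> lie B q b \<Longrightarrow> lie B (p + q) (commutator G a b)"

lemma lie_mem: "lie B d a \<Longrightarrow> 1 \<le> d \<and> a \<in> N d"
proof (induction rule: lie.induct)
  case (high d c)
  then show ?case
    using Suc_subset by blast
qed (auto intro: mult_mem inv_mem commutator_mem)

lemma lie_one: "1 \<le> d \<Longrightarrow> lie B d \<one>"
  by (rule lie.high) (simp_all add: one_mem)

lemma lie_subgroup: "1 \<le> d \<Longrightarrow> subgroup {a. lie B d a} G"
proof (rule subgroupI)
  assume d: "1 \<le> d"
  show "{a. lie B d a} \<subseteq> carrier G"
    using lie_mem mem_carrier by blast
  show "{a. lie B d a} \<noteq> {}"
    using lie_one[OF d] by blast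
qed (auto intro: lie.mult lie.inverse)

text \<open>The end point of the elimination: without generators all derivations start from
  \<open>high\<close>, and none of the other rules leads back to a nontrivial class.\<close>

lemma lie_empty: "lie {} d a \<Longrightarrow> a \<in> N (Suc d)"
proof (induction rule: lie.induct)
  case (bracket p a q b)
  then have "1 \<le> p" "1 \<le> q" "b \<in> N q"
    by (auto dest: lie_mem)
  then show ?case
    using commutator_mem[of "Suc p" q a b] bracket.IH by auto
qed (auto intro: mult_mem inv_mem)

text \<open>The elements ad(x)^k c that generate the complement of x in Lazard elimination; w is the
  degree of x. Cutting off at degree q keeps the family finite for finite Y and positive w.\<close>

definition eliminate :: "nat \<Rightarrow> 'a \<Rightarrow> (nat \<times> 'a) set \<Rightarrow> nat \<Rightarrow> (nat \<times> 'a) set" where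
  "eliminate w x Y q =
    {(k * w + d, (commutator G x ^^ k) c) | k d c. (d, c) \<in> Y \<and> k * w + d \<le> q}"

text \<open>ad(x) acts as a derivation: it sends a generator with exponent k to the one with k + 1,
  and brackets are handled by \<open>jacobi_mem\<close>. The bound on w + d ensures that the
  generator with k + 1 has not been cut off.\<close>

lemma lie_eliminate_ad:
  assumes w: "1 \<le> w" "x \<in> N w"
  shows "lie (eliminate w x Y q) d h \<Longrightarrow> w + d \<le> q \<Longrightarrow>
    lie (eliminate w x Y q) (w + d) (commutator G x h)"
proof (induction rule: lie.induct)
  case (gen d c)
  then obtain k d' c' where "d = k * w + d'" "c = (commutator G x ^^ k) c'" "(d', c') \<in> Y"
    by (auto simp: eliminate_def)
  then have "(w + d, commutator G x c) \<in> eliminate w x Y q"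
    using gen.prems unfolding eliminate_def by (intro CollectI exI[of _ "Suc k"] exI) auto
  then show ?case
    using w gen.hyps by (intro lie.gen commutator_mem) auto
next
  case (high d c)
  then show ?case
    using commutator_mem[of w "Suc d" x c] w by (intro lie.high) auto
next
  case (mult d a b)
  have d: "1 \<le> d" "a \<in> N d" "b \<in> N d"
    using mult.hyps by (auto dest: lie_mem)
  have "commutator G x (a \<otimes> b) \<in> {h. lie (eliminate w x Y q) (w + d) h}"
    using w d mult by (intro commutator_mult_right_mem[of w d] lie_subgroup) (auto intro: lie.high)
  then show ?case by simp
next
  case (inverse d a)
  have d: "1 \<le> d" "a \<in> N d"
    using inverse.hyps by (auto dest: lie_mem)
  have "commutator G x (inv a) \<in> {h. lie (eliminate w x Y q) (w + d) h}"
    using w d inverse by (intro commutator_inv_right_mem[of w d] lie_subgroup) (auto intro: lie.high)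
  then show ?case by simp
next
  case (bracket p a r b)
  let ?L = "lie (eliminate w x Y q)"
  have d: "1 \<le> p" "a \<in> N p" "1 \<le> r" "b \<in> N r"
    using bracket.hyps by (auto dest: lie_mem)
  have c: "x \<in> carrier G" "a \<in> carrier G" "b \<in> carrier G"
    using w d by (auto intro: mem_carrier)
  have xa: "?L (w + p) (commutator G x a)" and xb: "?L (w + r) (commutator G x b)"
    using bracket by auto
  have bx: "?L (w + r) (commutator G b x)"
    using lie.inverse[OF xb] c by (simp add: inv_commutator)
  have V: "subgroup {h. ?L (w + p + r) h} G" "N (Suc (w + p + r)) \<subseteq> {h. ?L (w + p + r) h}"
    using w d by (auto intro: lie_subgroup lie.high)
  have "r + w + p = w + p + r"
    by simp
  then have J2: "commutator G (commutator G b x) a \<in> {h. ?L (w + p + r) h}"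
    using lie.bracket[OF bx bracket.hyps(1)] by (metis add.assoc add.commute mem_Collect_eq)
  have J1: "commutator G (commutator G x a) b \<in> {h. ?L (w + p + r) h}"
    using lie.bracket[OF xa bracket.hyps(2)] by simp
  have "commutator G (commutator G a b) x \<in> {h. ?L (w + p + r) h}"
    by (rule jacobi_mem[OF w(1) d(1,3) V w(2) d(2,4) J1 J2])
  then have "?L (w + p + r) (inv commutator G (commutator G a b) x)"
    by (auto intro: lie.inverse)
  then show ?case
    using c by (simp add: inv_commutator add.assoc)
qed

text \<open>The elements of the form x^e h are closed under all rules of \<open>lie\<close>. The
  power of x can occur only in its own degree w, and brackets never produce one, because L' is
  stable under ad(x) and powers of x commute.\<close>

lemma lie_eliminate:
  assumes w: "1 \<le> w" "x \<in> N w"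
  shows "lie (insert (w, x) Y) d g \<Longrightarrow> d \<le> q \<Longrightarrow>
    \<exists>(e::int) h. g = x [^] e \<otimes> h \<and> lie (eliminate w x Y q) d h \<and> (d = w \<or> e = 0)"
proof (induction rule: lie.induct)
  case (gen d c)
  show ?case
  proof (cases "(d, c) = (w, x)")
    case True
    then show ?thesis
      using w by (intro exI[of _ 1] exI[of _ \<one>]) (auto simp: int_pow_1 mem_carrier intro: lie_one)
  next
    case False
    then have "(d, c) \<in> eliminate w x Y q"
      using gen unfolding eliminate_def by (intro CollectI exI[of _ 0] exI) auto
    then show ?thesis
      using gen by (intro exI[of _ 0] exI[of _ c]) (auto simp: mem_carrier intro: lie.gen)
  qed
next
  case (high d c)
  then show ?case
    by (intro exI[of _ 0] exI[of _ c]) (auto simp: mem_carrier[of "Suc d"] intro: lie.high)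
next
  case (mult d a b)
  let ?L = "lie (eliminate w x Y q)"
  obtain e h e' h' where ab: "a = x [^] (e::int) \<otimes> h" "?L d h" "d = w \<or> e = 0"
      "b = x [^] (e'::int) \<otimes> h'" "?L d h'" "d = w \<or> e' = 0"
    using mult by blast
  have d: "1 \<le> d" "h \<in> N d" "h' \<in> N d"
    using ab by (auto dest: lie_mem)
  have X: "x [^] e' \<in> N d"
    using ab(6) w d one_mem pow_mem by (cases "e' = 0") auto
  have c: "x \<in> carrier G" "h \<in> carrier G" "h' \<in> carrier G"
    using w d by (auto intro: mem_carrier)
  \<comment> \<open>Moving the power of x to the left past h costs this commutator, which has degree
    2d and is absorbed by \<open>high\<close>.\<close>
  have "?L d (commutator G h (x [^] e'))"
    using commutator_mem'[of d d h "x [^] e'" "Suc d"] d X by (intro lie.high) auto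
  then have "?L d (h \<otimes> commutator G h (x [^] e') \<otimes> h')"
    using ab by (intro lie.mult)
  moreover have "a \<otimes> b = x [^] (e + e') \<otimes> (h \<otimes> commutator G h (x [^] e') \<otimes> h')"
  proof -
    have "a \<otimes> b = x [^] e \<otimes> (h \<otimes> x [^] e') \<otimes> h'"
      using ab c by (simp add: m_assoc)
    also have "h \<otimes> x [^] e' = x [^] e' \<otimes> h \<otimes> commutator G h (x [^] e')"
      using mult_commutator[of h "x [^] e'"] c by simp
    finally show ?thesis
      using c by (simp add: int_pow_mult m_assoc)
  qed
  ultimately show ?case
    using ab by (intro exI[of _ "e + e'"] exI) auto
next
  case (inverse d a)
  let ?L = "lie (eliminate w x Y q)"
  obtain e h where a: "a = x [^] (e::int) \<otimes> h" "?L d h" "d = w \<or> e = 0"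
    using inverse by blast
  have d: "1 \<le> d" "h \<in> N d"
    using a by (auto dest: lie_mem)
  have X: "x [^] (- e) \<in> N d"
    using a w d one_mem pow_mem by (cases "e = 0") auto
  have c: "x \<in> carrier G" "h \<in> carrier G"
    using w d by (auto intro: mem_carrier)
  have "?L d (commutator G (inv h) (x [^] (- e)))"
    using commutator_mem'[of d d "inv h" "x [^] (- e)" "Suc d"] d X inv_mem by (intro lie.high) auto
  then have "?L d (inv h \<otimes> commutator G (inv h) (x [^] (- e)))"
    using a by (intro lie.mult lie.inverse)
  moreover have "inv a = x [^] (- e) \<otimes> (inv h \<otimes> commutator G (inv h) (x [^] (- e)))"
  proof -
    have "inv a = inv h \<otimes> x [^] (- e)"
      using a c by (simp add: inv_mult_group int_pow_neg)
    also have "\<dots> = x [^] (- e) \<otimes> inv h \<otimes> commutator G (inv h) (x [^] (- e))"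
      using mult_commutator[of "inv h" "x [^] (- e)"] c by simp
    finally show ?thesis
      using c by (simp add: m_assoc)
  qed
  ultimately show ?case
    using a by (intro exI[of _ "- e"] exI) auto
next
  case (bracket p a r b)
  let ?L = "lie (eliminate w x Y q)"
  let ?V = "{h. ?L (p + r) h}"
  have "p \<le> q" "r \<le> q"
    using bracket.prems by auto
  then obtain e h e' h' where ab: "a = x [^] (e::int) \<otimes> h" "?L p h" "p = w \<or> e = 0"
      "b = x [^] (e'::int) \<otimes> h'" "?L r h'" "r = w \<or> e' = 0"
    using bracket.IH by blast
  have d: "1 \<le> p" "1 \<le> r" "h \<in> N p" "h' \<in> N r"
    using ab by (auto dest: lie_mem)
  have X: "x [^] e \<in> N p" "x [^] e' \<in> N r"
    using ab(3,6) w d one_mem pow_mem by (cases "e = 0"; cases "e' = 0"; auto)+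
  have c: "x \<in> carrier G" "h \<in> carrier G" "h' \<in> carrier G"
    using w d by (auto intro: mem_carrier)
  have V: "subgroup ?V G" "N (Suc (p + r)) \<subseteq> ?V"
    using d by (auto intro: lie_subgroup lie.high)
  have V': "subgroup {h. ?L (w + s) h} G" "N (Suc (w + s)) \<subseteq> {h. ?L (w + s) h}" for s
    using w by (auto intro: lie_subgroup lie.high)
  have one: "\<one> \<in> ?V"
    using d by (auto intro: lie_one)
  have triv: "commutator G \<one> y = \<one>" "commutator G y \<one> = \<one>" if "y \<in> carrier G" for y
    using that by (simp_all add: commutator_def)
  \<comment> \<open>Of the four commutators in the expansion of [x^e h, x^e' h'], this is the only
    one without a factor in L'.\<close>
  have XX: "commutator G (x [^] e) (x [^] e') \<in> ?V"
  proof -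
    have "x [^] e \<otimes> x [^] e' = x [^] e' \<otimes> x [^] e"
      using c by (simp flip: int_pow_mult add: add.commute)
    then have "commutator G (x [^] e) (x [^] e') = \<one>"
      using c by (simp add: commutator_def m_assoc)
    then show ?thesis
      using one by simp
  qed
  have Xh: "commutator G (x [^] e) h' \<in> ?V"
  proof (cases "e = 0")
    case False
    then have "p = w" using ab by simp
    moreover have "commutator G x h' \<in> {h. ?L (w + r) h}"
      using lie_eliminate_ad[OF w ab(5)] bracket.prems \<open>p = w\<close> by simp
    ultimately show ?thesis
      using commutator_pow_left_mem[OF w(1) d(2) V' w(2) d(4)] by simp
  qed (use c one triv in auto)
  have hX: "commutator G h (x [^] e') \<in> ?V"
  proof (cases "e' = 0")
    case False
    then have "r = w" using ab by simp
    moreover have "commutator G x h \<in> {h. ?L (w + p) h}"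
      using lie_eliminate_ad[OF w ab(2)] bracket.prems \<open>r = w\<close> by simp
    ultimately have "?L (p + r) (inv commutator G (x [^] e') h)"
      using commutator_pow_left_mem[OF w(1) d(1) V' w(2) d(3), of e'] by (auto simp: ac_simps intro: lie.inverse)
    then show ?thesis
      using c by (simp add: inv_commutator)
  qed (use c one triv in auto)
  have "commutator G h h' \<in> ?V"
    using lie.bracket[OF ab(2,5)] by simp
  then have "commutator G h b \<in> ?V"
    unfolding ab(4) using d X hX by (intro commutator_mult_right_mem[OF d(1,2) V])
  moreover have "commutator G (x [^] e) b \<in> ?V"
    unfolding ab(4) using d X XX Xh by (intro commutator_mult_right_mem[OF d(1,2) V])
  ultimately have "commutator G a b \<in> ?V"
    unfolding ab(1) using d X mult_mem[of r "x [^] e'" h'] ab(4)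
    by (intro commutator_mult_left_mem[OF d(1,2) V]) auto
  moreover have "commutator G a b \<in> carrier G"
    using ab c by simp
  ultimately show ?case
    by (intro exI[of _ 0] exI[of _ "commutator G a b"]) auto
qed

end

section \<open>The theorem of Magnus and Witt\<close>

lemma append_less_append_iff:
  "length u = length u' \<Longrightarrow> u @ v < u' @ v' \<longleftrightarrow> u < u' \<or> (u = u' \<and> v < v')"
  for u u' :: "'a::linorder list"
  by (induction u u' rule: list_induct2) auto

text \<open>If x is not a prefix of y, the comparison is decided at a letter of both words, so
  anything may be appended.\<close>

lemma less_append_mono:
  "x < y \<Longrightarrow> \<not> prefix x y \<Longrightarrow> x @ a < y @ b" for x y :: "'a::linorder list"
proof (induction x arbitrary: y)
  case (Cons c x)
  then show ?case by (cases y) auto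
qed simp

lemma le_append: "x \<le> x @ y" for x :: "'a::linorder list"
  by (induction x) auto

lemma less_take:
  fixes x y :: "'a::linorder list"
  assumes "x < y" "\<not> prefix y x"
  shows "take n x < y"
proof -
  have "take n x \<le> x"
    using le_append[of "take n x" "drop n x"] by simp
  then show ?thesis
    using assms by simp
qed

text \<open>\<open>((@) x ^^ k) y\<close> is the word x^k y, the leading word of ad(x)^k applied to
  an element with leading word y.\<close>

lemma funpow_append: "((@) x ^^ k) (y @ z) = ((@) x ^^ k) y @ z"
  by (induction k) auto

lemma length_funpow_append [simp]: "length (((@) x ^^ k) y) = k * length x + length y"
  by (induction k) auto

lemma funpow_append_less: "((@) x ^^ k) y < ((@) x ^^ k) z \<longleftrightarrow> y < z" for x :: "'a::linorder list"
  by (induction k) (auto simp: append_less_append_iff)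

text \<open>Cancelling common copies of x leaves either y and z, or a case where x is comparable
  with y or z in the prefix order. This keeps the words of an eliminated family a prefix
  code.\<close>

lemma prefix_funpow_append:
  assumes "prefix (((@) x ^^ i) y) (((@) x ^^ j) z)"
    "\<not> prefix x y" "\<not> prefix y x" "\<not> prefix x z" "\<not> prefix z x"
  shows "i = j \<and> prefix y z"
  using assms(1)
proof (induction i arbitrary: j)
  case 0
  then show ?case
    using assms(2-) by (cases j) (auto dest: prefix_same_cases[of y _ x])
next
  case (Suc i)
  then show ?case
    using assms(2-) by (cases j) (auto dest: append_prefixD)
qed

text \<open>Only words of the same length as u are compared; lower degrees vanish by membership in
  the lower central series. Coefficient 1, rather than any nonzero value, lets an integer exponent
  be read off directly.\<close>

definition lead :: "'a::linorder list \<Rightarrow> ('a \<times> bool) list \<Rightarrow> bool" where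
  "lead u c \<longleftrightarrow> coeff (magnus c) u = 1 \<and>
    (\<forall>v. length v = length u \<longrightarrow> v < u \<longrightarrow> coeff (magnus c) v = 0)"

text \<open>The two products in the bracket have least words xz and zx. Since xz is the smaller one,
  it survives with coefficient 1.\<close>

lemma lead_commutator:
  assumes c: "c \<in> carrier (free_group S)" "deg_ge (length x) (magnus c - 1)" "lead x c" "x \<noteq> []"
    and d: "d \<in> carrier (free_group S)" "deg_ge (length z) (magnus d - 1)" "lead z d" "z \<noteq> []"
    and less: "x @ z < z @ x"
  shows "lead (x @ z) (commutator (free_group S) c d)"
proof -
  let ?f = "\<lambda>u. coeff (magnus c) u" and ?g = "\<lambda>u. coeff (magnus d) u"
  have eq: "coeff (magnus (commutator (free_group S) c d)) u =
      ?f (take (length x) u) * ?g (drop (length x) u) - ?g (take (length z) u) * ?f (drop (length z) u)"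
    if "length u = length x + length z" for u
    using that c d by (intro coeff_magnus_commutator) (auto simp: Suc_le_eq)
  have zero: "coeff (magnus e) u * coeff (magnus e') v = 0"
    if "lead y e" "lead y' e'" "u @ v < y @ y'" "length u = length y" "length v = length y'"
    for u v y y' :: "'a list" and e e'
    using that by (auto simp: append_less_append_iff lead_def)
  have second: "?g (take (length z) u) * ?f (drop (length z) u) = 0"
    if "length u = length x + length z" "u \<le> x @ z" for u
    using that less by (intro zero[OF d(3) c(3)]) auto
  have first: "?f (take (length x) u) * ?g (drop (length x) u) = 0"
    if "length u = length x + length z" "u < x @ z" for u
    using that less by (intro zero[OF c(3) d(3)]) auto
  show ?thesis
    unfolding lead_def
  proof (intro conjI allI impI)
    show "coeff (magnus (commutator (free_group S) c d)) (x @ z) = 1"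
      using eq[of "x @ z"] second[of "x @ z"] c(3) d(3) by (simp add: lead_def)
    fix v assume "length v = length (x @ z)" "v < x @ z"
    then show "coeff (magnus (commutator (free_group S) c d)) v = 0"
      using eq[of v] second[of v] first[of v] by simp
  qed
qed

lemma lead_funpow:
  assumes x: "cx \<in> lower_central (free_group S) (length x)" "lead x cx" "x \<noteq> []"
    and y: "cy \<in> lower_central (free_group S) (length y)" "lead y cy" "y \<noteq> []"
    and less: "x < y" "\<not> prefix x y"
  shows "(commutator (free_group S) cx ^^ k) cy \<in> lower_central (free_group S) (k * length x + length y) \<and>
    lead (((@) x ^^ k) y) ((commutator (free_group S) cx ^^ k) cy)"
proof (induction k)
  case (Suc k)
  let ?z = "((@) x ^^ k) y" and ?c = "(commutator (free_group S) cx ^^ k) cy"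
  have z: "?z \<noteq> []"
    using y by (metis add_is_0 length_0_conv length_funpow_append)
  have len: "1 \<le> length x" "1 \<le> k * length x + length y"
    using x y by (auto simp: Suc_le_eq)
  \<comment> \<open>Cancelling x^k reduces this to xy < yx, which holds since x < y is decided at a
    letter.\<close>
  have "x @ ?z < ?z @ x"
  proof -
    have "x @ ?z = ((@) x ^^ k) (x @ y)" "?z @ x = ((@) x ^^ k) (y @ x)"
      by (simp_all add: funpow_append flip: funpow_swap1)
    then show ?thesis
      using less_append_mono[OF less] by (simp add: funpow_append_less)
  qed
  then have "lead (x @ ?z) (commutator (free_group S) cx ?c)"
    using x z Suc magnus_lower_central[of cx S] magnus_lower_central[of ?c S]
      F.lower_central_carrier
    by (intro lead_commutator) (auto dest: F.lower_central_carrier)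
  then show ?case
    using F.lower_central_commutator[OF len x(1) conjunct1[OF Suc]] by (simp add: add.assoc)
qed (use y in auto)

section \<open>Elimination of the least word from a prefix code\<close>

definition weighted :: "('a list \<times> 'b) set \<Rightarrow> (nat \<times> 'b) set" where
  "weighted T = (\<lambda>(u, c). (length u, c)) ` T"

text \<open>\<open>eliminate\<close> with the leading words carried along in place of mere
  degrees.\<close>

definition word_eliminate ::
  "'a list \<Rightarrow> ('a \<times> bool) list \<Rightarrow> ('a list \<times> ('a \<times> bool) list) set \<Rightarrow> nat \<Rightarrow> 'a set \<Rightarrow>
    ('a list \<times> ('a \<times> bool) list) set" where
  "word_eliminate x cx Y q S =
    {(((@) x ^^ k) y, (commutator (free_group S) cx ^^ k) c) | k y c.
      (y, c) \<in> Y \<and> k * length x + length y \<le> q}"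

text \<open>The last condition is the prefix code property; it also forbids two different elements
  with the same word.\<close>

definition leading_family :: "'a::linorder set \<Rightarrow> nat \<Rightarrow> ('a list \<times> ('a \<times> bool) list) set \<Rightarrow> bool" where
  "leading_family S q T \<longleftrightarrow> finite T \<and>
    (\<forall>(u, c) \<in> T. u \<noteq> [] \<and> length u \<le> q \<and> c \<in> lower_central (free_group S) (length u) \<and> lead u c) \<and>
    (\<forall>p \<in> T. \<forall>p' \<in> T. prefix (fst p) (fst p') \<longrightarrow> p = p')"

lemma weighted_eliminate:
  "weighted (word_eliminate x cx Y q S) =
    filtration.eliminate (free_group S) (length x) cx (weighted Y) q"
proof -
  interpret filtration "free_group S" "lower_central (free_group S)"
    by (rule F.lower_central_filtration)
  show ?thesis
    unfolding weighted_def word_eliminate_def eliminate_def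
  proof (intro equalityI subsetI)
    fix p assume "p \<in> (\<lambda>(u, c). (length u, c)) ` {(((@) x ^^ k) y, (commutator (free_group S) cx ^^ k) c) |
      k y c. (y, c) \<in> Y \<and> k * length x + length y \<le> q}"
    then obtain k y c where "p = (k * length x + length y, (commutator (free_group S) cx ^^ k) c)"
      "(y, c) \<in> Y" "k * length x + length y \<le> q"
      by auto
    then show "p \<in> {(k * length x + d, (commutator (free_group S) cx ^^ k) c) |
      k d c. (d, c) \<in> (\<lambda>(u, c). (length u, c)) ` Y \<and> k * length x + d \<le> q}"
      by (intro CollectI exI[of _ k] exI[of _ "length y"] exI[of _ c]) force
  next
    fix p assume "p \<in> {(k * length x + d, (commutator (free_group S) cx ^^ k) c) |
      k d c. (d, c) \<in> (\<lambda>(u, c). (length u, c)) ` Y \<and> k * length x + d \<le> q}"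
    then obtain k y c where "p = (k * length x + length y, (commutator (free_group S) cx ^^ k) c)"
      "(y, c) \<in> Y" "k * length x + length y \<le> q"
      by auto
    then show "p \<in> (\<lambda>(u, c). (length u, c)) ` {(((@) x ^^ k) y, (commutator (free_group S) cx ^^ k) c) |
      k y c. (y, c) \<in> Y \<and> k * length x + length y \<le> q}"
      by (intro image_eqI[of _ _ "(((@) x ^^ k) y, (commutator (free_group S) cx ^^ k) c)"]) auto
  qed
qed

lemma leading_familyD:
  assumes "leading_family S q T" "(u, c) \<in> T"
  shows "u \<noteq> []" "length u \<le> q" "c \<in> lower_central (free_group S) (length u)" "lead u c"
    and "(u', c') \<in> T \<Longrightarrow> prefix u u' \<Longrightarrow> (u, c) = (u', c')"
proof -
  have "\<forall>p \<in> T. \<forall>p' \<in> T. prefix (fst p) (fst p') \<longrightarrow> p = p'"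
    using assms(1) by (simp add: leading_family_def)
  from bspec[OF bspec[OF this assms(2)], of "(u', c')"]
  show "(u', c') \<in> T \<Longrightarrow> prefix u u' \<Longrightarrow> (u, c) = (u', c')"
    by simp
  have "case (u, c) of (u, c) \<Rightarrow> u \<noteq> [] \<and> length u \<le> q \<and>
      c \<in> lower_central (free_group S) (length u) \<and> lead u c"
    using assms unfolding leading_family_def by blast
  then show "u \<noteq> []" "length u \<le> q" "c \<in> lower_central (free_group S) (length u)" "lead u c"
    by simp_all
qed

text \<open>Minimality of x and the prefix code property give x < y without x being a prefix of y,
  so the leading word of ad(x)^k y is x^k y. The family loses x and gains only words x^k y with k at
  least 1, all longer than x: one step down in the multiset order.\<close>

lemma leading_family_eliminate:
  assumes T: "leading_family S q T" and x: "(x, cx) \<in> T" "\<And>u c. (u, c) \<in> T \<Longrightarrow> x \<le> u"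
  defines "T' \<equiv> word_eliminate x cx (T - {(x, cx)}) q S"
  shows "leading_family S q T'"
    and "((image_mset (\<lambda>(u, c). Suc q - length u) (mset_set T')),
      (image_mset (\<lambda>(u, c). Suc q - length u) (mset_set T))) \<in> mult1 less_than"
proof -
  let ?Y = "T - {(x, cx)}"
  have fin: "finite T"
    using T by (simp add: leading_family_def)
  note lead = leading_familyD(1-4)[OF T] and pf = leading_familyD(5)[OF T]
  have x': "1 \<le> length x"
    using lead[OF x(1)] by (simp add: Suc_le_eq)
  have Y: "(y, c) \<in> T" "x < y" "\<not> prefix x y" "\<not> prefix y x" if "(y, c) \<in> ?Y" for y c
  proof -
    show "\<not> prefix x y" "\<not> prefix y x"
      using that pf x by blast+
    then show "(y, c) \<in> T" "x < y"
      using that x(2)[of y c] by (auto simp: less_le)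
  qed
  have "T' \<subseteq> (\<lambda>(k, y, c). (((@) x ^^ k) y, (commutator (free_group S) cx ^^ k) c)) ` ({..q} \<times> T)"
  proof
    fix p assume "p \<in> T'"
    then obtain k y c where p: "p = (((@) x ^^ k) y, (commutator (free_group S) cx ^^ k) c)"
      "(y, c) \<in> T" "k * length x + length y \<le> q"
      unfolding T'_def word_eliminate_def by auto
    have "k \<le> q"
      using mult_le_mono2[OF x', of k] p(3) by linarith
    then show "p \<in> (\<lambda>(k, y, c). (((@) x ^^ k) y, (commutator (free_group S) cx ^^ k) c)) ` ({..q} \<times> T)"
      using p by (intro image_eqI[of _ _ "(k, y, c)"]) auto
  qed
  then have fin': "finite T'"
    by (rule finite_subset) (use fin in auto)
  show "leading_family S q T'"
    unfolding leading_family_def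
  proof (intro conjI ballI fin')
    fix p assume "p \<in> T'"
    then obtain k y c where p: "p = (((@) x ^^ k) y, (commutator (free_group S) cx ^^ k) c)"
      "(y, c) \<in> ?Y" "k * length x + length y \<le> q"
      unfolding T'_def word_eliminate_def by auto
    note y = lead[OF Y(1)[OF p(2)]]
    have "((@) x ^^ k) y \<noteq> []"
      using y by (metis add_is_0 length_0_conv length_funpow_append)
    then show "case p of (u, c) \<Rightarrow> u \<noteq> [] \<and> length u \<le> q \<and>
        c \<in> lower_central (free_group S) (length u) \<and> lead u c"
      using lead_funpow[of cx S x c y k] lead[OF x(1)] y Y[OF p(2)] p by simp
  next
    show "prefix (fst p) (fst p') \<longrightarrow> p = p'" if "p \<in> T'" "p' \<in> T'" for p p'
    proof
      assume pre: "prefix (fst p) (fst p')"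
      obtain k y c where p: "p = (((@) x ^^ k) y, (commutator (free_group S) cx ^^ k) c)" "(y, c) \<in> ?Y"
        using \<open>p \<in> T'\<close> unfolding T'_def word_eliminate_def by auto
      obtain k' y' c' where p': "p' = (((@) x ^^ k') y', (commutator (free_group S) cx ^^ k') c')" "(y', c') \<in> ?Y"
        using \<open>p' \<in> T'\<close> unfolding T'_def word_eliminate_def by auto
      have "k = k' \<and> prefix y y'"
        using pre Y[OF p(2)] Y[OF p'(2)] unfolding p p' by (intro prefix_funpow_append) auto
      then show "p = p'"
        using pf[of y c y' c'] p p' by auto
    qed
  qed
  let ?f = "\<lambda>(u::'a list, c::('a \<times> bool) list). Suc q - length u"
  have sub: "?Y \<subseteq> T'"
  proof
    fix p assume "p \<in> ?Y"
    then show "p \<in> T'"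
      using lead[of "fst p" "snd p"] unfolding T'_def word_eliminate_def
      by (intro CollectI exI[of _ 0] exI[of _ "fst p"] exI[of _ "snd p"]) auto
  qed
  have "mset_set T = add_mset (x, cx) (mset_set ?Y)"
    by (rule mset_set.remove[OF fin x(1)])
  moreover have "mset_set T' = mset_set ?Y + mset_set (T' - ?Y)"
  proof -
    have "?Y \<union> (T' - ?Y) = T'"
      using sub by blast
    then show ?thesis
      using mset_set_Union[of ?Y "T' - ?Y"] fin fin' by simp
  qed
  moreover have "?f p < ?f (x, cx)" if p: "p \<in> T' - ?Y" for p
  proof -
    obtain k y c where p': "p = (((@) x ^^ k) y, (commutator (free_group S) cx ^^ k) c)"
      "(y, c) \<in> ?Y" "k * length x + length y \<le> q"
      using p unfolding T'_def word_eliminate_def by auto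
    have "k \<noteq> 0"
      using p p' by (intro notI) auto
    then have "1 * length x \<le> k * length x"
      by (intro mult_le_mono1) simp
    moreover have "0 < length y"
      using lead[OF Y(1)[OF p'(2)]] by simp
    ultimately have "length x < k * length x + length y"
      by linarith
    then show ?thesis
      using p' by simp
  qed
  ultimately show "(image_mset ?f (mset_set T'), image_mset ?f (mset_set T)) \<in> mult1 less_than"
    using fin' by (intro mult1I[of _ "?f (x, cx)" "image_mset ?f (mset_set ?Y)" _
        "image_mset ?f (mset_set (T' - ?Y))"]) (simp_all, fastforce)
qed

text \<open>Proved for all prefixes of x so that the induction passes through brackets: each of the
  two products in the coefficient of [a,b] at a prefix of x has a factor at a shorter prefix. A
  generator of degree at most the length of x must have k = 0, and prefixes of x are smaller than
  its leading word y.\<close>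

lemma coeff_lie_eliminate:
  assumes T: "leading_family S q T" and x: "(x, cx) \<in> T" "\<And>u c. (u, c) \<in> T \<Longrightarrow> x \<le> u"
  shows "filtration.lie (free_group S) (lower_central (free_group S))
      (weighted (word_eliminate x cx (T - {(x, cx)}) q S)) d h \<Longrightarrow>
    d \<le> length x \<Longrightarrow> coeff (magnus h) (take d x) = 0"
proof -
  interpret filtration "free_group S" "lower_central (free_group S)"
    by (rule F.lower_central_filtration)
  let ?T' = "word_eliminate x cx (T - {(x, cx)}) q S"
  have deg: "1 \<le> d \<and> h \<in> carrier (free_group S) \<and> deg_ge d (magnus h - 1)" if "lie (weighted ?T') d h" for d h
    using lie_mem[OF that] magnus_lower_central[of h S d] F.lower_central_carrier[of h S d] by auto
  show "lie (weighted ?T') d h \<Longrightarrow> d \<le> length x \<Longrightarrow> coeff (magnus h) (take d x) = 0"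
  proof (induction rule: lie.induct)
    case (gen d c)
    then obtain k y c' where y: "d = k * length x + length y" "(y, c') \<in> T" "(y, c') \<noteq> (x, cx)"
      "c = (commutator (free_group S) cx ^^ k) c'"
      by (auto simp: weighted_def word_eliminate_def)
    have l: "y \<noteq> []" "lead y c'" and pf: "\<not> prefix y x"
      using leading_familyD[OF T y(2)] x(1) y(3) by auto
    have k: "k = 0"
    proof (rule ccontr)
      assume "k \<noteq> 0"
      then have "1 * length x \<le> k * length x" by (intro mult_le_mono1) simp
      moreover have "0 < length y" using l(1) by simp
      ultimately show False using y(1) gen.prems by linarith
    qed
    have "x < y"
      using x(2)[OF y(2)] pf by (auto simp: less_le)
    then have "take d x < y"
      using pf by (intro less_take)
    then show ?case
      using l(2) y k gen.prems by (auto simp: lead_def)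
  next
    case (high d c)
    then show ?case
      using magnus_lower_central[OF high(2)] by (auto simp: deg_ge_def dest!: spec[of _ "take d x"])
  next
    case (mult d a b)
    then show ?case
      using deg[of d a] deg[of d b] coeff_magnus_mult[of a S b d "take d x"] by simp
  next
    case (inverse d a)
    then show ?case
      using deg[of d a] coeff_magnus_inv[of a S d "take d x"] by simp
  next
    case (bracket p a r b)
    have "coeff (magnus (commutator (free_group S) a b)) (take (p + r) x) =
        coeff (magnus a) (take p (take (p + r) x)) * coeff (magnus b) (drop p (take (p + r) x)) -
        coeff (magnus b) (take r (take (p + r) x)) * coeff (magnus a) (drop r (take (p + r) x))"
      using deg[OF bracket.hyps(1)] deg[OF bracket.hyps(2)] bracket.prems
      by (intro coeff_magnus_commutator) auto
    then show ?case
      using bracket by (simp add: min_def)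
  qed
qed

text \<open>Well-founded induction on the family in the multiset order, eliminating the least word x
  each time; the empty family is settled by \<open>lie_empty\<close>.\<close>

lemma magnus_witt_family:
  assumes "leading_family S q T" "1 \<le> q"
    and "filtration.lie (free_group S) (lower_central (free_group S)) (weighted T) q g"
    and "\<And>u. length u = q \<Longrightarrow> coeff (magnus g) u = 0"
  shows "g \<in> lower_central (free_group S) (Suc q)"
proof -
  interpret filtration "free_group S" "lower_central (free_group S)"
    by (rule F.lower_central_filtration)
  define f where "f = (\<lambda>(u::'a list, c::('a \<times> bool) list). Suc q - length u)"
  have "wf (inv_image (mult1 less_than) (\<lambda>T. image_mset f (mset_set T)))"
    by (intro wf_inv_image wf_mult1) simp
  then show ?thesis
    using assms(1,3,4)
  proof (induction T arbitrary: g rule: wf_induct_rule)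
    case (less T)
    show ?case
    proof (cases "T = {}")
      case True
      then show ?thesis
        using less.prems(2) lie_empty by (simp add: weighted_def)
    next
      case False
      have fin: "finite (fst ` T)"
        using less.prems(1) by (auto simp: leading_family_def)
      define x where "x = Min (fst ` T)"
      have "x \<in> fst ` T" and min: "\<And>u c. (u, c) \<in> T \<Longrightarrow> x \<le> u"
        using fin False unfolding x_def by (auto intro!: Min_in Min_le image_eqI[of _ fst])
      then obtain cx where cx: "(x, cx) \<in> T"
        by auto
      let ?T' = "word_eliminate x cx (T - {(x, cx)}) q S"
      note elim = leading_family_eliminate[OF less.prems(1) cx min]
      have x: "1 \<le> length x" "cx \<in> lower_central (free_group S) (length x)" "lead x cx"
        using leading_familyD[OF less.prems(1) cx] by (auto simp: Suc_le_eq)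
      have "weighted T = insert (length x, cx) (weighted (T - {(x, cx)}))"
        using cx unfolding weighted_def by (force simp: image_iff)
      then have "lie (insert (length x, cx) (weighted (T - {(x, cx)}))) q g"
        using less.prems(2) by simp
      from lie_eliminate[OF x(1,2) this order_refl] obtain e h
        where g: "g = cx [^]\<^bsub>free_group S\<^esub> (e::int) \<otimes>\<^bsub>free_group S\<^esub> h"
          "lie (weighted ?T') q h" "q = length x \<or> e = 0"
        unfolding weighted_eliminate by blast
      have h: "h \<in> carrier (free_group S)" "deg_ge q (magnus h - 1)"
        using lie_mem[OF g(2)] magnus_lower_central F.lower_central_carrier by auto
      \<comment> \<open>If e were nonzero, x would have length q and the coefficient of g at x would
        be e: the power of x contributes e, the factor h contributes 0.\<close>
      have "e = 0"
      proof (rule ccontr)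
        assume "e \<noteq> 0"
        then have q: "q = length x"
          using g by simp
        have cx: "cx \<in> carrier (free_group S)" "deg_ge q (magnus cx - 1)"
          using x magnus_lower_central F.lower_central_carrier q by auto
        have "coeff (magnus h) x = 0"
          using coeff_lie_eliminate[OF less.prems(1) \<open>(x, cx) \<in> T\<close> min g(2)] q by simp
        moreover have "coeff (magnus g) x = coeff (magnus (cx [^]\<^bsub>free_group S\<^esub> e)) x + coeff (magnus h) x"
          unfolding g(1) using h cx q assms(2) coeff_magnus_pow[OF cx, of x e]
          by (intro coeff_magnus_mult[where q = q]) auto
        moreover have "coeff (magnus (cx [^]\<^bsub>free_group S\<^esub> e)) x = e * coeff (magnus cx) x"
          using coeff_magnus_pow[OF cx q[symmetric] assms(2)] by blast
        ultimately have "coeff (magnus g) x = e"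
          using x(3) by (simp add: lead_def)
        then show False
          using less.prems(3)[of x] q \<open>e \<noteq> 0\<close> by simp
      qed
      then have "g = h"
        using g(1) h(1) by simp
      moreover have "(?T', T) \<in> inv_image (mult1 less_than) (\<lambda>T. image_mset f (mset_set T))"
        using elim(2) by (simp add: f_def inv_image_def)
      ultimately show ?thesis
        using less.IH[of ?T' h] elim(1) g(2) less.prems(3) by simp
    qed
  qed
qed

text \<open>The converse of \<open>magnus_lower_central\<close>, one degree at a time: elimination
  starts from the generators, whose classes generate the whole graded Lie ring.\<close>

theorem magnus_witt:
  fixes S :: "'a::linorder set"
  assumes S: "finite S" and q: "1 \<le> q" and g: "g \<in> lower_central (free_group S) q"
    and zero: "\<And>u. length u = q \<Longrightarrow> coeff (magnus g) u = 0"
  shows "g \<in> lower_central (free_group S) (Suc q)"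
proof -
  interpret filtration "free_group S" "lower_central (free_group S)"
    by (rule F.lower_central_filtration)
  \<comment> \<open>Single letters form a prefix code, and 1 + x_k has leading word [k] in degree
    1.\<close>
  define T where "T = (\<lambda>k. ([k], gen k)) ` S"
  have fam: "leading_family S q T"
    using S q gen_in_free_group[of _ S]
    by (auto simp: leading_family_def T_def lead_def magnus_gen)
  have "gen k \<in> {w. lie (weighted T) 1 w}" if "k \<in> S" for k
    using that gen_in_free_group[OF that] lie.gen[of 1 "gen k" "weighted T"]
    by (force simp: weighted_def T_def)
  then have one: "lie (weighted T) 1 w" if "w \<in> carrier (free_group S)" for w
    using free_group_generated[OF lie_subgroup[OF order_refl] _ that] by blast
  have "w \<in> lower_central (free_group S) q \<Longrightarrow> lie (weighted T) q w" for w
    using q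
  proof (induction q arbitrary: w rule: nat_induct_at_least)
    case base
    then show ?case using one by simp
  next
    case (Suc q)
    have "lower_central (free_group S) (Suc q) \<subseteq> {a. lie (weighted T) (Suc q) a}"
    proof (rule F.lower_central_Suc_le[OF Suc.hyps lie_subgroup])
      show "commutator (free_group S) a b \<in> {a. lie (weighted T) (Suc q) a}"
        if "a \<in> lower_central (free_group S) q" "b \<in> carrier (free_group S)" for a b
        using lie.bracket[OF Suc.IH[OF that(1)] one[OF that(2)]] by simp
    qed simp
    then show ?case
      using Suc.prems by blast
  qed
  then show ?thesis
    using magnus_witt_family[OF fam q _ zero] g by simp
qed

section \<open>Automorphisms acting trivially modulo the lower central series\<close>

text \<open>The element form of the kernel defining \<open>IA\<close>, for an arbitrary group;
  \<open>kernel_induced_auto\<close> identifies the two. Degree q of the Johnson filtration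
  corresponds to c = q + 1.\<close>

definition ia :: "('a, 'b) monoid_scheme \<Rightarrow> nat \<Rightarrow> ('a \<Rightarrow> 'a) set" where
  "ia G c = {\<phi> \<in> carrier (AutoGroup G). \<forall>w\<in>carrier G. inv\<^bsub>G\<^esub> w \<otimes>\<^bsub>G\<^esub> \<phi> w \<in> lower_central G c}"

lemma autD:
  assumes "\<phi> \<in> carrier (AutoGroup G)"
  shows "\<phi> \<in> hom G G" "bij_betw \<phi> (carrier G) (carrier G)" "\<phi> \<in> extensional (carrier G)"
  using assms by (auto simp: AutoGroup_def auto_def Bij_def)

lemma autI:
  "\<phi> \<in> hom G G \<Longrightarrow> bij_betw \<phi> (carrier G) (carrier G) \<Longrightarrow> \<phi> \<in> extensional (carrier G) \<Longrightarrow>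
    \<phi> \<in> carrier (AutoGroup G)"
  by (auto simp: AutoGroup_def auto_def Bij_def)

lemma aut_mult_apply:
  "\<phi> \<in> carrier (AutoGroup G) \<Longrightarrow> \<psi> \<in> carrier (AutoGroup G) \<Longrightarrow> w \<in> carrier G \<Longrightarrow>
    (\<phi> \<otimes>\<^bsub>AutoGroup G\<^esub> \<psi>) w = \<phi> (\<psi> w)"
  by (auto simp: AutoGroup_def auto_def BijGroup_def compose_def)

lemma aut_one_apply: "w \<in> carrier G \<Longrightarrow> \<one>\<^bsub>AutoGroup G\<^esub> w = w"
  by (simp add: AutoGroup_def BijGroup_def)

lemma aut_eqI:
  assumes "\<phi> \<in> carrier (AutoGroup G)" "\<psi> \<in> carrier (AutoGroup G)"
    "\<And>w. w \<in> carrier G \<Longrightarrow> \<phi> w = \<psi> w"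
  shows "\<phi> = \<psi>"
  using autD(3)[OF assms(1)] autD(3)[OF assms(2)] assms(3) by (rule extensionalityI)

context group
begin

interpretation A: group "AutoGroup G"
  by (rule AutoGroup)

lemma aut_closed: "\<phi> \<in> carrier (AutoGroup G) \<Longrightarrow> w \<in> carrier G \<Longrightarrow> \<phi> w \<in> carrier G"
  using autD(1)[of \<phi> G] by (auto simp: hom_def)

lemma aut_mult: "\<phi> \<in> carrier (AutoGroup G) \<Longrightarrow> v \<in> carrier G \<Longrightarrow> w \<in> carrier G \<Longrightarrow>
    \<phi> (v \<otimes> w) = \<phi> v \<otimes> \<phi> w"
  using autD(1)[of \<phi> G] by (auto simp: hom_def)

lemma aut_group_hom: "\<phi> \<in> carrier (AutoGroup G) \<Longrightarrow> group_hom G G \<phi>"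
  by (simp add: group_hom_def group_hom_axioms_def group_axioms autD(1))

lemma aut_inv: "\<phi> \<in> carrier (AutoGroup G) \<Longrightarrow> v \<in> carrier G \<Longrightarrow> \<phi> (inv v) = inv \<phi> v"
  using aut_group_hom group_hom.hom_inv by metis

lemma aut_inv_apply:
  assumes "\<phi> \<in> carrier (AutoGroup G)" "w \<in> carrier G"
  shows "(inv\<^bsub>AutoGroup G\<^esub> \<phi>) (\<phi> w) = w" "\<phi> ((inv\<^bsub>AutoGroup G\<^esub> \<phi>) w) = w"
  using assms aut_mult_apply[of "inv\<^bsub>AutoGroup G\<^esub> \<phi>" G \<phi> w] aut_mult_apply[of \<phi> G "inv\<^bsub>AutoGroup G\<^esub> \<phi>" w]
  by (simp_all add: aut_one_apply)

lemma aut_lower_central: "\<phi> \<in> carrier (AutoGroup G) \<Longrightarrow> w \<in> lower_central G q \<Longrightarrow> \<phi> w \<in> lower_central G q"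
  by (rule lower_central_hom[OF group_axioms group_axioms autD(1)])

lemma iaD: "\<phi> \<in> ia G c \<Longrightarrow> \<phi> \<in> carrier (AutoGroup G)"
  "\<phi> \<in> ia G c \<Longrightarrow> w \<in> carrier G \<Longrightarrow> inv w \<otimes> \<phi> w \<in> lower_central G c"
  by (auto simp: ia_def)

lemmas lc_closed = subgroup.m_closed[OF lower_central_subgroup]
  subgroup.m_inv_closed[OF lower_central_subgroup] subgroup.one_closed[OF lower_central_subgroup]

lemmas lc_conj = normal.inv_op_closed1[OF lower_central_normal]
  normal.inv_op_closed2[OF lower_central_normal]

lemma rcos_eq_iff:
  assumes "subgroup N G" "x \<in> carrier G" "y \<in> carrier G"
  shows "N #> x = N #> y \<longleftrightarrow> x \<otimes> inv y \<in> N"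
  using assms subgroup.rcos_module[OF assms(1) group_axioms assms(3,2)] repr_independence[of x N y]
    rcos_self[of x N] by auto

lemma ia_Suc_subset: "ia G (Suc c) \<subseteq> ia G c"
  using lower_central_Suc_subset by (auto simp: ia_def)

lemma ia_normal: "ia G c \<lhd> AutoGroup G"
proof -
  have "subgroup (ia G c) (AutoGroup G)"
  proof (rule A.subgroupI)
    show "ia G c \<noteq> {}"
      using lc_closed(3) by (auto simp: ia_def aut_one_apply intro!: exI[of _ "\<one>\<^bsub>AutoGroup G\<^esub>"])
    show "inv\<^bsub>AutoGroup G\<^esub> \<phi> \<in> ia G c" if \<phi>: "\<phi> \<in> ia G c" for \<phi>
    proof -
      have c: "\<phi> \<in> carrier (AutoGroup G)"
        using \<phi> by (rule iaD)
      have "inv w \<otimes> (inv\<^bsub>AutoGroup G\<^esub> \<phi>) w \<in> lower_central G c" if w: "w \<in> carrier G" for w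
      proof -
        define v where "v = (inv\<^bsub>AutoGroup G\<^esub> \<phi>) w"
        have v: "v \<in> carrier G" "w = \<phi> v"
          using aut_closed[OF A.inv_closed[OF c] w] aut_inv_apply(2)[OF c w] by (simp_all add: v_def)
        have "inv (inv v \<otimes> \<phi> v) \<in> lower_central G c"
          using iaD(2)[OF \<phi> v(1)] by (rule lc_closed)
        then show ?thesis
          using v c unfolding v_def[symmetric] by (simp add: inv_mult_group aut_closed)
      qed
      then show ?thesis
        using c by (auto simp: ia_def)
    qed
    show "\<phi> \<otimes>\<^bsub>AutoGroup G\<^esub> \<psi> \<in> ia G c" if \<phi>: "\<phi> \<in> ia G c" and \<psi>: "\<psi> \<in> ia G c" for \<phi> \<psi>
    proof -
      have c: "\<phi> \<in> carrier (AutoGroup G)" "\<psi> \<in> carrier (AutoGroup G)"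
        using \<phi> \<psi> by (auto dest: iaD)
      have "inv w \<otimes> \<phi> (\<psi> w) \<in> lower_central G c" if w: "w \<in> carrier G" for w
      proof -
        have "inv w \<otimes> \<phi> (\<psi> w) = (inv w \<otimes> \<psi> w) \<otimes> (inv (\<psi> w) \<otimes> \<phi> (\<psi> w))"
          using w c by (simp add: m_assoc aut_closed)
        then show ?thesis
          using lc_closed(1)[OF iaD(2)[OF \<psi> w] iaD(2)[OF \<phi>, of "\<psi> w"]] w c by (simp add: aut_closed)
      qed
      then show ?thesis
        using c by (auto simp: ia_def aut_mult_apply)
    qed
  qed (auto dest: iaD)
  moreover have "\<theta> \<otimes>\<^bsub>AutoGroup G\<^esub> \<phi> \<otimes>\<^bsub>AutoGroup G\<^esub> inv\<^bsub>AutoGroup G\<^esub> \<theta> \<in> ia G c"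
    if \<theta>: "\<theta> \<in> carrier (AutoGroup G)" and \<phi>: "\<phi> \<in> ia G c" for \<theta> \<phi>
  proof -
    have c: "\<phi> \<in> carrier (AutoGroup G)"
      using \<phi> by (rule iaD)
    have "inv w \<otimes> (\<theta> \<otimes>\<^bsub>AutoGroup G\<^esub> \<phi> \<otimes>\<^bsub>AutoGroup G\<^esub> inv\<^bsub>AutoGroup G\<^esub> \<theta>) w \<in> lower_central G c"
      if w: "w \<in> carrier G" for w
    proof -
      define v where "v = (inv\<^bsub>AutoGroup G\<^esub> \<theta>) w"
      have v: "v \<in> carrier G" "w = \<theta> v"
        using aut_closed[OF A.inv_closed[OF \<theta>] w] aut_inv_apply(2)[OF \<theta> w] by (simp_all add: v_def)
      have "(\<theta> \<otimes>\<^bsub>AutoGroup G\<^esub> \<phi> \<otimes>\<^bsub>AutoGroup G\<^esub> inv\<^bsub>AutoGroup G\<^esub> \<theta>) w = \<theta> (\<phi> v)"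
        using c \<theta> v by (simp add: aut_mult_apply aut_closed aut_inv_apply)
      then have "inv w \<otimes> (\<theta> \<otimes>\<^bsub>AutoGroup G\<^esub> \<phi> \<otimes>\<^bsub>AutoGroup G\<^esub> inv\<^bsub>AutoGroup G\<^esub> \<theta>) w = \<theta> (inv v \<otimes> \<phi> v)"
        using c \<theta> v by (simp add: aut_mult aut_inv aut_closed)
      then show ?thesis
        using aut_lower_central[OF \<theta> iaD(2)[OF \<phi> v(1)]] by simp
    qed
    then show ?thesis
      using \<theta> c by (auto simp: ia_def)
  qed
  ultimately show ?thesis
    by (simp add: A.normal_inv_iff)
qed

text \<open>An automorphism of degree p raises the degree of every element by p. By induction on k
  the displacement of [a,b] is expressed through those of a and b.\<close>

lemma ia_lower_central:
  assumes \<phi>: "\<phi> \<in> ia G (Suc p)" and k: "1 \<le> k"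
  shows "w \<in> lower_central G k \<Longrightarrow> inv w \<otimes> \<phi> w \<in> lower_central G (k + p)"
  using k
proof (induction k arbitrary: w rule: nat_induct_at_least)
  case base
  then show ?case
    using iaD(2)[OF \<phi>] by simp
next
  case (Suc k)
  have c: "\<phi> \<in> carrier (AutoGroup G)"
    using \<phi> by (rule iaD)
  let ?M = "lower_central G (Suc k + p)"
  let ?H = "{w \<in> carrier G. inv w \<otimes> \<phi> w \<in> ?M}"
  have mono: "lower_central G j \<subseteq> ?M" if "Suc k + p \<le> j" for j
    using filtration.antimono[OF lower_central_filtration, of "Suc k + p" j] that by simp
  have "lower_central G (Suc k) \<subseteq> ?H"
  proof (rule lower_central_Suc_le[OF Suc.hyps])
    show "subgroup ?H G"
    proof (rule subgroupI)
      show "?H \<noteq> {}"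
        using lc_closed(3) aut_group_hom[OF c] by (auto intro!: exI[of _ \<one>] simp: group_hom.hom_one)
      show "inv v \<in> ?H" if v: "v \<in> ?H" for v
      proof -
        have "inv (inv v) \<otimes> \<phi> (inv v) = v \<otimes> inv (inv v \<otimes> \<phi> v) \<otimes> inv v"
          using v c by (simp add: aut_inv inv_mult_group m_assoc aut_closed)
        then show ?thesis
          using v lc_conj(2)[OF _ lc_closed(2), of v "inv v \<otimes> \<phi> v"] by auto
      qed
      show "v \<otimes> u \<in> ?H" if v: "v \<in> ?H" and u: "u \<in> ?H" for v u
      proof -
        have "inv (v \<otimes> u) \<otimes> \<phi> (v \<otimes> u) = (inv u \<otimes> (inv v \<otimes> \<phi> v) \<otimes> u) \<otimes> (inv u \<otimes> \<phi> u)"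
          using v u c by (simp add: aut_mult inv_mult_group m_assoc aut_closed)
        then show ?thesis
          using v u lc_conj(1)[of u "inv v \<otimes> \<phi> v"] by (auto intro: lc_closed)
      qed
    qed auto
    fix a b assume a: "a \<in> lower_central G k" and b: "b \<in> carrier G"
    define x where "x = inv a \<otimes> \<phi> a"
    define y where "y = inv b \<otimes> \<phi> b"
    have ac: "a \<in> carrier G"
      using a by (rule lower_central_carrier)
    have x: "x \<in> lower_central G (k + p)" and y: "y \<in> lower_central G (Suc p)"
      using Suc.IH[OF a] iaD(2)[OF \<phi> b] by (auto simp: x_def y_def)
    then have xy: "x \<in> carrier G" "y \<in> carrier G"
      by (auto dest: lower_central_carrier)
    have \<phi>ab: "\<phi> a = a \<otimes> x" "\<phi> b = b \<otimes> y"
      using ac b c by (simp_all add: x_def y_def aut_closed)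
    have m1: "commutator G a y \<in> ?M"
      using lower_central_commutator[of k "Suc p" a y] a y Suc.hyps by simp
    have ab: "commutator G a b \<in> lower_central G (Suc k)" "commutator G a (b \<otimes> y) \<in> lower_central G (Suc k)"
      using commutator_lower_central_Suc[OF a _ Suc.hyps] b xy by auto
    have m2: "commutator G (commutator G a b) y \<in> ?M"
      using lower_central_commutator[of "Suc k" "Suc p" _ y] ab y mono[of "Suc k + Suc p"] by auto
    have m3: "commutator G (commutator G a (b \<otimes> y)) x \<in> ?M"
      using lower_central_commutator[of "Suc k" "k + p" _ x] ab x mono[of "Suc k + (k + p)"] Suc.hyps by auto
    have m4: "commutator G x (b \<otimes> y) \<in> ?M"
      using commutator_lower_central_Suc[OF x, of "b \<otimes> y"] b xy Suc.hyps by simp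
    let ?c = "commutator G a b"
    have "\<phi> ?c = commutator G (a \<otimes> x) (b \<otimes> y)"
      using hom_commutator[OF group_axioms group_axioms autD(1)[OF c] ac b] \<phi>ab by simp
    also have "\<dots> = commutator G a (b \<otimes> y) \<otimes> commutator G (commutator G a (b \<otimes> y)) x \<otimes> commutator G x (b \<otimes> y)"
      using ac b xy by (intro commutator_mult_left) auto
    also have "commutator G a (b \<otimes> y) = commutator G a y \<otimes> ?c \<otimes> commutator G ?c y"
      using ac b xy by (intro commutator_mult_right) auto
    \<comment> \<open>Up to conjugation, every factor on the right is a commutator involving x or y,
      the displacements of a and b.\<close>
    finally have "inv ?c \<otimes> \<phi> ?c = (inv ?c \<otimes> commutator G a y \<otimes> ?c) \<otimes> commutator G ?c y \<otimes>
        commutator G (commutator G a y \<otimes> ?c \<otimes> commutator G ?c y) x \<otimes> commutator G x (b \<otimes> y)"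
      using ac b xy by (simp add: m_assoc del: inv_mult_group)
    moreover have "commutator G a y \<otimes> ?c \<otimes> commutator G ?c y = commutator G a (b \<otimes> y)"
      using ac b xy by (intro commutator_mult_right[symmetric]) auto
    moreover have "inv ?c \<otimes> commutator G a y \<otimes> ?c \<in> ?M"
      using m1 ac b by (intro lc_conj) auto
    ultimately show "?c \<in> ?H"
      using m2 m3 m4 ac b by (auto intro: lc_closed)
  qed
  then show ?case
    using Suc.prems by auto
qed

text \<open>It suffices to compare the two composites on w. They differ by [a,b] and by the
  displacements of a under \<open>\<psi>\<close> and of b under \<open>\<phi>\<close>, all of degree
  at least p + q + 1.\<close>

lemma ia_commutator:
  assumes \<phi>: "\<phi> \<in> ia G (Suc p)" and \<psi>: "\<psi> \<in> ia G (Suc q)"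
  shows "commutator (AutoGroup G) \<phi> \<psi> \<in> ia G (Suc (p + q))"
proof -
  have c: "\<phi> \<in> carrier (AutoGroup G)" "\<psi> \<in> carrier (AutoGroup G)"
    using \<phi> \<psi> by (auto dest: iaD)
  let ?\<theta> = "\<psi> \<otimes>\<^bsub>AutoGroup G\<^esub> \<phi>" and ?M = "lower_central G (Suc (p + q))"
  have eq: "commutator (AutoGroup G) \<phi> \<psi> =
      inv\<^bsub>AutoGroup G\<^esub> ?\<theta> \<otimes>\<^bsub>AutoGroup G\<^esub> (\<phi> \<otimes>\<^bsub>AutoGroup G\<^esub> \<psi>)"
    using c by (simp add: A.word_simps)
  have "inv w \<otimes> (commutator (AutoGroup G) \<phi> \<psi>) w \<in> ?M" if w: "w \<in> carrier G" for w
  proof -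
    define a where "a = inv w \<otimes> \<phi> w"
    define b where "b = inv w \<otimes> \<psi> w"
    define a' where "a' = inv a \<otimes> \<psi> a"
    define b' where "b' = inv b \<otimes> \<phi> b"
    have ab: "a \<in> lower_central G (Suc p)" "b \<in> lower_central G (Suc q)"
      using iaD(2)[OF \<phi> w] iaD(2)[OF \<psi> w] by (auto simp: a_def b_def)
    have ab': "a' \<in> ?M" "b' \<in> ?M"
      using ia_lower_central[OF \<psi> _ ab(1)] ia_lower_central[OF \<phi> _ ab(2)]
      by (auto simp: a'_def b'_def add.commute)
    have [simp]: "a \<in> carrier G" "b \<in> carrier G" "a' \<in> carrier G" "b' \<in> carrier G"
      using ab ab' by (auto dest: lower_central_carrier)
    have e: "\<phi> w = w \<otimes> a" "\<psi> w = w \<otimes> b" "\<psi> a = a \<otimes> a'" "\<phi> b = b \<otimes> b'"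
      using w c by (simp_all add: a_def b_def a'_def b'_def aut_closed)
    \<comment> \<open>The composites send w to w a b b' and w b a a'; z is the quotient of the first
      by the second.\<close>
    define z where "z = inv a' \<otimes> commutator G a b \<otimes> b'"
    have "commutator G a b \<in> lower_central G (Suc p + Suc q)"
      using ab by (intro lower_central_commutator) auto
    then have "commutator G a b \<in> ?M"
      using filtration.antimono[OF lower_central_filtration, of "Suc (p + q)" "Suc p + Suc q"] by auto
    then have z: "z \<in> ?M"
      unfolding z_def using ab' by (intro lc_closed)
    then have zc: "z \<in> carrier G"
      by (rule lower_central_carrier)
    have "\<phi> (\<psi> w) = ?\<theta> w \<otimes> z"
      using w c by (simp add: e aut_mult aut_mult_apply z_def m_assoc commutator_def inv_mult_group)
    then have "(commutator (AutoGroup G) \<phi> \<psi>) w = (inv\<^bsub>AutoGroup G\<^esub> ?\<theta>) (?\<theta> w \<otimes> z)"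
      using w c unfolding eq by (simp add: aut_mult_apply[of "inv\<^bsub>AutoGroup G\<^esub> ?\<theta>"] aut_mult_apply[of \<phi>])
    also have "\<dots> = w \<otimes> (inv\<^bsub>AutoGroup G\<^esub> ?\<theta>) z"
      using w c zc aut_mult[of "inv\<^bsub>AutoGroup G\<^esub> ?\<theta>" "?\<theta> w" z] by (simp add: aut_closed aut_inv_apply)
    finally show ?thesis
      using w c zc z aut_lower_central[of "inv\<^bsub>AutoGroup G\<^esub> ?\<theta>" z "Suc (p + q)"]
      by (simp add: aut_closed)
  qed
  then show ?thesis
    using c by (auto simp: ia_def)
qed

lemma ia_filtration: "filtration (AutoGroup G) (\<lambda>q. ia G (Suc q))"
  by (intro filtration.intro filtration_axioms.intro AutoGroup ia_normal ia_Suc_subset)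
    (simp add: ia_commutator)

text \<open>An automorphism maps a term of the lower central series onto itself, because its inverse
  preserves the term too. Hence it sends cosets to cosets, and being trivial on cosets can be tested
  on representatives.\<close>

lemma kernel_induced_auto:
  "kernel (AutoGroup G) (AutoGroup (G Mod lower_central G c)) (induced_auto G (lower_central G c)) =
    ia G c"
proof -
  let ?N = "lower_central G c"
  interpret N: normal ?N G
    by (rule lower_central_normal)
  have img: "\<phi> ` (?N #> w) = ?N #> \<phi> w" if \<phi>: "\<phi> \<in> carrier (AutoGroup G)" and w: "w \<in> carrier G" for \<phi> w
  proof -
    have "\<phi> ` ?N = ?N"
    proof (intro equalityI subsetI)
      fix x assume "x \<in> ?N"
      then show "x \<in> \<phi> ` ?N"
        using aut_lower_central[of "inv\<^bsub>AutoGroup G\<^esub> \<phi>" x c] aut_inv_apply(2)[OF \<phi>, of x]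
          N.mem_carrier \<phi> by (auto intro!: image_eqI[of _ \<phi> "(inv\<^bsub>AutoGroup G\<^esub> \<phi>) x"])
    qed (use aut_lower_central[OF \<phi>] in auto)
    then have "?N #> \<phi> w = (\<lambda>x. x \<otimes> \<phi> w) ` (\<phi> ` ?N)"
      by (auto simp: r_coset_def)
    also have "\<dots> = \<phi> ` ((\<lambda>x. x \<otimes> w) ` ?N)"
      using aut_mult[OF \<phi> N.mem_carrier w] by (auto simp: image_image intro!: image_cong)
    also have "(\<lambda>x. x \<otimes> w) ` ?N = ?N #> w"
      by (auto simp: r_coset_def)
    finally show ?thesis ..
  qed
  have "induced_auto G ?N \<phi> = \<one>\<^bsub>AutoGroup (G Mod ?N)\<^esub> \<longleftrightarrow>
      (\<forall>w\<in>carrier G. inv w \<otimes> \<phi> w \<in> ?N)" if \<phi>: "\<phi> \<in> carrier (AutoGroup G)" for \<phi>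
  proof -
    have "induced_auto G ?N \<phi> = \<one>\<^bsub>AutoGroup (G Mod ?N)\<^esub> \<longleftrightarrow>
        (\<forall>A\<in>carrier (G Mod ?N). \<phi> ` A = A)"
      by (auto simp: induced_auto_def AutoGroup_def BijGroup_def fun_eq_iff restrict_def)
    also have "\<dots> \<longleftrightarrow> (\<forall>w\<in>carrier G. ?N #> \<phi> w = ?N #> w)"
      using img[OF \<phi>] by (auto simp: carrier_FactGroup)
    also have "\<dots> \<longleftrightarrow> (\<forall>w\<in>carrier G. inv w \<otimes> \<phi> w \<in> ?N)"
    proof (intro ball_cong refl)
      fix w assume w: "w \<in> carrier G"
      have \<phi>w: "\<phi> w \<in> carrier G"
        using \<phi> w by (rule aut_closed)
      have "?N #> \<phi> w = ?N #> w \<longleftrightarrow> \<phi> w \<otimes> inv w \<in> ?N"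
        using w \<phi>w by (intro rcos_eq_iff N.subgroup_axioms)
      \<comment> \<open>Library cosets give the displacement on the right of w; normality moves it
        to the left.\<close>
      also have "\<dots> \<longleftrightarrow> inv w \<otimes> \<phi> w \<in> ?N"
        using lc_conj(1)[of w "\<phi> w \<otimes> inv w" c] lc_conj(2)[of w "inv w \<otimes> \<phi> w" c] w \<phi>w
        by (auto simp: m_assoc)
      finally show "?N #> \<phi> w = ?N #> w \<longleftrightarrow> inv w \<otimes> \<phi> w \<in> ?N" .
    qed
    finally show ?thesis .
  qed
  then show ?thesis
    by (auto simp: kernel_def ia_def)
qed

end

lemma IA_eq_ia: "IA n c = ia (Fn n) c"
  unfolding IA_def by (rule group.kernel_induced_auto[OF group_free_group])

section \<open>Graded Lie rings of nested filtrations\<close>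

lemma hom_finprod:
  assumes "comm_group P" "comm_group Q" "h \<in> hom P Q" "f \<in> A \<rightarrow> carrier P"
  shows "h (finprod P f A) = finprod Q (\<lambda>x. h (f x)) A"
proof -
  interpret P: comm_group P by fact
  interpret Q: comm_group Q by fact
  interpret h: group_hom P Q h
    using assms by (simp add: group_hom_def group_hom_axioms_def P.is_group Q.is_group)
  show ?thesis
    using assms(4)
  proof (induction A rule: infinite_finite_induct)
    case (insert x A)
    then have "f \<in> A \<rightarrow> carrier P" "f x \<in> carrier P" "(\<lambda>x. h (f x)) \<in> A \<rightarrow> carrier Q"
      by (auto intro: h.hom_closed)
    then show ?case
      using insert by (simp add: P.finprod_insert Q.finprod_insert)
  qed simp_all
qed

lemma carrier_update_simps [simp]:
  "r_coset (G\<lparr>carrier := H\<rparr>) = r_coset G" "set_mult (G\<lparr>carrier := H\<rparr>) = set_mult G"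
  by (auto simp: r_coset_def set_mult_def fun_eq_iff)

context filtration
begin

lemma graded_piece_simps [simp]:
  "carrier (graded_piece G N q) = (\<lambda>a. N (Suc q) #> a) ` N q"
  "monoid.mult (graded_piece G N q) = set_mult G"
  "one (graded_piece G N q) = N (Suc q)"
  by (simp_all add: graded_piece_def carrier_FactGroup)

lemma rcos_mult:
  assumes "1 \<le> q" "a \<in> N q" "b \<in> N q"
  shows "(N (Suc q) #> a) <#> (N (Suc q) #> b) = N (Suc q) #> (a \<otimes> b)"
  using assms normal.rcos_sum[OF normal[of "Suc q"]] mem_carrier by auto

lemma rcos_eq:
  "1 \<le> q \<Longrightarrow> x \<in> carrier G \<Longrightarrow> y \<in> carrier G \<Longrightarrow> N q #> x = N q #> y \<longleftrightarrow> x \<otimes> inv y \<in> N q"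
  by (intro rcos_eq_iff sub)

lemma rcos_one: "1 \<le> q \<Longrightarrow> N q #> \<one> = N q"
  using coset_mult_one sub subgroup.subset by blast

lemma comm_group_graded_piece:
  assumes q: "1 \<le> q"
  shows "comm_group (graded_piece G N q)"
proof (rule comm_groupI)
  fix A assume A: "A \<in> carrier (graded_piece G N q)"
  then obtain a where a: "a \<in> N q" "A = N (Suc q) #> a"
    by auto
  have "(N (Suc q) #> inv a) <#> (N (Suc q) #> a) = N (Suc q) #> (inv a \<otimes> a)"
    using q a inv_mem by (intro rcos_mult) auto
  also have "\<dots> = N (Suc q)"
    using mem_carrier[OF q a(1)] by (simp add: rcos_one)
  finally show "\<exists>B\<in>carrier (graded_piece G N q). B \<otimes>\<^bsub>graded_piece G N q\<^esub> A = \<one>\<^bsub>graded_piece G N q\<^esub>"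
    using a inv_mem[OF q a(1)] by auto
  have "(N (Suc q) #> \<one>) <#> A = A"
    using rcos_mult[OF q one_mem[OF q] a(1)] mem_carrier[OF q a(1)] a(2) by simp
  then show "\<one>\<^bsub>graded_piece G N q\<^esub> \<otimes>\<^bsub>graded_piece G N q\<^esub> A = A"
    by (simp add: rcos_one)
next
  fix A B assume "A \<in> carrier (graded_piece G N q)" "B \<in> carrier (graded_piece G N q)"
  then obtain a b where ab: "a \<in> N q" "A = N (Suc q) #> a" "b \<in> N q" "B = N (Suc q) #> b"
    by auto
  note c = mem_carrier[OF q ab(1)] mem_carrier[OF q ab(3)]
  show "A \<otimes>\<^bsub>graded_piece G N q\<^esub> B \<in> carrier (graded_piece G N q)"
    using ab rcos_mult[OF q] mult_mem[OF q] by auto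
  have "(a \<otimes> b) \<otimes> inv (b \<otimes> a) = commutator G (inv a) (inv b)"
    using c by (simp add: word_simps)
  also have "\<dots> \<in> N (Suc q)"
    using q ab inv_mem by (intro commutator_mem'[of q q]) auto
  finally have "N (Suc q) #> (a \<otimes> b) = N (Suc q) #> (b \<otimes> a)"
    using c by (simp add: rcos_eq)
  then show "A \<otimes>\<^bsub>graded_piece G N q\<^esub> B = B \<otimes>\<^bsub>graded_piece G N q\<^esub> A"
    using ab rcos_mult[OF q] by simp
  fix C assume "C \<in> carrier (graded_piece G N q)"
  then obtain c' where "c' \<in> N q" "C = N (Suc q) #> c'"
    by auto
  then show "A \<otimes>\<^bsub>graded_piece G N q\<^esub> B \<otimes>\<^bsub>graded_piece G N q\<^esub> C =
      A \<otimes>\<^bsub>graded_piece G N q\<^esub> (B \<otimes>\<^bsub>graded_piece G N q\<^esub> C)"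
    using ab c rcos_mult[OF q] mult_mem[OF q] mem_carrier[OF q] by (simp add: m_assoc)
next
  show "\<one>\<^bsub>graded_piece G N q\<^esub> \<in> carrier (graded_piece G N q)"
    using rcos_one one_mem[OF q] by (auto intro!: image_eqI[of _ _ \<one>])
qed

text \<open>Changing a by \<open>N (Suc p)\<close> or b by \<open>N (Suc q)\<close> changes [a,b]
  only by elements of \<open>N (Suc (p + q))\<close>, so all cosets in the union coincide.\<close>

lemma piece_bracket_rcos:
  assumes p: "1 \<le> p" and q: "1 \<le> q" and a: "a \<in> N p" and b: "b \<in> N q"
  shows "piece_bracket G N p q (N (Suc p) #> a) (N (Suc q) #> b) = N (Suc (p + q)) #> commutator G a b"
proof -
  let ?M = "N (Suc (p + q))"
  note sM = sub[of "Suc (p + q)", simplified]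
  have ac: "a \<in> carrier G" and bc: "b \<in> carrier G"
    using mem_carrier p q a b by auto
  have "?M #> commutator G a' b' = ?M #> commutator G a b"
    if a': "a' \<in> N (Suc p) #> a" and b': "b' \<in> N (Suc q) #> b" for a' b'
  proof -
    obtain x where x: "a' = x \<otimes> a" "x \<in> N (Suc p)"
      using a' by (auto simp: r_coset_def)
    obtain y where y: "b' = y \<otimes> b" "y \<in> N (Suc q)"
      using b' by (auto simp: r_coset_def)
    have xyc: "x \<in> carrier G" "y \<in> carrier G"
      using x y mem_carrier[of "Suc p"] mem_carrier[of "Suc q"] by auto
    have "b' \<in> N q"
      using y b q Suc_subset[of q] by (auto intro: mult_mem)
    then have bc': "b' \<in> carrier G" and xb: "commutator G x b' \<in> ?M"
      using commutator_mem[of "Suc p" q x b'] x q mem_carrier by auto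
    have "commutator G (commutator G x b') a \<in> ?M"
      using commutator_mem'[of "Suc (p + q)" p _ a "Suc (p + q)"] xb a p by auto
    then have "commutator G x b' \<otimes> commutator G (commutator G x b') a \<in> ?M"
      using xb by (intro subgroup.m_closed[OF sM])
    then have 1: "?M #> commutator G a' b' = ?M #> commutator G a b'"
      using ac xyc bc' by (simp add: x rcos_eq commutator_mult_left m_assoc)
    have ay: "commutator G a y \<in> ?M"
      using commutator_mem[of p "Suc q" a y] a y p by simp
    have "commutator G (commutator G a y) b \<in> ?M"
      using commutator_mem'[of "Suc (p + q)" q _ b "Suc (p + q)"] ay b q by auto
    then have "commutator G a y \<otimes> commutator G (commutator G a y) b \<in> ?M"
      using ay by (intro subgroup.m_closed[OF sM])
    then have "commutator G a b \<otimes> (commutator G a y \<otimes> commutator G (commutator G a y) b) \<otimes>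
        inv commutator G a b \<in> ?M"
      using ac bc normal.inv_op_closed2[OF normal[of "Suc (p + q)"]] by simp
    then have "?M #> commutator G a b' = ?M #> commutator G a b"
      using ac bc xyc by (simp add: y rcos_eq commutator_mult_right m_assoc)
    with 1 show ?thesis by simp
  qed
  moreover have "a \<in> N (Suc p) #> a"
    by (rule rcos_self[OF ac sub]) simp
  moreover have "b \<in> N (Suc q) #> b"
    by (rule rcos_self[OF bc sub]) simp
  ultimately show ?thesis
    unfolding piece_bracket_def by blast
qed

end

lemma (in group) commutator_restrict:
  "subgroup H G \<Longrightarrow> a \<in> H \<Longrightarrow> b \<in> H \<Longrightarrow> commutator (G\<lparr>carrier := H\<rparr>) a b = commutator G a b"
  using m_inv_consistent by (simp add: commutator_def)

text \<open>Each further commutator with an element of H, which has degree at least 1, raises the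
  degree by one.\<close>

lemma (in filtration) lower_central_restrict_subset:
  assumes H: "subgroup H G" "H \<subseteq> N 1"
  shows "1 \<le> q \<Longrightarrow> lower_central (G\<lparr>carrier := H\<rparr>) q \<subseteq> N q"
proof (induction q rule: nat_induct_at_least)
  case (Suc q)
  interpret H: group "G\<lparr>carrier := H\<rparr>"
    by (rule subgroup_imp_group[OF H(1)])
  have "lower_central (G\<lparr>carrier := H\<rparr>) (Suc q) \<subseteq> N (Suc q) \<inter> H"
  proof (rule H.lower_central_Suc_le[OF Suc.hyps])
    show "subgroup (N (Suc q) \<inter> H) (G\<lparr>carrier := H\<rparr>)"
      by (intro subgroup_incl subgroups_Inter_pair sub H) auto
    fix a b assume ab: "a \<in> lower_central (G\<lparr>carrier := H\<rparr>) q" "b \<in> carrier (G\<lparr>carrier := H\<rparr>)"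
    then have "a \<in> H" "b \<in> H"
      by (auto dest: H.lower_central_carrier)
    then show "commutator (G\<lparr>carrier := H\<rparr>) a b \<in> N (Suc q) \<inter> H"
      using commutator_mem[of q 1 a b] Suc ab H H.commutator_closed[of a b]
      by (auto simp: commutator_restrict)
  qed
  then show ?case by blast
qed (use H in simp)

text \<open>In degree q the coset \<open>N (Suc q)\<close> a goes to the coset
  \<open>M (Suc q)\<close> a, written as a product of sets to avoid choosing a. The hypothesis
  \<open>inter\<close> is injectivity in each degree; the carrier of the target describes the
  image.\<close>

lemma filtration_lie_embedding:
  fixes G (structure)
  assumes M: "filtration G M" and H: "subgroup H G" and N: "filtration (G\<lparr>carrier := H\<rparr>) N"
    and sub: "\<And>q. 1 \<le> q \<Longrightarrow> N q \<subseteq> M q"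
    and inter: "\<And>q. 1 \<le> q \<Longrightarrow> N q \<inter> M (Suc q) \<subseteq> N (Suc q)"
  shows "(\<lambda>f. \<lambda>q\<in>{1..}. M (Suc q) <#> f q) \<in> lie_iso (filtration_lie (G\<lparr>carrier := H\<rparr>) N)
    ((filtration_lie G M)\<lparr>carrier := {f \<in> carrier (filtration_lie G M).
      \<forall>q\<ge>1. f q \<in> (\<lambda>a. M (Suc q) #> a) ` N q}\<rparr>)"
proof -
  let ?G' = "G\<lparr>carrier := H\<rparr>"
  interpret M: filtration G M by fact
  interpret N: filtration ?G' N by fact
  define P where "P = graded_piece ?G' N"
  define Q where "Q = graded_piece G M"
  define \<iota> where "\<iota> = (\<lambda>q A. M (Suc q) <#> A)"
  define \<zeta> where "\<zeta> = (\<lambda>f. \<lambda>q\<in>{1::nat..}. \<iota> q (f q))"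
  have P: "comm_group (P q)" and Q: "comm_group (Q q)" if "1 \<le> q" for q
    unfolding P_def Q_def using that by (rule N.comm_group_graded_piece, rule M.comm_group_graded_piece)
  have Pc: "carrier (P q) = (\<lambda>a. N (Suc q) #> a) ` N q" "monoid.mult (P q) = set_mult G"
    "one (P q) = N (Suc q)" for q
    by (simp_all add: P_def)
  have Qc: "carrier (Q q) = (\<lambda>a. M (Suc q) #> a) ` M q" "monoid.mult (Q q) = set_mult G"
    "one (Q q) = M (Suc q)" for q
    by (simp_all add: Q_def)
  have inH: "a \<in> H" "a \<in> carrier G" if "a \<in> N q" "1 \<le> q" for a q
    using that N.mem_carrier[of q a] subgroup.mem_carrier[OF H] by auto
  have inv_eq: "inv\<^bsub>?G'\<^esub> a = inv a" if "a \<in> H" for a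
    using M.m_inv_consistent[OF H that] .
  have \<iota>_rcos: "\<iota> q (N (Suc q) #> a) = M (Suc q) #> a" if a: "a \<in> N q" and q: "1 \<le> q" for a q
  proof -
    have NM: "N (Suc q) \<subseteq> M (Suc q)"
      using sub by simp
    have "m \<otimes> (x \<otimes> a) \<in> M (Suc q) #> a" if "m \<in> M (Suc q)" "x \<in> N (Suc q)" for m x
    proof -
      have "m \<otimes> (x \<otimes> a) = (m \<otimes> x) \<otimes> a"
        using that NM inH(2)[OF a q] M.mem_carrier[of "Suc q"] by (subst M.m_assoc) auto
      then show ?thesis
        using that NM M.mult_mem[of "Suc q" m x] by (auto simp: r_coset_def)
    qed
    moreover have "m \<otimes> a \<in> M (Suc q) <#> (N (Suc q) #> a)" if "m \<in> M (Suc q)" for m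
    proof -
      have "\<one> \<otimes> a \<in> N (Suc q) #> a"
        using N.one_mem[of "Suc q"] by (auto simp: r_coset_def)
      then show ?thesis
        using that inH(2)[OF a q] by (auto simp: set_mult_def)
    qed
    ultimately show ?thesis
      by (fastforce simp: \<iota>_def set_mult_def r_coset_def)
  qed
  have img: "\<iota> q ` carrier (P q) = (\<lambda>a. M (Suc q) #> a) ` N q" if "1 \<le> q" for q
    using \<iota>_rcos[OF _ that] by (force simp: Pc image_image)
  have hom: "\<iota> q \<in> hom (P q) (Q q)" if q: "1 \<le> q" for q
  proof (rule homI)
    show "\<iota> q A \<in> carrier (Q q)" if "A \<in> carrier (P q)" for A
      using that img[OF q] sub[OF q] unfolding Qc by blast
    fix A B assume "A \<in> carrier (P q)" "B \<in> carrier (P q)"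
    then obtain a b where ab: "a \<in> N q" "A = N (Suc q) #> a" "b \<in> N q" "B = N (Suc q) #> b"
      by (auto simp: Pc)
    have "A <#> B = N (Suc q) #> (a \<otimes> b)"
      using N.rcos_mult[OF q ab(1,3)] ab by simp
    moreover have "(M (Suc q) #> a) <#> (M (Suc q) #> b) = M (Suc q) #> (a \<otimes> b)"
      using M.rcos_mult[OF q] ab sub[OF q] by blast
    moreover have "a \<otimes> b \<in> N q"
      using N.mult_mem[OF q ab(1,3)] by simp
    ultimately show "\<iota> q (A \<otimes>\<^bsub>P q\<^esub> B) = \<iota> q A \<otimes>\<^bsub>Q q\<^esub> \<iota> q B"
      using ab \<iota>_rcos[OF _ q] by (simp add: Pc Qc)
  qed
  have inj: "inj_on (\<iota> q) (carrier (P q))" if q: "1 \<le> q" for q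
  proof (rule inj_onI)
    fix A B assume AB: "A \<in> carrier (P q)" "B \<in> carrier (P q)" "\<iota> q A = \<iota> q B"
    then obtain a b where ab: "a \<in> N q" "A = N (Suc q) #> a" "b \<in> N q" "B = N (Suc q) #> b"
      by (auto simp: Pc)
    have c: "a \<otimes> inv b \<in> N q"
      using N.mult_mem[OF q ab(1) N.inv_mem[OF q ab(3)]] inv_eq inH(1)[OF ab(3) q] by simp
    have "M (Suc q) #> a = M (Suc q) #> b"
      using AB(3) ab \<iota>_rcos[OF _ q] by simp
    then have "a \<otimes> inv b \<in> M (Suc q)"
      using M.rcos_eq[of "Suc q"] inH(2)[OF _ q] ab by simp
    then have "a \<otimes> inv b \<in> N (Suc q)"
      using inter[OF q] c by blast
    then show "A = B"
      using N.rcos_eq[of "Suc q" a b] inH(1)[OF _ q] ab inv_eq by simp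
  qed
  have \<iota>_one: "\<iota> q A = \<one>\<^bsub>Q q\<^esub> \<longleftrightarrow> A = \<one>\<^bsub>P q\<^esub>" if q: "1 \<le> q" and A: "A \<in> carrier (P q)" for q A
  proof -
    interpret P: comm_group "P q" using P[OF q] .
    interpret Q: comm_group "Q q" using Q[OF q] .
    have "\<iota> q \<one>\<^bsub>P q\<^esub> = \<one>\<^bsub>Q q\<^esub>"
      using hom_one[OF hom[OF q] P.is_group Q.is_group] .
    then show ?thesis
      using inj_onD[OF inj[OF q] _ A, of "\<one>\<^bsub>P q\<^esub>"] by auto
  qed
  have carL: "carrier (filtration_lie ?G' N) =
      {f \<in> \<Pi>\<^sub>E i\<in>{1..}. carrier (P i). finite {i \<in> {1..}. f i \<noteq> \<one>\<^bsub>P i\<^esub>}}"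
    unfolding filtration_lie_def P_def
    using carrier_sum_group[of "{1..}" P] comm_group.axioms(2)[OF P] by (simp add: P_def)
  have carM: "carrier (filtration_lie G M) =
      {f \<in> \<Pi>\<^sub>E i\<in>{1..}. carrier (Q i). finite {i \<in> {1..}. f i \<noteq> \<one>\<^bsub>Q i\<^esub>}}"
    unfolding filtration_lie_def Q_def
    using carrier_sum_group[of "{1..}" Q] comm_group.axioms(2)[OF Q] by (simp add: Q_def)
  define T where "T = {f \<in> carrier (filtration_lie G M). \<forall>q\<ge>1. f q \<in> (\<lambda>a. M (Suc q) #> a) ` N q}"
  \<comment> \<open>Injectivity in each degree preserves the support, so finiteness of supports
    passes in both directions.\<close>
  have supp: "{i \<in> {1..}. \<zeta> f i \<noteq> \<one>\<^bsub>Q i\<^esub>} = {i \<in> {1..}. f i \<noteq> \<one>\<^bsub>P i\<^esub>}"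
    if "\<And>i. i \<in> {1..} \<Longrightarrow> f i \<in> carrier (P i)" for f
    using that \<iota>_one by (auto simp: \<zeta>_def)
  have "bij_betw \<zeta> (carrier (filtration_lie ?G' N)) T"
  proof (rule bij_betw_imageI)
    show "inj_on \<zeta> (carrier (filtration_lie ?G' N))"
    proof (rule inj_onI)
      fix f g assume f: "f \<in> carrier (filtration_lie ?G' N)" and g: "g \<in> carrier (filtration_lie ?G' N)"
        and eq: "\<zeta> f = \<zeta> g"
      have fe: "f \<in> (\<Pi>\<^sub>E i\<in>{1..}. carrier (P i))" and ge: "g \<in> (\<Pi>\<^sub>E i\<in>{1..}. carrier (P i))"
        using f g by (auto simp: carL)
      show "f = g"
      proof (rule PiE_ext[OF fe ge])
        fix i :: nat assume i: "i \<in> {1..}"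
        have "\<iota> i (f i) = \<iota> i (g i)"
          using fun_cong[OF eq, of i] i by (simp add: \<zeta>_def)
        then show "f i = g i"
          using inj_onD[OF inj, of i "f i" "g i"] i fe ge by (auto simp: PiE_iff)
      qed
    qed
    show "\<zeta> ` carrier (filtration_lie ?G' N) = T"
    proof (intro equalityI subsetI)
      fix h assume "h \<in> \<zeta> ` carrier (filtration_lie ?G' N)"
      then obtain f where f: "h = \<zeta> f" "f \<in> (\<Pi>\<^sub>E i\<in>{1..}. carrier (P i))"
        "finite {i \<in> {1..}. f i \<noteq> \<one>\<^bsub>P i\<^esub>}"
        by (auto simp: carL)
      have fi: "f i \<in> carrier (P i)" if "i \<in> {1..}" for i
        using f(2) that by (auto simp: PiE_iff)
      have "h i \<in> (\<lambda>a. M (Suc i) #> a) ` N i" if "1 \<le> i" for i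
        using img[OF that] fi[of i] that by (auto simp: f(1) \<zeta>_def)
      moreover have "h i \<in> carrier (Q i)" if "i \<in> {1..}" for i
        using hom[of i] fi[OF that] that by (auto simp: f(1) \<zeta>_def hom_def)
      ultimately show "h \<in> T"
        using f(3) supp[OF fi] by (auto simp: T_def carM f(1) \<zeta>_def[abs_def] PiE_iff)
    next
      fix h assume h: "h \<in> T"
      have hi: "h i \<in> \<iota> i ` carrier (P i)" if "i \<in> {1..}" for i
        using h that img[of i] by (auto simp: T_def)
      define f where "f = (\<lambda>i\<in>{1..}. inv_into (carrier (P i)) (\<iota> i) (h i))"
      have fi: "f i \<in> carrier (P i)" "\<iota> i (f i) = h i" if "i \<in> {1..}" for i
        using inv_into_into[OF hi[OF that]] f_inv_into_f[OF hi[OF that]] that by (auto simp: f_def)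
      have "h \<in> extensional {1..}"
        using h by (auto simp: T_def carM PiE_iff)
      then have hf: "h = \<zeta> f"
        using fi(2) by (auto simp: \<zeta>_def extensional_def fun_eq_iff)
      moreover have "f \<in> carrier (filtration_lie ?G' N)"
        using h fi(1) supp[OF fi(1)] by (auto simp: T_def carL carM PiE_iff hf[symmetric]) (auto simp: f_def)
      ultimately show "h \<in> \<zeta> ` carrier (filtration_lie ?G' N)"
        by blast
    qed
  qed
  moreover have "\<zeta> (f \<otimes>\<^bsub>filtration_lie ?G' N\<^esub> g) = \<zeta> f \<otimes>\<^bsub>filtration_lie G M\<^esub> \<zeta> g"
    if f: "f \<in> carrier (filtration_lie ?G' N)" and g: "g \<in> carrier (filtration_lie ?G' N)" for f g
  proof -
    have "\<iota> q (f q <#> g q) = \<iota> q (f q) <#> \<iota> q (g q)" if "1 \<le> q" for q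
      using hom_mult[OF hom[OF that], of "f q" "g q"] f g that by (auto simp: carL PiE_iff Pc(2) Qc(2))
    then show ?thesis
      by (auto simp: filtration_lie_def \<zeta>_def fun_eq_iff)
  qed
  moreover have "\<zeta> (bracket (filtration_lie ?G' N) f g) = bracket (filtration_lie G M) (\<zeta> f) (\<zeta> g)"
    if f: "f \<in> carrier (filtration_lie ?G' N)" and g: "g \<in> carrier (filtration_lie ?G' N)" for f g
  proof
    fix r
    show "\<zeta> (bracket (filtration_lie ?G' N) f g) r = bracket (filtration_lie G M) (\<zeta> f) (\<zeta> g) r"
    proof (cases "1 \<le> r")
      case True
      define B where "B = (\<lambda>p. piece_bracket ?G' N p (r - p) (f p) (g (r - p)))"
      have B: "B p \<in> carrier (P r) \<and>
          \<iota> r (B p) = piece_bracket G M p (r - p) (\<zeta> f p) (\<zeta> g (r - p))" if p: "p \<in> {1..<r}" for p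
      proof -
        have p': "1 \<le> p" "1 \<le> r - p" "p + (r - p) = r"
          using p by auto
        have "f p \<in> carrier (P p)" "g (r - p) \<in> carrier (P (r - p))"
          using f g p' by (auto simp: carL PiE_iff)
        then obtain a b where ab: "a \<in> N p" "f p = N (Suc p) #> a" "b \<in> N (r - p)"
            "g (r - p) = N (Suc (r - p)) #> b"
          by (auto simp: Pc)
        have c: "a \<in> H" "b \<in> H"
          using inH ab p' by auto
        have comm: "commutator ?G' a b = commutator G a b"
          using c by (simp add: commutator_def inv_eq)
        have cN: "commutator G a b \<in> N r"
          using N.commutator_mem[OF p'(1,2) ab(1,3)] p'(3) comm by simp
        have Bp: "B p = N (Suc r) #> commutator G a b"
          using N.piece_bracket_rcos[OF p'(1,2) ab(1,3)] p'(3) by (simp add: B_def ab comm)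
        have "piece_bracket G M p (r - p) (\<zeta> f p) (\<zeta> g (r - p)) = M (Suc r) #> commutator G a b"
          using M.piece_bracket_rcos[OF p'(1,2), of a b] ab sub[OF p'(1)] sub[OF p'(2)] p'
            \<iota>_rcos[OF ab(1) p'(1)] \<iota>_rcos[OF ab(3) p'(2)] by (auto simp: \<zeta>_def)
        then show ?thesis
          using Bp cN \<iota>_rcos[OF cN True] by (auto simp: Pc)
      qed
      have "\<zeta> (bracket (filtration_lie ?G' N) f g) r = \<iota> r (finprod (P r) B {1..<r})"
        using True by (simp add: \<zeta>_def filtration_lie_def B_def P_def)
      also have "\<dots> = finprod (Q r) (\<lambda>p. \<iota> r (B p)) {1..<r}"
        using B by (intro hom_finprod P Q hom True) auto
      also have "\<dots> = finprod (Q r) (\<lambda>p. piece_bracket G M p (r - p) (\<zeta> f p) (\<zeta> g (r - p))) {1..<r}"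
      proof -
        interpret Q: comm_group "Q r" using Q[OF True] .
        have "piece_bracket G M p (r - p) (\<zeta> f p) (\<zeta> g (r - p)) \<in> carrier (Q r)" if "p \<in> {1..<r}" for p
          using B[OF that] hom_in_carrier[OF hom[OF True], of "B p"] by simp
        then show ?thesis
          using B by (intro Q.finprod_cong') auto
      qed
      also have "\<dots> = bracket (filtration_lie G M) (\<zeta> f) (\<zeta> g) r"
        using True by (simp add: filtration_lie_def Q_def)
      finally show ?thesis .
    qed (simp add: \<zeta>_def filtration_lie_def)
  qed
  ultimately have "\<zeta> \<in> lie_iso (filtration_lie ?G' N) ((filtration_lie G M)\<lparr>carrier := T\<rparr>)"
    unfolding lie_iso_def iso_def
    by (auto simp: hom_def bij_betw_def)
  then show ?thesis
    by (simp add: T_def \<zeta>_def \<iota>_def)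
qed

section \<open>Partial conjugations\<close>

declare One_nat_def [simp del]

interpretation A: group "Aut n" for n
  by (rule F.AutoGroup)

section \<open>Free groups on subsets of the generators\<close>

lemma free_group_mono: "S \<subseteq> S' \<Longrightarrow> carrier (free_group S) \<subseteq> carrier (free_group S')"
  by (auto simp: free_group_def)

lemma free_group_mult_eq: "monoid.mult (free_group S) = monoid.mult (free_group S')"
  by (simp add: free_group_def)

lemma free_group_subset_hom: "S \<subseteq> S' \<Longrightarrow> (\<lambda>w. w) \<in> hom (free_group S) (free_group S')"
  using free_group_mono[of S S'] by (auto simp: hom_def free_group_mult_eq[of S S'])

lemma free_group_inv_eq:
  assumes "S \<subseteq> S'" "w \<in> carrier (free_group S)"
  shows "inv\<^bsub>free_group S'\<^esub> w = inv\<^bsub>free_group S\<^esub> w"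
proof -
  interpret h: group_hom "free_group S" "free_group S'" "\<lambda>w. w"
    using free_group_subset_hom[OF assms(1)] by (simp add: group_hom_def group_hom_axioms_def F.is_group)
  show ?thesis
    using h.hom_inv[OF assms(2)] by simp
qed

lemma free_group_lower_central_mono:
  "S \<subseteq> S' \<Longrightarrow> w \<in> lower_central (free_group S) q \<Longrightarrow> w \<in> lower_central (free_group S') q"
  using lower_central_hom[OF F.is_group F.is_group free_group_subset_hom] by blast

text \<open>The smaller free group is a retract: killing the other generators fixes w and respects
  the lower central series.\<close>

lemma free_group_lower_central_Int:
  assumes "S \<subseteq> S'" "w \<in> lower_central (free_group S') q" "w \<in> carrier (free_group S)"
  shows "w \<in> lower_central (free_group S) q"
proof -
  define \<pi> where "\<pi> = free_ext (free_group S) (\<lambda>k. if k \<in> S then gen k else \<one>\<^bsub>free_group S\<^esub>)"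
  have \<pi>: "\<pi> \<in> hom (free_group S') (free_group S)"
    unfolding \<pi>_def by (rule F.free_ext_hom) (auto intro: gen_in_free_group)
  have "\<pi> w = w"
  proof (rule F.free_hom_unique[of \<pi> S S "\<lambda>w. w"])
    show "\<pi> \<in> hom (free_group S) (free_group S)"
      using \<pi> free_group_mono[OF assms(1)] free_group_mult_eq[of S S'] by (auto simp: hom_def Pi_iff)
    show "\<pi> (gen k) = gen k" if "k \<in> S" for k
      unfolding \<pi>_def using that gen_in_free_group[OF that] by (subst F.free_ext_gen) auto
  qed (use assms(3) in \<open>auto simp: hom_def\<close>)
  then show ?thesis
    using lower_central_hom[OF F.is_group F.is_group \<pi> assms(2)] by simp
qed

lemma free_hom_maps_into:
  assumes S: "S \<subseteq> S'" and \<phi>: "\<phi> \<in> hom (free_group S') (free_group S')"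
    and gen: "\<And>k. k \<in> S \<Longrightarrow> \<phi> (gen k) \<in> carrier (free_group S)"
    and w: "w \<in> carrier (free_group S)"
  shows "\<phi> w \<in> carrier (free_group S)"
proof -
  define h where "h = free_ext (free_group S) (\<lambda>k. \<phi> (gen k))"
  have h: "h \<in> hom (free_group S) (free_group S)"
    unfolding h_def by (rule F.free_ext_hom) (use gen in auto)
  have "\<phi> w = h w"
  proof (rule F.free_hom_unique[OF _ _ _ w])
    show "\<phi> \<in> hom (free_group S) (free_group S')"
      using \<phi> free_group_mono[OF S] free_group_mult_eq[of S S'] by (auto simp: hom_def Pi_iff)
    show "h \<in> hom (free_group S) (free_group S')"
      using h free_group_mono[OF S] free_group_mult_eq[of S S'] by (auto simp: hom_def Pi_iff)
    show "\<phi> (gen k) = h (gen k)" if "k \<in> S" for k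
      unfolding h_def by (subst F.free_ext_gen) (use gen[OF that] in auto)
  qed
  then show ?thesis
    using h w by (auto simp: hom_def)
qed

lemma aut_gen_eqI:
  assumes "\<phi> \<in> carrier (Aut n)" "\<psi> \<in> carrier (Aut n)"
    and "\<And>k. 1 \<le> k \<Longrightarrow> k \<le> n \<Longrightarrow> \<phi> (gen k) = \<psi> (gen k)"
  shows "\<phi> = \<psi>"
  using F.free_hom_unique[OF autD(1)[OF assms(1)] autD(1)[OF assms(2)]] assms(3)
  by (intro aut_eqI[OF assms(1,2)]) auto

text \<open>Both w and its image define homomorphisms into the quotient by the c-th term, and
  homomorphisms from a free group are determined on generators.\<close>

lemma free_ia_gen:
  assumes \<phi>: "\<phi> \<in> carrier (Aut n)"
    and gen: "\<And>k. 1 \<le> k \<Longrightarrow> k \<le> n \<Longrightarrow> inv\<^bsub>Fn n\<^esub> gen k \<otimes>\<^bsub>Fn n\<^esub> \<phi> (gen k) \<in> lower_central (Fn n) c"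
  shows "\<phi> \<in> ia (Fn n) c"
proof -
  let ?N = "lower_central (Fn n) c"
  interpret N: normal ?N "Fn n"
    by (rule F.lower_central_normal)
  interpret Q: group "Fn n Mod ?N"
    by (rule N.factorgroup_is_group)
  have rcos: "?N #>\<^bsub>Fn n\<^esub> \<phi> w = ?N #>\<^bsub>Fn n\<^esub> w \<longleftrightarrow> inv\<^bsub>Fn n\<^esub> w \<otimes>\<^bsub>Fn n\<^esub> \<phi> w \<in> ?N"
    if w: "w \<in> carrier (Fn n)" for w
  proof -
    have \<phi>w: "\<phi> w \<in> carrier (Fn n)"
      using \<phi> w by (rule F.aut_closed)
    then have "?N #>\<^bsub>Fn n\<^esub> \<phi> w = ?N #>\<^bsub>Fn n\<^esub> w \<longleftrightarrow> \<phi> w \<otimes>\<^bsub>Fn n\<^esub> inv\<^bsub>Fn n\<^esub> w \<in> ?N"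
      using w by (intro F.rcos_eq_iff N.subgroup_axioms)
    also have "\<dots> \<longleftrightarrow> inv\<^bsub>Fn n\<^esub> w \<otimes>\<^bsub>Fn n\<^esub> \<phi> w \<in> ?N"
      using F.lc_conj(1)[OF w, of "\<phi> w \<otimes>\<^bsub>Fn n\<^esub> inv\<^bsub>Fn n\<^esub> w" c]
        F.lc_conj(2)[OF w, of "inv\<^bsub>Fn n\<^esub> w \<otimes>\<^bsub>Fn n\<^esub> \<phi> w" c] w \<phi>w
      by (auto simp: F.m_assoc)
    finally show ?thesis .
  qed
  have "?N #>\<^bsub>Fn n\<^esub> \<phi> w = ?N #>\<^bsub>Fn n\<^esub> w" if w: "w \<in> carrier (Fn n)" for w
  proof (rule Q.free_hom_unique[OF _ _ _ w, of "\<lambda>w. ?N #>\<^bsub>Fn n\<^esub> \<phi> w"])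
    show "(\<lambda>w. ?N #>\<^bsub>Fn n\<^esub> \<phi> w) \<in> hom (Fn n) (Fn n Mod ?N)"
      using hom_compose[OF autD(1)[OF \<phi>] N.r_coset_hom_Mod] by (simp add: comp_def)
    show "(\<lambda>w. ?N #>\<^bsub>Fn n\<^esub> w) \<in> hom (Fn n) (Fn n Mod ?N)"
      by (rule N.r_coset_hom_Mod)
    show "?N #>\<^bsub>Fn n\<^esub> \<phi> (gen k) = ?N #>\<^bsub>Fn n\<^esub> gen k" if "k \<in> {1..n}" for k
      using rcos[of "gen k"] gen[of k] gen_in_free_group[OF that] that by auto
  qed
  then show ?thesis
    using rcos \<phi> by (auto simp: ia_def)
qed

text \<open>Inner on \<open>Fn m\<close>, trivial on the later generators. With the convention g x
  g^{-1} it is a homomorphism in g, as the product of \<open>Aut n\<close> applies the right factor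
  first; the price is that \<open>y_aut n m i\<close> belongs to the inverse of
  \<open>gen i\<close>.\<close>

definition conj_aut :: "nat \<Rightarrow> nat \<Rightarrow> word \<Rightarrow> word \<Rightarrow> word" where
  "conj_aut n m g = (\<lambda>w\<in>carrier (Fn n). free_ext (Fn n)
     (\<lambda>k. if k \<le> m then g \<otimes>\<^bsub>Fn n\<^esub> gen k \<otimes>\<^bsub>Fn n\<^esub> inv\<^bsub>Fn n\<^esub> g else gen k) w)"

lemma gen_closed: "1 \<le> k \<Longrightarrow> k \<le> n \<Longrightarrow> gen k \<in> carrier (Fn n)"
  by (auto intro: gen_in_free_group)

lemma Fn_mono: "m \<le> n \<Longrightarrow> w \<in> carrier (Fn m) \<Longrightarrow> w \<in> carrier (Fn n)"
  using free_group_mono[of "{1..m}" "{1..n}"] by auto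

lemma Fn_mult_eq: "monoid.mult (Fn m) = monoid.mult (Fn n)"
  by (rule free_group_mult_eq)

lemma Fn_inv_eq: "m \<le> n \<Longrightarrow> w \<in> carrier (Fn m) \<Longrightarrow> inv\<^bsub>Fn m\<^esub> w = inv\<^bsub>Fn n\<^esub> w"
  using free_group_inv_eq[of "{1..m}" "{1..n}"] by simp

lemma Fn_one_eq: "\<one>\<^bsub>Fn m\<^esub> = \<one>\<^bsub>Fn n\<^esub>"
  by (simp add: free_group_def)

lemma Fn_sub_closed:
  assumes "m \<le> n" "v \<in> carrier (Fn m)" "w \<in> carrier (Fn m)"
  shows "v \<otimes>\<^bsub>Fn n\<^esub> w \<in> carrier (Fn m)" "inv\<^bsub>Fn n\<^esub> v \<in> carrier (Fn m)"
  using F.m_closed[OF assms(2,3)] F.inv_closed[OF assms(2)] Fn_inv_eq[OF assms(1,2)]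
  by (simp_all add: Fn_mult_eq[of n m])

context
  fixes n m :: nat
  assumes m: "m \<le> n"
begin

lemma conj_aut_hom:
  assumes "g \<in> carrier (Fn m)"
  shows "conj_aut n m g \<in> hom (Fn n) (Fn n)"
proof -
  have "free_ext (Fn n) (\<lambda>k. if k \<le> m then g \<otimes>\<^bsub>Fn n\<^esub> gen k \<otimes>\<^bsub>Fn n\<^esub> inv\<^bsub>Fn n\<^esub> g else gen k) \<in> hom (Fn n) (Fn n)"
    using Fn_mono[OF m assms] by (intro F.free_ext_hom) (auto simp: gen_closed)
  then show ?thesis
    by (auto simp: conj_aut_def hom_def)
qed

lemma conj_aut_gen:
  assumes "g \<in> carrier (Fn m)" "1 \<le> k" "k \<le> n"
  shows "conj_aut n m g (gen k) =
    (if k \<le> m then g \<otimes>\<^bsub>Fn n\<^esub> gen k \<otimes>\<^bsub>Fn n\<^esub> inv\<^bsub>Fn n\<^esub> g else gen k)"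
  using gen_closed[OF assms(2,3)] Fn_mono[OF m assms(1)] by (simp add: conj_aut_def F.free_ext_gen)

lemma conj_aut_apply:
  assumes g: "g \<in> carrier (Fn m)" and w: "w \<in> carrier (Fn m)"
  shows "conj_aut n m g w = g \<otimes>\<^bsub>Fn n\<^esub> w \<otimes>\<^bsub>Fn n\<^esub> inv\<^bsub>Fn n\<^esub> g"
proof (rule F.free_hom_unique[OF _ _ _ w, of _ "{1..n}" "\<lambda>w. g \<otimes>\<^bsub>Fn n\<^esub> w \<otimes>\<^bsub>Fn n\<^esub> inv\<^bsub>Fn n\<^esub> g"])
  have gn: "g \<in> carrier (Fn n)"
    using Fn_mono[OF m g] .
  show "conj_aut n m g \<in> hom (Fn m) (Fn n)"
    using conj_aut_hom[OF g] Fn_mono[OF m] by (auto simp: hom_def Pi_iff Fn_mult_eq[of m n])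
  show "(\<lambda>w. g \<otimes>\<^bsub>Fn n\<^esub> w \<otimes>\<^bsub>Fn n\<^esub> inv\<^bsub>Fn n\<^esub> g) \<in> hom (Fn m) (Fn n)"
    using gn Fn_mono[OF m] by (intro homI) (auto simp: Fn_mult_eq[of m n] F.m_assoc)
  show "conj_aut n m g (gen k) = g \<otimes>\<^bsub>Fn n\<^esub> gen k \<otimes>\<^bsub>Fn n\<^esub> inv\<^bsub>Fn n\<^esub> g" if "k \<in> {1..m}" for k
    using that m g by (simp add: conj_aut_gen)
qed

lemma conj_aut_mult_apply:
  assumes g: "g \<in> carrier (Fn m)" and h: "h \<in> carrier (Fn m)" and w: "w \<in> carrier (Fn n)"
  shows "conj_aut n m g (conj_aut n m h w) = conj_aut n m (g \<otimes>\<^bsub>Fn n\<^esub> h) w"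
proof (rule F.free_hom_unique[OF _ _ _ w, of "\<lambda>w. conj_aut n m g (conj_aut n m h w)" "{1..n}"])
  have gh: "g \<otimes>\<^bsub>Fn n\<^esub> h \<in> carrier (Fn m)"
    using Fn_sub_closed[OF m g h] by simp
  have c: "g \<in> carrier (Fn n)" "h \<in> carrier (Fn n)"
    using Fn_mono[OF m] g h by auto
  show "(\<lambda>w. conj_aut n m g (conj_aut n m h w)) \<in> hom (Fn n) (Fn n)"
    using hom_compose[OF conj_aut_hom[OF h] conj_aut_hom[OF g]] by (simp add: comp_def)
  show "conj_aut n m (g \<otimes>\<^bsub>Fn n\<^esub> h) \<in> hom (Fn n) (Fn n)"
    by (rule conj_aut_hom[OF gh])
  show "conj_aut n m g (conj_aut n m h (gen k)) = conj_aut n m (g \<otimes>\<^bsub>Fn n\<^esub> h) (gen k)"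
    if k: "k \<in> {1..n}" for k
  proof (cases "k \<le> m")
    case True
    then have gk: "gen k \<in> carrier (Fn m)" "gen k \<in> carrier (Fn n)"
      using k by (auto intro!: gen_closed)
    then have "conj_aut n m h (gen k) \<in> carrier (Fn m)"
      using h m by (simp add: conj_aut_apply Fn_sub_closed)
    then show ?thesis
      using gk c gh g h by (simp add: conj_aut_apply F.m_assoc F.inv_mult_group)
  next
    case False
    then show ?thesis
      using k g h gh by (simp add: conj_aut_gen)
  qed
qed

lemma conj_aut_one: "w \<in> carrier (Fn n) \<Longrightarrow> conj_aut n m \<one>\<^bsub>Fn n\<^esub> w = w"
proof (rule F.free_hom_unique[of _ "{1..n}" "{1..n}" "\<lambda>w. w"])
  have one: "\<one>\<^bsub>Fn n\<^esub> \<in> carrier (Fn m)"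
    using F.one_closed Fn_one_eq by metis
  show "conj_aut n m \<one>\<^bsub>Fn n\<^esub> \<in> hom (Fn n) (Fn n)"
    by (rule conj_aut_hom[OF one])
  show "conj_aut n m \<one>\<^bsub>Fn n\<^esub> (gen k) = gen k" if "k \<in> {1..n}" for k
    using that one gen_closed[of k n] by (simp add: conj_aut_gen)
qed (auto simp: hom_def)

lemma conj_aut_in_Aut:
  assumes g: "g \<in> carrier (Fn m)"
  shows "conj_aut n m g \<in> carrier (Aut n)"
proof (rule autI[OF conj_aut_hom[OF g]])
  have gi: "inv\<^bsub>Fn n\<^esub> g \<in> carrier (Fn m)"
    using Fn_sub_closed[OF m g g] by simp
  have gn: "g \<in> carrier (Fn n)"
    using Fn_mono[OF m g] .
  show "bij_betw (conj_aut n m g) (carrier (Fn n)) (carrier (Fn n))"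
    using conj_aut_hom[OF g] conj_aut_hom[OF gi] g gi gn
    by (intro bij_betw_byWitness[where f' = "conj_aut n m (inv\<^bsub>Fn n\<^esub> g)"])
      (auto simp: conj_aut_mult_apply conj_aut_one hom_def)
qed (simp add: conj_aut_def)

lemma conj_aut_mult:
  assumes "g \<in> carrier (Fn m)" "h \<in> carrier (Fn m)"
  shows "conj_aut n m (g \<otimes>\<^bsub>Fn n\<^esub> h) = conj_aut n m g \<otimes>\<^bsub>Aut n\<^esub> conj_aut n m h"
  using assms conj_aut_in_Aut Fn_sub_closed[OF m]
  by (intro aut_eqI) (auto simp: aut_mult_apply conj_aut_mult_apply)

lemma conj_aut_group_hom: "group_hom (Fn m) (Aut n) (conj_aut n m)"
  by (auto simp: group_hom_def group_hom_axioms_def F.is_group A.is_group hom_def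
      conj_aut_in_Aut conj_aut_mult Fn_mult_eq[of m n])

lemma conj_aut_inv:
  "g \<in> carrier (Fn m) \<Longrightarrow> conj_aut n m (inv\<^bsub>Fn n\<^esub> g) = inv\<^bsub>Aut n\<^esub> conj_aut n m g"
  using group_hom.hom_inv[OF conj_aut_group_hom] Fn_inv_eq[OF m] by metis

lemma y_aut_eq_conj_aut: "1 \<le> i \<Longrightarrow> i \<le> m \<Longrightarrow> y_aut n m i = conj_aut n m (inv\<^bsub>Fn n\<^esub> gen i)"
  using m gen_closed[of i n] by (auto simp: y_aut_def conj_aut_def cong: if_cong)

end


section \<open>The chain of subgroups\<close>

definition J_sub :: "nat \<Rightarrow> nat \<Rightarrow> (word \<Rightarrow> word) set" where
  "J_sub n m = generate (Aut n) {y_aut n k i | k i. 2 \<le> k \<and> k \<le> m \<and> 1 \<le> i \<and> i \<le> k}"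

lemma I_sub_eq: "I_sub n = J_sub n n"
  by (simp add: I_sub_def J_sub_def)

lemma J_sub_1: "J_sub n 1 = {\<one>\<^bsub>Aut n\<^esub>}"
proof -
  have "{y_aut n k i | k i. 2 \<le> k \<and> k \<le> 1 \<and> 1 \<le> i \<and> i \<le> k} = {}"
    by auto
  then show ?thesis
    using A.generate_empty by (simp only: J_sub_def)
qed

lemma J_sub_subgroup: "m \<le> n \<Longrightarrow> subgroup (J_sub n m) (Aut n)"
  unfolding J_sub_def by (intro A.generate_is_subgroup) (auto intro!: y_aut_in_Aut)

lemma J_sub_mono: "k \<le> m \<Longrightarrow> J_sub n k \<subseteq> J_sub n m"
  unfolding J_sub_def by (intro A.mono_generate) fastforce

lemma J_sub_le:
  assumes "m \<le> n" "subgroup K (Aut n)"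
    and "\<And>k i. 2 \<le> k \<Longrightarrow> k \<le> m \<Longrightarrow> 1 \<le> i \<Longrightarrow> i \<le> k \<Longrightarrow> y_aut n k i \<in> K"
  shows "J_sub n m \<subseteq> K"
  unfolding J_sub_def using assms(3) by (intro A.generate_subgroup_incl[OF _ assms(2)]) auto

lemma y_aut_in_J_sub: "2 \<le> k \<Longrightarrow> k \<le> m \<Longrightarrow> 1 \<le> i \<Longrightarrow> i \<le> k \<Longrightarrow> y_aut n k i \<in> J_sub n m"
  unfolding J_sub_def by (intro generate.incl) auto

lemma J_sub_Aut: "m \<le> n \<Longrightarrow> \<phi> \<in> J_sub n m \<Longrightarrow> \<phi> \<in> carrier (Aut n)"
  using subgroup.mem_carrier[OF J_sub_subgroup] .

lemma J_sub_fix: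
  assumes "m < k" "k \<le> n" "\<phi> \<in> J_sub n m"
  shows "\<phi> (gen k) = gen k"
proof -
  have gk: "gen k \<in> carrier (Fn n)"
    using assms by (intro gen_closed) auto
  have "J_sub n m \<subseteq> {\<phi> \<in> carrier (Aut n). \<phi> (gen k) = gen k}"
  proof (rule J_sub_le)
    show "subgroup {\<phi> \<in> carrier (Aut n). \<phi> (gen k) = gen k} (Aut n)"
    proof (rule A.subgroupI)
      fix \<phi> assume "\<phi> \<in> {\<phi> \<in> carrier (Aut n). \<phi> (gen k) = gen k}"
      then show "inv\<^bsub>Aut n\<^esub> \<phi> \<in> {\<phi> \<in> carrier (Aut n). \<phi> (gen k) = gen k}"
        using F.aut_inv_apply(1)[of \<phi> "{1..n}" "gen k"] gk by simp
    qed (use gk in \<open>auto simp: aut_mult_apply aut_one_apply intro!: exI[of _ "\<one>\<^bsub>Aut n\<^esub>"]\<close>)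
  qed (use assms in \<open>auto simp: y_aut_gen intro!: y_aut_in_Aut\<close>)
  then show ?thesis
    using assms by auto
qed

lemma J_sub_maps:
  assumes "m \<le> m'" "m' \<le> n" "\<phi> \<in> J_sub n m" "w \<in> carrier (Fn m')"
  shows "\<phi> w \<in> carrier (Fn m')"
proof -
  let ?C = "carrier (Fn m')"
  \<comment> \<open>Equality rather than inclusion, so that the set is closed under
    inverses.\<close>
  let ?K = "{\<phi> \<in> carrier (Aut n). \<phi> ` ?C = ?C}"
  have sub: "?C \<subseteq> carrier (Fn n)"
    using Fn_mono[OF assms(2)] by auto
  have "J_sub n m \<subseteq> ?K"
  proof (rule J_sub_le)
    show "subgroup ?K (Aut n)"
    proof (rule A.subgroupI)
      fix \<phi> assume \<phi>: "\<phi> \<in> ?K"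
      then have "(inv\<^bsub>Aut n\<^esub> \<phi>) ` ?C = (inv\<^bsub>Aut n\<^esub> \<phi>) ` \<phi> ` ?C"
        by simp
      also have "\<dots> = (\<lambda>w. w) ` ?C"
        unfolding image_image
        by (rule image_cong[OF refl], rule F.aut_inv_apply(1)) (use \<phi> sub in auto)
      finally show "inv\<^bsub>Aut n\<^esub> \<phi> \<in> ?K"
        using \<phi> by (simp add: A.inv_closed)
      fix \<psi> assume \<psi>: "\<psi> \<in> ?K"
      have "(\<phi> \<otimes>\<^bsub>Aut n\<^esub> \<psi>) ` ?C = \<phi> ` \<psi> ` ?C"
        unfolding image_image
        by (rule image_cong[OF refl], rule aut_mult_apply) (use \<phi> \<psi> sub in auto)
      then show "\<phi> \<otimes>\<^bsub>Aut n\<^esub> \<psi> \<in> ?K"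
        using \<phi> \<psi> by simp
    next
      have "\<one>\<^bsub>Aut n\<^esub> ` ?C = (\<lambda>w. w) ` ?C"
        by (rule image_cong[OF refl], rule aut_one_apply) (use sub in auto)
      then show "?K \<noteq> {}"
        using A.one_closed by auto
    qed auto
  next
    fix k i assume ki: "2 \<le> k" "k \<le> m" "1 \<le> i" "i \<le> k"
    have maps: "conj_aut n k g w \<in> ?C" if "g \<in> carrier (Fn k)" "w \<in> ?C" for g w
    proof (rule free_hom_maps_into[OF _ _ _ \<open>w \<in> ?C\<close>])
      show "{1..m'} \<subseteq> {1..n}" "conj_aut n k g \<in> hom (Fn n) (Fn n)"
        using that ki assms by (auto intro: conj_aut_hom)
      have gC: "g \<in> ?C"
        using that ki assms Fn_mono[of k m'] by simp
      show "conj_aut n k g (gen j) \<in> ?C" if "j \<in> {1..m'}" for j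
        using that ki assms gC \<open>g \<in> carrier (Fn k)\<close> gen_closed[of j m']
        by (simp add: conj_aut_gen Fn_sub_closed)
    qed
    have g: "gen i \<in> carrier (Fn k)" "inv\<^bsub>Fn n\<^esub> gen i \<in> carrier (Fn k)"
      using ki assms gen_closed[of i k] Fn_sub_closed[of k n "gen i" "gen i"] by auto
    have "conj_aut n k (inv\<^bsub>Fn n\<^esub> gen i) ` ?C = ?C"
    proof (intro equalityI subsetI)
      fix w assume w: "w \<in> ?C"
      \<comment> \<open>Surjectivity on the smaller group: conjugation by the inverse element also
        stays inside it.\<close>
      have "w = conj_aut n k (inv\<^bsub>Fn n\<^esub> gen i) (conj_aut n k (gen i) w)"
        using g ki assms w sub Fn_mono[of k n "gen i"]
        by (subst conj_aut_mult_apply) (auto simp: conj_aut_one)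
      then show "w \<in> conj_aut n k (inv\<^bsub>Fn n\<^esub> gen i) ` ?C"
        using maps[OF g(1) w] by blast
    qed (use maps g in auto)
    then show "y_aut n k i \<in> ?K"
      using ki assms y_aut_in_Aut[of i k n] by (simp add: y_aut_eq_conj_aut)
  qed (use assms in auto)
  then show ?thesis
    using assms by blast
qed

lemma J_sub_ia: "m \<le> n \<Longrightarrow> J_sub n m \<subseteq> ia (Fn n) 2"
proof (rule J_sub_le)
  show "subgroup (ia (Fn n) 2) (Aut n)"
    by (rule normal_imp_subgroup[OF F.ia_normal])
  fix k i assume mn: "m \<le> n" and ki: "2 \<le> k" "k \<le> m" "1 \<le> i" "i \<le> k"
  show "y_aut n k i \<in> ia (Fn n) 2"
  proof (rule free_ia_gen)
    show "y_aut n k i \<in> carrier (Aut n)"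
      using mn ki by (intro y_aut_in_Aut) auto
    fix j assume j: "1 \<le> j" "j \<le> n"
    have c: "gen j \<in> carrier (Fn n)" "gen i \<in> carrier (Fn n)"
      using j ki mn by (auto intro!: gen_closed)
    show "inv\<^bsub>Fn n\<^esub> gen j \<otimes>\<^bsub>Fn n\<^esub> y_aut n k i (gen j) \<in> lower_central (Fn n) 2"
    proof (cases "j \<le> k")
      case True
      have "inv\<^bsub>Fn n\<^esub> gen j \<otimes>\<^bsub>Fn n\<^esub> y_aut n k i (gen j) = commutator (Fn n) (gen j) (gen i)"
        using True c j ki mn by (simp add: y_aut_gen F.word_simps)
      then show ?thesis
        using F.lower_central_commutator[of 1 1 "gen j" "{1..n}" "gen i"] c by (simp add: numeral_2_eq_2 One_nat_def)
    next
      case False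
      then show ?thesis
        using c j ki mn by (simp add: y_aut_gen F.lc_closed)
    qed
  qed
qed

lemma lower_central_1 [simp]: "lower_central G 1 = carrier G"
  by (simp add: One_nat_def)

section \<open>Lower central terms of the groups \<open>J_sub\<close>\<close>

abbreviation J_lc :: "nat \<Rightarrow> nat \<Rightarrow> nat \<Rightarrow> (word \<Rightarrow> word) set" where
  "J_lc n m q \<equiv> lower_central ((Aut n)\<lparr>carrier := J_sub n m\<rparr>) q"

lemma J_group: "m \<le> n \<Longrightarrow> group ((Aut n)\<lparr>carrier := J_sub n m\<rparr>)"
  by (rule A.subgroup_imp_group[OF J_sub_subgroup])

lemma J_lc_subset: "m \<le> n \<Longrightarrow> J_lc n m q \<subseteq> J_sub n m"
  using group.lower_central_carrier[OF J_group, of m n _ q] by auto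

lemma J_lc_subgroup: "m \<le> n \<Longrightarrow> subgroup (J_lc n m q) (Aut n)"
  using A.incl_subgroup[OF J_sub_subgroup group.lower_central_subgroup[OF J_group]] by blast

lemma J_lc_ia: "m \<le> n \<Longrightarrow> 1 \<le> q \<Longrightarrow> J_lc n m q \<subseteq> ia (Fn n) (Suc q)"
  using filtration.lower_central_restrict_subset[OF F.ia_filtration J_sub_subgroup, of m n q] J_sub_ia[of m n]
  by (simp add: numeral_2_eq_2 One_nat_def)

lemma J_lc_mono:
  assumes "k \<le> m" "m \<le> n" "\<phi> \<in> J_lc n k q"
  shows "\<phi> \<in> J_lc n m q"
proof -
  have "(\<lambda>\<phi>. \<phi>) \<in> hom ((Aut n)\<lparr>carrier := J_sub n k\<rparr>) ((Aut n)\<lparr>carrier := J_sub n m\<rparr>)"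
    using J_sub_mono[OF assms(1), of n] by (auto simp: hom_def)
  then show ?thesis
    using lower_central_hom[OF J_group J_group] assms by (meson order_trans)
qed

lemma conj_aut_in_J_sub:
  assumes m: "2 \<le> m" "m \<le> n" and g: "g \<in> carrier (Fn m)"
  shows "conj_aut n m g \<in> J_sub n m"
proof -
  interpret h: group_hom "Fn m" "Aut n" "conj_aut n m"
    by (rule conj_aut_group_hom[OF m(2)])
  note J = J_sub_subgroup[OF m(2)]
  have "subgroup {g \<in> carrier (Fn m). conj_aut n m g \<in> J_sub n m} (Fn m)"
    using subgroup.m_closed[OF J] subgroup.m_inv_closed[OF J] subgroup.one_closed[OF J]
    by (intro F.subgroupI) (auto intro!: exI[of _ "\<one>\<^bsub>Fn m\<^esub>"])
  then have "g \<in> {g \<in> carrier (Fn m). conj_aut n m g \<in> J_sub n m}"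
  proof (rule free_group_generated[OF _ _ g])
    fix i assume i: "i \<in> {1..m}"
    then have c: "gen i \<in> carrier (Fn m)"
      by (rule gen_in_free_group)
    have "inv\<^bsub>Aut n\<^esub> conj_aut n m (gen i) = y_aut n m i"
      using i m c by (simp add: y_aut_eq_conj_aut conj_aut_inv)
    moreover have "y_aut n m i \<in> J_sub n m"
      using i m by (intro y_aut_in_J_sub) auto
    ultimately have "inv\<^bsub>Aut n\<^esub> (inv\<^bsub>Aut n\<^esub> conj_aut n m (gen i)) \<in> J_sub n m"
      using subgroup.m_inv_closed[OF J] by simp
    then show "gen i \<in> {g \<in> carrier (Fn m). conj_aut n m g \<in> J_sub n m}"
      using c conj_aut_in_Aut[OF m(2) c] by simp
  qed
  then show ?thesis by simp
qed

lemma conj_aut_lower_central: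
  assumes m: "2 \<le> m" "m \<le> n" and g: "g \<in> lower_central (Fn m) q"
  shows "conj_aut n m g \<in> J_lc n m q"
proof -
  interpret h: group_hom "Fn m" "Aut n" "conj_aut n m"
    by (rule conj_aut_group_hom[OF m(2)])
  have "conj_aut n m \<in> hom (Fn m) ((Aut n)\<lparr>carrier := J_sub n m\<rparr>)"
    using conj_aut_in_J_sub[OF m] h.homh by (auto simp: hom_def)
  then show ?thesis
    using lower_central_hom[OF F.is_group J_group[OF m(2)] _ g] by simp
qed

text \<open>The conjugation rule of the semidirect product. On the first m generators it says that
  \<open>\<psi>\<close> maps conjugates in \<open>Fn m\<close> to conjugates in \<open>Fn m\<close>;
  the later generators are fixed by both factors.\<close>

lemma J_sub_conj:
  assumes "m \<le> n" "k \<le> m" "\<psi> \<in> J_sub n k" "g \<in> carrier (Fn m)"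
  shows "\<psi> \<otimes>\<^bsub>Aut n\<^esub> conj_aut n m g = conj_aut n m (\<psi> g) \<otimes>\<^bsub>Aut n\<^esub> \<psi>"
proof (rule aut_gen_eqI)
  have \<psi>: "\<psi> \<in> carrier (Aut n)"
    using J_sub_Aut[of k n] assms by simp
  have g: "conj_aut n m g \<in> carrier (Aut n)" "conj_aut n m (\<psi> g) \<in> carrier (Aut n)"
    using assms J_sub_maps[of k m n \<psi> g] by (auto intro: conj_aut_in_Aut)
  have gn: "g \<in> carrier (Fn n)" "\<psi> g \<in> carrier (Fn m)"
    using assms J_sub_maps[of k m n \<psi> g] Fn_mono by auto
  show "\<psi> \<otimes>\<^bsub>Aut n\<^esub> conj_aut n m g \<in> carrier (Aut n)" "conj_aut n m (\<psi> g) \<otimes>\<^bsub>Aut n\<^esub> \<psi> \<in> carrier (Aut n)"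
    using \<psi> g by auto
  fix j assume j: "1 \<le> j" "j \<le> n"
  then have cj: "gen j \<in> carrier (Fn n)"
    by (rule gen_closed)
  show "(\<psi> \<otimes>\<^bsub>Aut n\<^esub> conj_aut n m g) (gen j) = (conj_aut n m (\<psi> g) \<otimes>\<^bsub>Aut n\<^esub> \<psi>) (gen j)"
  proof (cases "j \<le> m")
    case True
    then have "gen j \<in> carrier (Fn m)"
      using j by (intro gen_closed)
    then have "\<psi> (gen j) \<in> carrier (Fn m)"
      using assms J_sub_maps by blast
    then show ?thesis
      using True j assms \<psi> g cj gn
      by (simp add: aut_mult_apply conj_aut_gen conj_aut_apply F.aut_mult F.aut_inv)
  next
    case False
    then have "\<psi> (gen j) = gen j"
      using J_sub_fix[of k j n \<psi>] j assms by simp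
    then show ?thesis
      using False j assms \<psi> g cj gn by (simp add: aut_mult_apply conj_aut_gen)
  qed
qed

lemma J_sub_lower_central_maps:
  assumes "m \<le> n" "k \<le> m" "\<psi> \<in> J_sub n k" "g \<in> lower_central (Fn m) q"
  shows "\<psi> g \<in> lower_central (Fn m) q"
proof -
  have "g \<in> carrier (Fn m)" "g \<in> lower_central (Fn n) q"
    using assms F.lower_central_carrier free_group_lower_central_mono[of "{1..m}" "{1..n}"] by auto
  moreover have "\<psi> \<in> carrier (Aut n)"
    using J_sub_Aut[of k n] assms by simp
  ultimately show ?thesis
    using assms J_sub_maps[of k m n \<psi> g] F.aut_lower_central
    by (intro free_group_lower_central_Int[of "{1..m}" "{1..n}"]) auto
qed

text \<open>\<open>ia_lower_central\<close> bounds the displacement inside \<open>Fn n\<close>; the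
  retraction onto \<open>Fn m\<close> brings it back to the lower central series of
  \<open>Fn m\<close>.\<close>

lemma J_sub_action:
  assumes "m \<le> n" "k \<le> m" "\<psi> \<in> J_sub n k" "\<psi> \<in> ia (Fn n) (Suc p)"
    and g: "g \<in> lower_central (Fn m) q" "1 \<le> q"
  shows "inv\<^bsub>Fn n\<^esub> g \<otimes>\<^bsub>Fn n\<^esub> \<psi> g \<in> lower_central (Fn m) (q + p)"
proof -
  have gm: "g \<in> carrier (Fn m)" and gn: "g \<in> lower_central (Fn n) q"
    using assms F.lower_central_carrier free_group_lower_central_mono[of "{1..m}" "{1..n}"] by auto
  have "inv\<^bsub>Fn n\<^esub> g \<otimes>\<^bsub>Fn n\<^esub> \<psi> g \<in> carrier (Fn m)"
    using assms gm J_sub_maps[of k m n \<psi> g] Fn_sub_closed by simp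
  then show ?thesis
    using F.ia_lower_central[OF assms(4) g(2) gn] assms(1)
    by (intro free_group_lower_central_Int[of "{1..m}" "{1..n}"]) auto
qed

text \<open>The candidate for the q-th lower central term of \<open>J_sub n m\<close>. It is closed
  under products because \<open>J_sub n (m - 1)\<close> preserves each lower central term of
  \<open>Fn m\<close>.\<close>

definition semidirect :: "nat \<Rightarrow> nat \<Rightarrow> nat \<Rightarrow> (word \<Rightarrow> word) set" where
  "semidirect n m q = {conj_aut n m g \<otimes>\<^bsub>Aut n\<^esub> \<psi> | g \<psi>.
     g \<in> lower_central (Fn m) q \<and> \<psi> \<in> J_lc n (m - 1) q}"

context
  fixes n m :: nat
  assumes m: "2 \<le> m" "m \<le> n"
begin

lemma m1: "m - 1 \<le> n" "m - 1 \<le> m" "m \<le> n"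
  using m by auto

lemma semidirect_mult:
  assumes "g \<in> carrier (Fn m)" "h \<in> carrier (Fn m)" "\<psi> \<in> J_sub n (m - 1)" "\<chi> \<in> J_sub n (m - 1)"
  shows "(conj_aut n m g \<otimes>\<^bsub>Aut n\<^esub> \<psi>) \<otimes>\<^bsub>Aut n\<^esub> (conj_aut n m h \<otimes>\<^bsub>Aut n\<^esub> \<chi>) =
    conj_aut n m (g \<otimes>\<^bsub>Fn n\<^esub> \<psi> h) \<otimes>\<^bsub>Aut n\<^esub> (\<psi> \<otimes>\<^bsub>Aut n\<^esub> \<chi>)"
proof -
  have c: "\<psi> \<in> carrier (Aut n)" "\<chi> \<in> carrier (Aut n)" "\<psi> h \<in> carrier (Fn m)"
    using assms J_sub_Aut[OF m1(1)] J_sub_maps[OF m1(2,3)] by auto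
  note d = conj_aut_in_Aut[OF m1(3)]
  have "(conj_aut n m g \<otimes>\<^bsub>Aut n\<^esub> \<psi>) \<otimes>\<^bsub>Aut n\<^esub> (conj_aut n m h \<otimes>\<^bsub>Aut n\<^esub> \<chi>) =
      conj_aut n m g \<otimes>\<^bsub>Aut n\<^esub> (\<psi> \<otimes>\<^bsub>Aut n\<^esub> conj_aut n m h) \<otimes>\<^bsub>Aut n\<^esub> \<chi>"
    using assms c d by (simp add: A.m_assoc)
  also have "\<dots> = conj_aut n m g \<otimes>\<^bsub>Aut n\<^esub> (conj_aut n m (\<psi> h) \<otimes>\<^bsub>Aut n\<^esub> \<psi>) \<otimes>\<^bsub>Aut n\<^esub> \<chi>"
    using J_sub_conj[OF m1(3,2) assms(3,2)] by simp
  also have "\<dots> = conj_aut n m (g \<otimes>\<^bsub>Fn n\<^esub> \<psi> h) \<otimes>\<^bsub>Aut n\<^esub> (\<psi> \<otimes>\<^bsub>Aut n\<^esub> \<chi>)"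
    using assms c d conj_aut_mult[OF m1(3) assms(1) c(3)] by (simp add: A.m_assoc)
  finally show ?thesis .
qed

lemma semidirect_subgroup: "subgroup (semidirect n m q) (Aut n)"
proof (rule A.subgroupI)
  note J = J_lc_subgroup[OF m1(1), of q]
  note JJ = subsetD[OF J_lc_subset[OF m1(1)]]
  have c: "g \<in> carrier (Fn m)" "conj_aut n m g \<in> carrier (Aut n)" if "g \<in> lower_central (Fn m) q" for g
    using F.lower_central_carrier[OF that] conj_aut_in_Aut[OF m1(3)] by auto
  have cJ: "\<psi> \<in> J_sub n (m - 1)" "\<psi> \<in> carrier (Aut n)" if "\<psi> \<in> J_lc n (m - 1) q" for \<psi>
    using JJ[OF that] J_sub_Aut[OF m1(1)] by auto
  show "semidirect n m q \<subseteq> carrier (Aut n)"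
    using c cJ by (auto simp: semidirect_def)
  show "semidirect n m q \<noteq> {}"
    using F.lc_closed(3)[of "{1..m}" q] subgroup.one_closed[OF J] by (auto simp: semidirect_def)
  fix a assume "a \<in> semidirect n m q"
  then obtain g \<psi> where a: "a = conj_aut n m g \<otimes>\<^bsub>Aut n\<^esub> \<psi>" "g \<in> lower_central (Fn m) q" "\<psi> \<in> J_lc n (m - 1) q"
    by (auto simp: semidirect_def)
  have \<psi>i: "inv\<^bsub>Aut n\<^esub> \<psi> \<in> J_lc n (m - 1) q"
    using subgroup.m_inv_closed[OF J a(3)] .
  have gi: "inv\<^bsub>Fn n\<^esub> g \<in> lower_central (Fn m) q"
    using F.lc_closed(2)[OF a(2)] Fn_inv_eq[OF m1(3) c(1)[OF a(2)]] by simp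
  have "inv\<^bsub>Aut n\<^esub> a = inv\<^bsub>Aut n\<^esub> \<psi> \<otimes>\<^bsub>Aut n\<^esub> conj_aut n m (inv\<^bsub>Fn n\<^esub> g)"
    using a c cJ by (simp add: A.inv_mult_group conj_aut_inv[OF m1(3)])
  also have "\<dots> = conj_aut n m ((inv\<^bsub>Aut n\<^esub> \<psi>) (inv\<^bsub>Fn n\<^esub> g)) \<otimes>\<^bsub>Aut n\<^esub> inv\<^bsub>Aut n\<^esub> \<psi>"
    by (rule J_sub_conj[OF m1(3,2) cJ(1)[OF \<psi>i] c(1)[OF gi]])
  finally show "inv\<^bsub>Aut n\<^esub> a \<in> semidirect n m q"
    using J_sub_lower_central_maps[OF m1(3,2) cJ(1)[OF \<psi>i] gi] \<psi>i by (auto simp: semidirect_def)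
  fix b assume "b \<in> semidirect n m q"
  then obtain h \<chi> where b: "b = conj_aut n m h \<otimes>\<^bsub>Aut n\<^esub> \<chi>" "h \<in> lower_central (Fn m) q" "\<chi> \<in> J_lc n (m - 1) q"
    by (auto simp: semidirect_def)
  have "\<psi> h \<in> lower_central (Fn m) q"
    by (rule J_sub_lower_central_maps[OF m1(3,2) cJ(1)[OF a(3)] b(2)])
  then have "g \<otimes>\<^bsub>Fn n\<^esub> \<psi> h \<in> lower_central (Fn m) q"
    using F.lc_closed(1)[OF a(2)] Fn_mult_eq[of n m] by simp
  then show "a \<otimes>\<^bsub>Aut n\<^esub> b \<in> semidirect n m q"
    using subgroup.m_closed[OF J a(3) b(3)]
    unfolding a(1) b(1) semidirect_mult[OF c(1)[OF a(2)] c(1)[OF b(2)] cJ(1)[OF a(3)] cJ(1)[OF b(3)]]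
    by (auto simp: semidirect_def)
qed

lemma J_sub_semidirect: "J_sub n m \<subseteq> semidirect n m 1"
proof -
  have one: "\<one>\<^bsub>Fn n\<^esub> \<in> carrier (Fn m)" "conj_aut n m \<one>\<^bsub>Fn n\<^esub> = \<one>\<^bsub>Aut n\<^esub>"
    using F.one_closed Fn_one_eq[of n m] group_hom.hom_one[OF conj_aut_group_hom[OF m1(3)]] by auto
  have oneJ: "\<one>\<^bsub>Aut n\<^esub> \<in> J_sub n (m - 1)"
    using subgroup.one_closed[OF J_sub_subgroup[OF m1(1)]] .
  show ?thesis
  proof (rule J_sub_le[OF m1(3) semidirect_subgroup])
    fix k i assume ki: "2 \<le> k" "k \<le> m" "1 \<le> i" "i \<le> k"
    show "y_aut n k i \<in> semidirect n m 1"
    proof (cases "k = m")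
      case True
      have g: "inv\<^bsub>Fn n\<^esub> gen i \<in> carrier (Fn m)"
        using ki m gen_closed[of i m] Fn_sub_closed[of m n "gen i" "gen i"] by simp
      have "y_aut n k i = conj_aut n m (inv\<^bsub>Fn n\<^esub> gen i) \<otimes>\<^bsub>Aut n\<^esub> \<one>\<^bsub>Aut n\<^esub>"
        using True ki m g conj_aut_in_Aut[OF m1(3)] by (simp add: y_aut_eq_conj_aut)
      then show ?thesis
        using g oneJ by (auto simp: semidirect_def)
    next
      case False
      then have y: "y_aut n k i \<in> J_sub n (m - 1)"
        using ki by (intro y_aut_in_J_sub) auto
      then have "y_aut n k i = conj_aut n m \<one>\<^bsub>Fn n\<^esub> \<otimes>\<^bsub>Aut n\<^esub> y_aut n k i"
        using J_sub_Aut[OF m1(1)] one by simp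
      then show ?thesis
        using y one by (auto simp: semidirect_def
          intro!: exI[of _ "\<one>\<^bsub>Fn n\<^esub>"] exI[of _ "y_aut n k i"])
    qed
  qed
qed

text \<open>\<open>J_sub n (m - 1)\<close> acts trivially on the abelianisation of \<open>Fn m\<close>, so the lower central series
  of the semidirect product is computed factor by factor.\<close>

lemma J_lc_semidirect: "1 \<le> q \<Longrightarrow> J_lc n m q \<subseteq> semidirect n m q"
proof (induction q rule: nat_induct_at_least)
  case base
  show ?case
    using J_sub_semidirect by simp
next
  case (Suc q)
  interpret J: group "(Aut n)\<lparr>carrier := J_sub n m\<rparr>"
    by (rule J_group[OF m1(3)])
  note SJ = J_sub_subgroup[OF m1(3)]
  have "J_lc n m (Suc q) \<subseteq> semidirect n m (Suc q) \<inter> J_sub n m"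
  proof (rule J.lower_central_Suc_le[OF Suc.hyps])
    show "subgroup (semidirect n m (Suc q) \<inter> J_sub n m) ((Aut n)\<lparr>carrier := J_sub n m\<rparr>)"
      by (intro A.subgroup_incl A.subgroups_Inter_pair semidirect_subgroup SJ) auto
    fix a b assume a: "a \<in> J_lc n m q" and b: "b \<in> carrier ((Aut n)\<lparr>carrier := J_sub n m\<rparr>)"
    have abJ: "a \<in> J_sub n m" "b \<in> J_sub n m"
      using a b J_lc_subset[OF m1(3)] by auto
    have comm: "commutator ((Aut n)\<lparr>carrier := J_sub n m\<rparr>) a b = commutator (Aut n) a b"
      by (rule A.commutator_restrict[OF SJ abJ])
    obtain g \<psi> where a': "a = conj_aut n m g \<otimes>\<^bsub>Aut n\<^esub> \<psi>" "g \<in> lower_central (Fn m) q" "\<psi> \<in> J_lc n (m - 1) q"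
      using Suc.IH a by (auto simp: semidirect_def)
    have "b \<in> semidirect n m 1"
      using J_sub_semidirect b by auto
    then obtain h \<chi> where b': "b = conj_aut n m h \<otimes>\<^bsub>Aut n\<^esub> \<chi>" "h \<in> carrier (Fn m)" "\<chi> \<in> J_sub n (m - 1)"
      by (auto simp: semidirect_def)
    have g: "g \<in> carrier (Fn m)"
      using a'(2) F.lower_central_carrier by blast
    have \<psi>: "\<psi> \<in> J_sub n (m - 1)"
      using a'(3) J_lc_subset[OF m1(1)] by auto
    have c: "\<psi> \<in> carrier (Aut n)" "\<chi> \<in> carrier (Aut n)"
      using \<psi> b'(3) J_sub_Aut[OF m1(1)] by auto
    have \<psi>\<chi>: "\<psi> h \<in> carrier (Fn m)" "\<chi> g \<in> carrier (Fn m)"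
      using J_sub_maps[OF m1(2,3)] \<psi> b' g by auto
    \<comment> \<open>The two displacements land in degree q + 1 for opposite reasons: u because g
      has degree q and \<open>\<chi>\<close> degree 1, v because h has degree 1 and
      \<open>\<psi>\<close> degree q.\<close>
    define u where "u = inv\<^bsub>Fn n\<^esub> g \<otimes>\<^bsub>Fn n\<^esub> \<chi> g"
    define v where "v = inv\<^bsub>Fn n\<^esub> h \<otimes>\<^bsub>Fn n\<^esub> \<psi> h"
    have u: "u \<in> lower_central (Fn m) (Suc q)"
    proof -
      have "\<chi> \<in> ia (Fn n) (Suc 1)"
        using subsetD[OF J_sub_ia[OF m1(1)] b'(3)] by (simp add: numeral_2_eq_2 One_nat_def)
      from J_sub_action[OF m1(3,2) b'(3) this a'(2) Suc.hyps] show ?thesis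
        by (simp only: u_def Suc_eq_plus1)
    qed
    have v: "v \<in> lower_central (Fn m) (Suc q)"
      using J_sub_action[OF m1(3,2) \<psi>, of q h 1] J_lc_ia[OF m1(1) Suc.hyps] a'(3) b'(2)
      by (auto simp: v_def Suc_eq_plus1_left)
    note Fc = Fn_mono[OF m1(3)]
    \<comment> \<open>The quotient of the \<open>Fn m\<close> parts of ab and ba; it is the product
      of [g,h] with the two displacements.\<close>
    define z where "z = inv\<^bsub>Fn n\<^esub> (h \<otimes>\<^bsub>Fn n\<^esub> \<chi> g) \<otimes>\<^bsub>Fn n\<^esub> (g \<otimes>\<^bsub>Fn n\<^esub> \<psi> h)"
    have z_eq: "z = inv\<^bsub>Fn n\<^esub> u \<otimes>\<^bsub>Fn n\<^esub> commutator (Fn n) g h \<otimes>\<^bsub>Fn n\<^esub> v"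
      using Fc[OF g] Fc[OF b'(2)] Fc[OF \<psi>\<chi>(1)] Fc[OF \<psi>\<chi>(2)]
      by (simp add: z_def u_def v_def F.word_simps)
    have "commutator (Fn n) g h = commutator (Fn m) g h"
      using g b'(2) Fn_inv_eq[OF m1(3)] by (simp add: commutator_def Fn_mult_eq[of n m])
    moreover have "commutator (Fn m) g h \<in> lower_central (Fn m) (Suc q)"
      by (rule F.commutator_lower_central_Suc[OF a'(2) b'(2) Suc.hyps])
    moreover have "inv\<^bsub>Fn n\<^esub> u = inv\<^bsub>Fn m\<^esub> u"
      using Fn_inv_eq[OF m1(3)] F.lower_central_carrier[OF u] by simp
    ultimately have z: "z \<in> lower_central (Fn m) (Suc q)"
      unfolding z_eq using u v by (simp add: Fn_mult_eq[of n m] F.lc_closed)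
    \<comment> \<open>Moving this factor to the right past the conjugation by z leaves the
      commutator of \<open>\<psi>\<close> and \<open>\<chi>\<close> as the second component.\<close>
    define \<theta> where "\<theta> = inv\<^bsub>Aut n\<^esub> (\<chi> \<otimes>\<^bsub>Aut n\<^esub> \<psi>)"
    have \<theta>: "\<theta> \<in> J_sub n (m - 1)"
      using subgroup.m_closed[OF J_sub_subgroup[OF m1(1)]] subgroup.m_inv_closed[OF J_sub_subgroup[OF m1(1)]]
        \<psi> b'(3) by (simp add: \<theta>_def)
    have \<theta>c: "\<theta> \<in> carrier (Aut n)"
      using J_sub_Aut[OF m1(1) \<theta>] .
    have zc: "z \<in> carrier (Fn m)"
      using F.lower_central_carrier[OF z] .
    have hg: "h \<otimes>\<^bsub>Fn n\<^esub> \<chi> g \<in> carrier (Fn m)" "g \<otimes>\<^bsub>Fn n\<^esub> \<psi> h \<in> carrier (Fn m)"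
      using Fn_sub_closed[OF m1(3)] g b'(2) \<psi>\<chi> by auto
    have hgi: "inv\<^bsub>Fn n\<^esub> (h \<otimes>\<^bsub>Fn n\<^esub> \<chi> g) \<in> carrier (Fn m)"
      using Fn_sub_closed[OF m1(3) hg(1) hg(1)] by simp
    note D = conj_aut_in_Aut[OF m1(3)]
    have "commutator (Aut n) a b = inv\<^bsub>Aut n\<^esub> (b \<otimes>\<^bsub>Aut n\<^esub> a) \<otimes>\<^bsub>Aut n\<^esub> (a \<otimes>\<^bsub>Aut n\<^esub> b)"
      using abJ J_sub_Aut[OF m1(3)] by (simp add: A.word_simps)
    also have "\<dots> = inv\<^bsub>Aut n\<^esub> (conj_aut n m (h \<otimes>\<^bsub>Fn n\<^esub> \<chi> g) \<otimes>\<^bsub>Aut n\<^esub> (\<chi> \<otimes>\<^bsub>Aut n\<^esub> \<psi>)) \<otimes>\<^bsub>Aut n\<^esub>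
        (conj_aut n m (g \<otimes>\<^bsub>Fn n\<^esub> \<psi> h) \<otimes>\<^bsub>Aut n\<^esub> (\<psi> \<otimes>\<^bsub>Aut n\<^esub> \<chi>))"
      unfolding a'(1) b'(1) using semidirect_mult g b'(2,3) \<psi> by simp
    also have "\<dots> = \<theta> \<otimes>\<^bsub>Aut n\<^esub> (conj_aut n m (inv\<^bsub>Fn n\<^esub> (h \<otimes>\<^bsub>Fn n\<^esub> \<chi> g)) \<otimes>\<^bsub>Aut n\<^esub> conj_aut n m (g \<otimes>\<^bsub>Fn n\<^esub> \<psi> h)) \<otimes>\<^bsub>Aut n\<^esub> (\<psi> \<otimes>\<^bsub>Aut n\<^esub> \<chi>)"
      unfolding \<theta>_def conj_aut_inv[OF m1(3) hg(1)] using c D[OF hg(1)] D[OF hg(2)]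
      by (simp add: A.m_assoc A.inv_mult_group[of "conj_aut n m (h \<otimes>\<^bsub>Fn n\<^esub> \<chi> g)"])
    also have "conj_aut n m (inv\<^bsub>Fn n\<^esub> (h \<otimes>\<^bsub>Fn n\<^esub> \<chi> g)) \<otimes>\<^bsub>Aut n\<^esub> conj_aut n m (g \<otimes>\<^bsub>Fn n\<^esub> \<psi> h) = conj_aut n m z"
      unfolding z_def by (rule conj_aut_mult[OF m1(3) hgi hg(2), symmetric])
    also have "\<theta> \<otimes>\<^bsub>Aut n\<^esub> conj_aut n m z = conj_aut n m (\<theta> z) \<otimes>\<^bsub>Aut n\<^esub> \<theta>"
      by (rule J_sub_conj[OF m1(3,2) \<theta> zc])
    also have "conj_aut n m (\<theta> z) \<otimes>\<^bsub>Aut n\<^esub> \<theta> \<otimes>\<^bsub>Aut n\<^esub> (\<psi> \<otimes>\<^bsub>Aut n\<^esub> \<chi>) =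
        conj_aut n m (\<theta> z) \<otimes>\<^bsub>Aut n\<^esub> commutator (Aut n) \<psi> \<chi>"
      using c \<theta>c D[OF J_sub_maps[OF m1(2,3) \<theta> zc]] by (simp add: A.m_assoc \<theta>_def A.word_simps)
    finally have eq: "commutator (Aut n) a b = conj_aut n m (\<theta> z) \<otimes>\<^bsub>Aut n\<^esub> commutator (Aut n) \<psi> \<chi>" .
    have "commutator ((Aut n)\<lparr>carrier := J_sub n (m - 1)\<rparr>) \<psi> \<chi> \<in> J_lc n (m - 1) (Suc q)"
      using group.commutator_lower_central_Suc[OF J_group[OF m1(1)] a'(3) _ Suc.hyps] b'(3) by simp
    then have "commutator (Aut n) \<psi> \<chi> \<in> J_lc n (m - 1) (Suc q)"
      using A.commutator_restrict[OF J_sub_subgroup[OF m1(1)] \<psi> b'(3)] by simp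
    moreover have "\<theta> z \<in> lower_central (Fn m) (Suc q)"
      by (rule J_sub_lower_central_maps[OF m1(3,2) \<theta> z])
    ultimately have "commutator (Aut n) a b \<in> semidirect n m (Suc q)"
      unfolding semidirect_def eq by blast
    moreover have "commutator (Aut n) a b \<in> J_sub n m"
      using J.commutator_closed[of a b] abJ comm by simp
    ultimately show "commutator ((Aut n)\<lparr>carrier := J_sub n m\<rparr>) a b \<in> semidirect n m (Suc q) \<inter> J_sub n m"
      by (simp add: comm)
  qed
  then show ?case by blast
qed

end

section \<open>Centralisers of generators in the graded Lie ring\<close>

text \<open>On the q-th lower central term, coefficients in degree q are additive. This allows the
  coefficient statements below to be checked on generators only.\<close>

lemma coeff_zero_subgroup:
  assumes q: "1 \<le> q" "length u = q"
  shows "subgroup {g \<in> lower_central (free_group S) q. coeff (magnus g) u = 0} (free_group S)"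
    (is "subgroup ?K _")
proof (rule F.subgroupI)
  have c: "g \<in> carrier (free_group S)" "deg_ge q (magnus g - 1)" if "g \<in> ?K" for g
    using that F.lower_central_carrier[of g S q] magnus_lower_central[of g S q] by auto
  show "?K \<subseteq> carrier (free_group S)"
    using c by blast
  have "\<one>\<^bsub>free_group S\<^esub> \<in> ?K"
    using F.lc_closed(3) q by auto
  then show "?K \<noteq> {}"
    by blast
  fix a assume a: "a \<in> ?K"
  show "inv\<^bsub>free_group S\<^esub> a \<in> ?K"
    using a coeff_magnus_inv[OF c[OF a] q(2,1)] F.lc_closed(2)[of a S q] by (simp del: magnus.hom_inv)
  fix b assume b: "b \<in> ?K"
  show "a \<otimes>\<^bsub>free_group S\<^esub> b \<in> ?K"
    using a b coeff_magnus_mult[OF c(1)[OF a] c(1)[OF b] c(2)[OF a] c(2)[OF b] q(2,1)]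
      F.lc_closed(1)[of a S q b] by (simp del: magnus.hom_mult)
qed

text \<open>Only one variable is visible on such a word, and series in one variable commute; so the
  coefficient of every commutator vanishes there from degree 2 on.\<close>

lemma coeff_magnus_replicate:
  assumes "2 \<le> q" "g \<in> lower_central (free_group S) q"
  shows "coeff (magnus g) (replicate q k) = 0"
proof -
  obtain p where p: "q = Suc p" "1 \<le> p"
    using assms(1) by (cases q) auto
  let ?K = "{g \<in> lower_central (free_group S) q. coeff (magnus g) (replicate q k) = 0}"
  have q: "1 \<le> q"
    using assms(1) by simp
  note c = F.lower_central_carrier magnus_lower_central
  have "lower_central (free_group S) q \<subseteq> ?K"
    unfolding p(1)
  proof (rule F.lower_central_Suc_le[OF p(2)], fold p(1))
    show "subgroup ?K (free_group S)"
      by (rule coeff_zero_subgroup) (use q in auto)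
    fix a b assume ab: "a \<in> lower_central (free_group S) p" "b \<in> carrier (free_group S)"
    have "coeff (magnus (commutator (free_group S) a b)) (replicate q k) =
        coeff (magnus a) (take p (replicate q k)) * coeff (magnus b) (drop p (replicate q k)) -
        coeff (magnus b) (take 1 (replicate q k)) * coeff (magnus a) (drop 1 (replicate q k))"
      using ab c p deg_ge_magnus by (intro coeff_magnus_commutator) auto
    moreover have "take p (replicate q k) = replicate p k" "drop p (replicate q k) = replicate (Suc 0) k"
        "take 1 (replicate q k) = replicate (Suc 0) k" "drop 1 (replicate q k) = replicate p k"
      by (simp_all add: p(1) One_nat_def take_replicate min_def del: replicate.simps)
    ultimately show "commutator (free_group S) a b \<in> ?K"
      using F.commutator_lower_central_Suc[OF ab p(2)] p(1) by simp
  qed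
  then show ?thesis
    using assms(2) by auto
qed

text \<open>A variable outside S never occurs. Only the two degrees needed for the case q = 1 of the
  main argument are treated, each where its coefficients are additive.\<close>

lemma coeff_magnus_foreign:
  assumes "k \<notin> S"
  shows "w \<in> carrier (free_group S) \<Longrightarrow> coeff (magnus w) [k] = 0"
    and "w \<in> lower_central (free_group S) 2 \<Longrightarrow> coeff (magnus w) [k, l] = 0"
proof -
  have one: "coeff (magnus w) [k] = 0" if "w \<in> carrier (free_group S)" for w
  proof -
    let ?K = "{w \<in> carrier (free_group S). coeff (magnus w) [k] = 0}"
    have "subgroup ?K (free_group S)"
      using coeff_zero_subgroup[of 1 "[k]" S] by (simp add: One_nat_def)
    moreover have "gen j \<in> ?K" if "j \<in> S" for j
      using that assms gen_in_free_group[OF that] by (auto simp: magnus_gen)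
    ultimately show ?thesis
      using free_group_generated[of ?K S w] that by auto
  qed
  then show "w \<in> carrier (free_group S) \<Longrightarrow> coeff (magnus w) [k] = 0" .
  let ?K = "{w \<in> lower_central (free_group S) (Suc 1). coeff (magnus w) [k, l] = 0}"
  note c = F.lower_central_carrier magnus_lower_central
  have "lower_central (free_group S) (Suc 1) \<subseteq> ?K"
  proof (rule F.lower_central_Suc_le)
    show "subgroup ?K (free_group S)"
      by (rule coeff_zero_subgroup) (simp_all add: One_nat_def)
    fix a b assume ab: "a \<in> lower_central (free_group S) 1" "b \<in> carrier (free_group S)"
    have "coeff (magnus (commutator (free_group S) a b)) [k, l] =
        coeff (magnus a) (take 1 [k, l]) * coeff (magnus b) (drop 1 [k, l]) -
        coeff (magnus b) (take 1 [k, l]) * coeff (magnus a) (drop 1 [k, l])"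
      using ab deg_ge_magnus by (intro coeff_magnus_commutator) auto
    then show "commutator (free_group S) a b \<in> ?K"
      using F.commutator_lower_central_Suc[OF ab] one[of a] one[of b] ab by (simp add: One_nat_def)
  qed simp
  then show "w \<in> lower_central (free_group S) 2 \<Longrightarrow> coeff (magnus w) [k, l] = 0"
    by (auto simp: numeral_2_eq_2 One_nat_def)
qed

text \<open>The hypothesis makes the degree q part of the series of g commute with x_k. Comparing
  coefficients rotates words, and a word other than a power of x_k is rotated until the comparison
  gives 0.\<close>

lemma conj_gen_coeff:
  assumes g: "g \<in> carrier (free_group S)" and k: "k \<in> S"
    and conj: "inv\<^bsub>free_group S\<^esub> gen k \<otimes>\<^bsub>free_group S\<^esub>
      (g \<otimes>\<^bsub>free_group S\<^esub> gen k \<otimes>\<^bsub>free_group S\<^esub> inv\<^bsub>free_group S\<^esub> g) \<in> lower_central (free_group S) (Suc (Suc q))"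
    and v: "length v = q" "v \<noteq> replicate q k" "1 \<le> q"
  shows "coeff (magnus g) v = 0"
proof -
  let ?f = "magnus g"
  define c where "c = inv\<^bsub>free_group S\<^esub> gen k \<otimes>\<^bsub>free_group S\<^esub>
      (g \<otimes>\<^bsub>free_group S\<^esub> gen k \<otimes>\<^bsub>free_group S\<^esub> inv\<^bsub>free_group S\<^esub> g)"
  note gk = gen_in_free_group[OF k]
  have cc: "c \<in> carrier (free_group S)" "deg_ge (Suc (Suc q)) (magnus c - 1)"
    using conj magnus_lower_central[OF conj] F.lower_central_carrier[OF conj] by (auto simp: c_def)
  have "g \<otimes>\<^bsub>free_group S\<^esub> gen k = gen k \<otimes>\<^bsub>free_group S\<^esub> c \<otimes>\<^bsub>free_group S\<^esub> g"
    using g gk by (simp add: c_def F.m_assoc)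
  then have "magnus (g \<otimes>\<^bsub>free_group S\<^esub> gen k) = magnus (gen k \<otimes>\<^bsub>free_group S\<^esub> c \<otimes>\<^bsub>free_group S\<^esub> g)"
    by simp
  then have "?f * (1 + Var k) = (1 + Var k) * magnus c * ?f"
    using g gk cc by (simp add: magnus_mult magnus_gen)
  then have eq: "?f * Var k = Var k * ?f + (1 + Var k) * ((magnus c - 1) * ?f)"
    by (simp add: algebra_simps)
  have "deg_ge (Suc (Suc q)) ((1 + Var k) * ((magnus c - 1) * ?f))"
    using cc by (intro deg_ge_mult_left deg_ge_mult_right)
  then have coeff_eq: "coeff (?f * Var k) u = coeff (Var k * ?f) u" if "length u = Suc q" for u
    unfolding eq using that by (auto simp: deg_ge_def)
  \<comment> \<open>The coefficients of f x_k and x_k f at the same word u of length q + 1.\<close>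
  have swap: "(if last u = k then coeff ?f (butlast u) else 0) = (if hd u = k then coeff ?f (tl u) else 0)"
    if "length u = Suc q" for u
    using coeff_eq[OF that] that by (cases u) (auto simp: coeff_mult_Var coeff_Var_mult split: if_splits)
  \<comment> \<open>Each leading k is moved to the end; once a different letter leads, one side of
    \<open>swap\<close> is 0 by definition.\<close>
  have *: "coeff ?f (replicate j k @ a # w) = 0" if "a \<noteq> k" "length (replicate j k @ a # w) = q" for j a w
    using that
  proof (induction j arbitrary: w)
    case 0
    then show ?case
      using swap[of "a # w @ [k]"] by simp
  next
    case (Suc j)
    then have "coeff ?f (replicate j k @ a # w @ [k]) = 0"
      using Suc.IH[of "w @ [k]"] by simp
    then show ?case
      using swap[of "k # replicate j k @ a # w @ [k]"] Suc.prems by (simp add: butlast_append)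
  qed
  have "\<exists>j a w. v = replicate j k @ a # w \<and> a \<noteq> k"
    using v(1,2)
  proof (induction v arbitrary: q)
    case (Cons b v)
    show ?case
    proof (cases "b = k")
      case True
      then have "v \<noteq> replicate (length v) k"
        using Cons.prems by auto
      then obtain j a w where "v = replicate j k @ a # w" "a \<noteq> k"
        using Cons.IH[OF refl] by blast
      then show ?thesis
        using True by (intro exI[of _ "Suc j"]) auto
    qed (auto intro: exI[of _ 0])
  qed auto
  then show ?thesis
    using * v(1) by blast
qed

text \<open>In degree 1 the coefficient of \<open>gen m\<close> is not visible on \<open>gen m\<close> itself; it is read off the
  image of \<open>gen 1\<close>.\<close>

lemma J_lc_ia_conj_part:
  assumes m: "2 \<le> m" "m \<le> n" and q: "1 \<le> q"
    and g: "g \<in> lower_central (Fn m) q" and \<psi>: "\<psi> \<in> J_sub n (m - 1)"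
    and ia: "conj_aut n m g \<otimes>\<^bsub>Aut n\<^esub> \<psi> \<in> ia (Fn n) (Suc (Suc q))"
  shows "g \<in> lower_central (Fn m) (Suc q)"
proof (rule magnus_witt[OF _ q g])
  have m1: "m - 1 \<le> n" "m - 1 \<le> m" "m \<le> n" "m - 1 < m"
    using m by auto
  have gm: "g \<in> carrier (Fn m)"
    using F.lower_central_carrier[OF g] .
  have gn: "g \<in> carrier (Fn n)"
    using Fn_mono[OF m(2) gm] .
  have c: "conj_aut n m g \<in> carrier (Aut n)" "\<psi> \<in> carrier (Aut n)"
    using conj_aut_in_Aut[OF m(2) gm] J_sub_Aut[OF m1(1) \<psi>] by auto
  \<comment> \<open>\<open>\<psi>\<close> fixes \<open>gen m\<close>, so on this generator the
    composite is conjugation by g alone.\<close>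
  have off: "coeff (magnus g) v = 0" if "length v = q" "v \<noteq> replicate q m" for v
  proof (rule conj_gen_coeff[OF gn _ _ that q])
    show "m \<in> {1..n}"
      using m by auto
    have gk: "gen m \<in> carrier (Fn n)"
      using m by (intro gen_closed) auto
    have "(conj_aut n m g \<otimes>\<^bsub>Aut n\<^esub> \<psi>) (gen m) = g \<otimes>\<^bsub>Fn n\<^esub> gen m \<otimes>\<^bsub>Fn n\<^esub> inv\<^bsub>Fn n\<^esub> g"
      using m gm c gk J_sub_fix[OF m1(4) m(2) \<psi>] by (simp add: aut_mult_apply conj_aut_gen)
    then show "inv\<^bsub>Fn n\<^esub> gen m \<otimes>\<^bsub>Fn n\<^esub> (g \<otimes>\<^bsub>Fn n\<^esub> gen m \<otimes>\<^bsub>Fn n\<^esub> inv\<^bsub>Fn n\<^esub> g) \<in> lower_central (Fn n) (Suc (Suc q))"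
      using F.iaD(2)[OF ia gk] by simp
  qed
  have "coeff (magnus g) (replicate q m) = 0"
  proof (cases "q = 1")
    case False
    then show ?thesis
      using q g by (intro coeff_magnus_replicate) auto
  next
    case True
    \<comment> \<open>For q = 1 the image of \<open>gen 1\<close> is g p g^{-1}, where p lies in
      \<open>Fn (m - 1)\<close> and is congruent to \<open>gen 1\<close> modulo commutators.\<close>
    define p where "p = \<psi> (gen 1)"
    have g1: "gen 1 \<in> carrier (Fn (m - 1))" "gen 1 \<in> carrier (Fn n)" "gen 1 \<in> carrier (Fn m)"
      using m by (auto intro!: gen_closed)
    have pm: "p \<in> carrier (Fn m)" "p \<in> carrier (Fn (m - 1))"
      using J_sub_maps[OF m1(2,3) \<psi> g1(3)] J_sub_maps[OF order_refl m1(1) \<psi> g1(1)] by (auto simp: p_def)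
    have pn: "p \<in> carrier (Fn n)"
      using Fn_mono[OF m(2) pm(1)] .
    define d where "d = inv\<^bsub>Fn n\<^esub> gen 1 \<otimes>\<^bsub>Fn n\<^esub> p"
    have \<psi>2: "\<psi> \<in> ia (Fn n) (Suc 1)"
      using subsetD[OF J_sub_ia[OF m1(1)] \<psi>] by (simp add: numeral_2_eq_2 One_nat_def)
    have "gen 1 \<in> lower_central (Fn (m - 1)) 1"
      using g1 by simp
    from J_sub_action[OF m1(1) order_refl \<psi> \<psi>2 this]
    have d: "d \<in> lower_central (Fn (m - 1)) 2"
      by (simp add: d_def p_def numeral_2_eq_2 One_nat_def)
    have dc: "d \<in> carrier (Fn n)"
      using g1 pn by (simp add: d_def)
    have "p = gen 1 \<otimes>\<^bsub>Fn n\<^esub> d"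
      using g1 pn by (simp add: d_def)
    then have mp: "magnus p = magnus d + Var 1 * magnus d"
      using g1 dc by (simp add: magnus_mult magnus_gen distrib_right)
    have d0: "coeff (magnus d) [] = 1" "coeff (magnus d) [1] = 0" "coeff (magnus d) [m, 1] = 0"
      using coeff_magnus_Nil magnus_lower_central[OF d] coeff_magnus_foreign(2)[OF _ d, of m 1] m
      by (auto simp: deg_ge_def dest!: spec[of _ "[1]"])
    have p0: "coeff (magnus p) [] = 1" "coeff (magnus p) [1] = 1" "coeff (magnus p) [m, 1] = 0"
      unfolding mp using d0 m by (auto simp: coeff_Var_mult)
    define c where "c = inv\<^bsub>Fn n\<^esub> gen 1 \<otimes>\<^bsub>Fn n\<^esub> (conj_aut n m g \<otimes>\<^bsub>Aut n\<^esub> \<psi>) (gen 1)"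
    have apply1: "(conj_aut n m g \<otimes>\<^bsub>Aut n\<^esub> \<psi>) (gen 1) = g \<otimes>\<^bsub>Fn n\<^esub> p \<otimes>\<^bsub>Fn n\<^esub> inv\<^bsub>Fn n\<^esub> g"
      using conj_aut_apply[OF m(2) gm pm(1)] \<open>conj_aut n m g \<in> carrier (Aut n)\<close> \<open>\<psi> \<in> carrier (Aut n)\<close> g1
      by (simp add: aut_mult_apply p_def)
    have c: "c \<in> carrier (Fn n)" "deg_ge 3 (magnus c - 1)"
      using F.iaD(2)[OF ia g1(2)] magnus_lower_central[of c "{1..n}" 3] F.lower_central_carrier[of c "{1..n}" 3]
      by (auto simp: c_def True numeral_3_eq_3 One_nat_def)
    have "g \<otimes>\<^bsub>Fn n\<^esub> p = gen 1 \<otimes>\<^bsub>Fn n\<^esub> c \<otimes>\<^bsub>Fn n\<^esub> g"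
      using g1 gn pn by (simp add: c_def apply1 F.m_assoc)
    then have "magnus (g \<otimes>\<^bsub>Fn n\<^esub> p) = magnus (gen 1 \<otimes>\<^bsub>Fn n\<^esub> c \<otimes>\<^bsub>Fn n\<^esub> g)"
      by simp
    then have "magnus g * magnus p = (1 + Var 1) * magnus c * magnus g"
      using g1 gn pn c by (simp add: magnus_mult magnus_gen)
    also have "\<dots> = magnus g + Var 1 * magnus g + (1 + Var 1) * ((magnus c - 1) * magnus g)"
      by (simp add: algebra_simps)
    finally have eq: "magnus g * magnus p = magnus g + Var 1 * magnus g + (1 + Var 1) * ((magnus c - 1) * magnus g)" .
    have "deg_ge 3 ((1 + Var 1) * ((magnus c - 1) * magnus g))"
      using c by (intro deg_ge_mult_left deg_ge_mult_right)
    \<comment> \<open>The word [m, 1] isolates the unknown: on the left it picks up the coefficient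
      of g at [m] times that of p at [1], which is 1, while on the right the factor of variable 1
      stands in the wrong place, since m is not 1.\<close>
    then have "coeff (magnus g * magnus p) [m, 1] = coeff (magnus g) [m, 1]"
      unfolding eq using m by (auto simp: deg_ge_def coeff_Var_mult)
    moreover have "coeff (magnus g * magnus p) [m, 1] =
        coeff (magnus g) [] * coeff (magnus p) [m, 1] + coeff (magnus g) [m] * coeff (magnus p) [1] +
        coeff (magnus g) [m, 1] * coeff (magnus p) []"
      by (simp add: times_ncps_def)
    ultimately have "coeff (magnus g) [m] = 0"
      using p0 by simp
    then show ?thesis
      by (simp add: True One_nat_def)
  qed
  then show "coeff (magnus g) v = 0" if "length v = q" for v
    using off[OF that] by (cases "v = replicate q m") auto
qed simp

lemma J_lc_Int_ia:
  "1 \<le> m \<Longrightarrow> m \<le> n \<Longrightarrow> 1 \<le> q \<Longrightarrow> \<phi> \<in> J_lc n m q \<Longrightarrow> \<phi> \<in> ia (Fn n) (Suc (Suc q)) \<Longrightarrow>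
    \<phi> \<in> J_lc n m (Suc q)"
proof (induction m arbitrary: \<phi> rule: nat_induct_at_least)
  case base
  then have "\<phi> = \<one>\<^bsub>Aut n\<^esub>"
    using J_lc_subset[of 1 n q] J_sub_1 by auto
  then show ?case
    using subgroup.one_closed[OF J_lc_subgroup[of 1 n "Suc q"]] base by simp
next
  case (Suc m)
  let ?m = "Suc m"
  have m: "2 \<le> ?m" "?m \<le> n" "m \<le> n" "m \<le> ?m" "?m - 1 = m"
    using Suc by auto
  obtain g \<psi> where \<phi>: "\<phi> = conj_aut n ?m g \<otimes>\<^bsub>Aut n\<^esub> \<psi>" "g \<in> lower_central (Fn ?m) q" "\<psi> \<in> J_lc n m q"
    using subsetD[OF J_lc_semidirect[OF m(1,2) Suc.prems(2)] Suc.prems(3)] m(5)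
    by (auto simp: semidirect_def)
  have \<psi>J: "\<psi> \<in> J_sub n m"
    using \<phi>(3) J_lc_subset[OF m(3)] by auto
  have "g \<in> lower_central (Fn ?m) (Suc q)"
    using J_lc_ia_conj_part[OF m(1,2) Suc.prems(2) \<phi>(2), of \<psi>] \<psi>J Suc.prems(4) m(5) \<phi>(1) by simp
  then have d: "conj_aut n ?m g \<in> J_lc n ?m (Suc q)"
    by (rule conj_aut_lower_central[OF m(1,2)])
  \<comment> \<open>The conjugation part, now known to lie one step deeper, can be divided off; this
    leaves \<open>\<psi>\<close> in the same Johnson term, ready for the induction
    hypothesis.\<close>
  then have d_ia: "conj_aut n ?m g \<in> ia (Fn n) (Suc (Suc q))"
    using J_lc_ia[OF m(2), of "Suc q"] by auto
  note N = normal_imp_subgroup[OF F.ia_normal[of "{1..n}" "Suc (Suc q)"]]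
  have c: "conj_aut n ?m g \<in> carrier (Aut n)" "\<psi> \<in> carrier (Aut n)"
    using subgroup.mem_carrier[OF N d_ia] J_sub_Aut[OF m(3) \<psi>J] by auto
  have "\<psi> = inv\<^bsub>Aut n\<^esub> conj_aut n ?m g \<otimes>\<^bsub>Aut n\<^esub> \<phi>"
    using c by (simp add: \<phi>(1))
  then have "\<psi> \<in> ia (Fn n) (Suc (Suc q))"
    using subgroup.m_closed[OF N subgroup.m_inv_closed[OF N d_ia] Suc.prems(4)] by simp
  then have "\<psi> \<in> J_lc n m (Suc q)"
    using Suc.IH[OF m(3) Suc.prems(2) \<phi>(3)] by simp
  then have "\<psi> \<in> J_lc n ?m (Suc q)"
    by (rule J_lc_mono[OF m(4,2)])
  then show ?case
    unfolding \<phi>(1) by (rule subgroup.m_closed[OF J_lc_subgroup[OF m(2)] d])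
qed

section \<open>Assembly of the graded isomorphism\<close>

theorem theorem4:
  fixes n :: nat
  assumes "n \<ge> 2"
  shows "\<exists>\<zeta> \<in> lie_iso (gr ((Aut n)\<lparr>carrier := I_sub n\<rparr>)) (L1 n (I_sub n)).
    \<forall>i j. 2 \<le> i \<and> i \<le> n \<and> 1 \<le> j \<and> j \<le> i \<longrightarrow>
      \<zeta> (homogeneous (lower_central ((Aut n)\<lparr>carrier := I_sub n\<rparr>)) 1
            (lower_central ((Aut n)\<lparr>carrier := I_sub n\<rparr>) 2 #>\<^bsub>Aut n\<^esub> y_aut n i j))
        = homogeneous (Johnson_filtration n) 1 (IA n 3 #>\<^bsub>Aut n\<^esub> y_aut n i j)"
proof -
  let ?G = "Aut n" and ?H = "I_sub n"
  let ?N = "lower_central (?G\<lparr>carrier := ?H\<rparr>)"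
  let ?M = "Johnson_filtration n"
  have M_eq: "?M q = ia (Fn n) (Suc q)" for q
    by (simp add: Johnson_filtration_def IA_eq_ia)
  then have M_fun: "?M = (\<lambda>q. ia (Fn n) (Suc q))"
    by auto
  have M: "filtration ?G ?M"
    unfolding M_fun by (rule F.ia_filtration)
  interpret M: filtration ?G ?M by (rule M)
  have H: "subgroup ?H ?G"
    unfolding I_sub_eq by (rule J_sub_subgroup) simp
  have N: "filtration (?G\<lparr>carrier := ?H\<rparr>) ?N"
    unfolding I_sub_eq by (rule group.lower_central_filtration[OF J_group]) simp
  have sub: "?N q \<subseteq> ?M q" if "1 \<le> q" for q
    unfolding I_sub_eq M_eq by (rule J_lc_ia) (use that in auto)
  have inter: "?N q \<inter> ?M (Suc q) \<subseteq> ?N (Suc q)" if "1 \<le> q" for q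
    unfolding I_sub_eq M_eq using J_lc_Int_ia[of n n q] that assms by auto
  define \<zeta> where "\<zeta> = (\<lambda>f. \<lambda>q\<in>{1::nat..}. ?M (Suc q) <#>\<^bsub>?G\<^esub> f q)"
  \<comment> \<open>Multiplying by the Johnson term absorbs K, so the lower central coset of a
    becomes its Johnson coset.\<close>
  have abs: "?M (Suc q) <#>\<^bsub>?G\<^esub> (K #>\<^bsub>?G\<^esub> a) = ?M (Suc q) #>\<^bsub>?G\<^esub> a"
    if "\<one>\<^bsub>?G\<^esub> \<in> K" "K \<subseteq> ?M (Suc q)" "a \<in> carrier ?G" for q K a
  proof -
    have Mc: "?M (Suc q) \<subseteq> carrier ?G" and Ms: "subgroup (?M (Suc q)) ?G"
      using M.mem_carrier[of "Suc q"] M.sub[of "Suc q"] by auto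
    have "?M (Suc q) <#>\<^bsub>?G\<^esub> K = ?M (Suc q)"
    proof (intro equalityI subsetI)
      show "x \<in> ?M (Suc q)" if "x \<in> ?M (Suc q) <#>\<^bsub>?G\<^esub> K" for x
        using that \<open>K \<subseteq> ?M (Suc q)\<close> subgroup.m_closed[OF Ms] by (auto simp: set_mult_def)
      show "x \<in> ?M (Suc q) <#>\<^bsub>?G\<^esub> K" if "x \<in> ?M (Suc q)" for x
        using that Mc \<open>\<one>\<^bsub>?G\<^esub> \<in> K\<close> unfolding set_mult_def by force
    qed
    then show ?thesis
      using A.setmult_rcos_assoc[OF Mc, of K a] Mc that by auto
  qed
  \<comment> \<open>The factor \<open>IA n (q + 2)\<close> in the definition of
    \<open>L1_piece\<close> adds no cosets, so representatives may be taken in the lower central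
    term.\<close>
  have piece: "L1_piece n ?H q = (\<lambda>a. ?M (Suc q) #>\<^bsub>?G\<^esub> a) ` ?N q" if q: "1 \<le> q" for q
  proof -
    note Ms = M.sub[of "Suc q", simplified]
    have "IA n (q + 2) = ?M (Suc q)"
      by (simp add: Johnson_filtration_def)
    then have "L1_piece n ?H q = (\<lambda>a. ?M (Suc q) #>\<^bsub>?G\<^esub> a) ` (?N q <#>\<^bsub>?G\<^esub> ?M (Suc q))"
      by (simp add: L1_piece_def carrier_FactGroup)
    also have "\<dots> = (\<lambda>a. ?M (Suc q) #>\<^bsub>?G\<^esub> a) ` ?N q"
    proof (intro equalityI subsetI)
      fix A assume "A \<in> (\<lambda>a. ?M (Suc q) #>\<^bsub>?G\<^esub> a) ` (?N q <#>\<^bsub>?G\<^esub> ?M (Suc q))"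
      then obtain a x where ax: "A = ?M (Suc q) #>\<^bsub>?G\<^esub> (a \<otimes>\<^bsub>?G\<^esub> x)" "a \<in> ?N q" "x \<in> ?M (Suc q)"
        by (auto simp: set_mult_def)
      have c: "a \<in> carrier ?G" "x \<in> carrier ?G"
        using ax sub[OF q] M.mem_carrier[OF q] M.mem_carrier[of "Suc q"] by auto
      have "a \<otimes>\<^bsub>?G\<^esub> x \<otimes>\<^bsub>?G\<^esub> inv\<^bsub>?G\<^esub> a \<in> ?M (Suc q)"
        using c ax(3) normal.inv_op_closed2[OF M.normal[of "Suc q"]] by simp
      then have "A = ?M (Suc q) #>\<^bsub>?G\<^esub> a"
        unfolding ax(1) using c by (subst M.rcos_eq) auto
      then show "A \<in> (\<lambda>a. ?M (Suc q) #>\<^bsub>?G\<^esub> a) ` ?N q"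
        using ax(2) by blast
    next
      fix A assume "A \<in> (\<lambda>a. ?M (Suc q) #>\<^bsub>?G\<^esub> a) ` ?N q"
      then obtain a where a: "A = ?M (Suc q) #>\<^bsub>?G\<^esub> a" "a \<in> ?N q"
        by auto
      then have "a \<in> carrier ?G"
        using sub[OF q] M.mem_carrier[OF q] by auto
      then have "a \<in> ?N q <#>\<^bsub>?G\<^esub> ?M (Suc q)"
        using a(2) subgroup.one_closed[OF Ms] unfolding set_mult_def by force
      then show "A \<in> (\<lambda>a. ?M (Suc q) #>\<^bsub>?G\<^esub> a) ` (?N q <#>\<^bsub>?G\<^esub> ?M (Suc q))"
        using a(1) by blast
    qed
    finally show ?thesis .
  qed
  have "L1 n ?H = (filtration_lie ?G ?M)\<lparr>carrier := {f \<in> carrier (filtration_lie ?G ?M).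
      \<forall>q\<ge>1. f q \<in> (\<lambda>a. ?M (Suc q) #>\<^bsub>?G\<^esub> a) ` ?N q}\<rparr>"
    unfolding L1_def Johnson_lie_def using piece by (auto cong: conj_cong)
  then have "\<zeta> \<in> lie_iso (gr (?G\<lparr>carrier := ?H\<rparr>)) (L1 n ?H)"
    using filtration_lie_embedding[OF M H N sub inter] by (simp add: gr_def \<zeta>_def)
  moreover have "\<zeta> (homogeneous ?N 1 (?N 2 #>\<^bsub>?G\<^esub> y_aut n i j)) =
      homogeneous ?M 1 (IA n 3 #>\<^bsub>?G\<^esub> y_aut n i j)"
    if ij: "2 \<le> i \<and> i \<le> n \<and> 1 \<le> j \<and> j \<le> i" for i j
  proof -
    have y: "y_aut n i j \<in> carrier ?G"
      using ij by (intro y_aut_in_Aut) auto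
    \<comment> \<open>Needed in all degrees: the trivial components of \<open>homogeneous\<close>
      are themselves the subgroups of the next degree and must go to the corresponding Johnson
      terms.\<close>
    have one: "\<one>\<^bsub>?G\<^esub> \<in> ?N (Suc q)" for q
      using subgroup.one_closed[OF J_lc_subgroup[of n n "Suc q"]] by (simp add: I_sub_eq)
    have "?M (Suc q) <#>\<^bsub>?G\<^esub> ?N (Suc q) = ?M (Suc q)" for q
    proof -
      have "?N (Suc q) #>\<^bsub>?G\<^esub> \<one>\<^bsub>?G\<^esub> = ?N (Suc q)"
        using sub[of "Suc q"] M.mem_carrier[of "Suc q"] by (intro A.coset_mult_one) auto
      then show ?thesis
        using abs[OF one sub[of "Suc q"] A.one_closed] M.rcos_one[of "Suc q"] by simp
    qed
    moreover have "?M (Suc 1) <#>\<^bsub>?G\<^esub> (?N 2 #>\<^bsub>?G\<^esub> y_aut n i j) = IA n 3 #>\<^bsub>?G\<^esub> y_aut n i j"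
      using abs[OF one[of 1] sub[of "Suc 1"] y]
      by (simp add: Johnson_filtration_def numeral_2_eq_2 numeral_3_eq_3 One_nat_def)
    ultimately show ?thesis
      by (auto simp: \<zeta>_def homogeneous_def fun_eq_iff)
  qed
  ultimately show ?thesis by blast
qed

end
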